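(* Let $\mathcal A=\mathbb R[R,S,F]$ be a graded Laplacian algebra on a Euclidean space, where $R=|z|^2$ and $S$ are independent quadratic generators and $F$ is a homogeneous generator of degree $e>2$ with $F\notin\mathbb R[R,S]$. After an orthogonal change of coordinates and a linear change of $R,S$, its quadratic part is generated by $u=|x|^2$, $v=|y|^2$, where $z=(x,y)$, $x\in\mathbb R^p$, $y\in\mathbb R^q$. There is a radial polynomial $H(u,v)$ such that $P=F-H$ is bihomogeneous in $(x,y)$ of some bidegree $(a,b)$, $a+b=e$, and $\Delta_xP=\Delta_yP=0$. Suppose that $p,q\ge2$ and both bidegrees $a,b$ are positive. Then closure (that is, the condition that $\mathbb R[u,v,P]$ be a Laplacian algebra, for $P$ nonzero, bihomogeneous of bidegree $(a,b)$ and separately harmonic) is equivalent to the identities $$|\nabla_xP|^2=a^2\bigl(Ku^{a-1}v^b+Lu^{a/2-1}v^{b/2}P\bigr),$$ $$|\nabla_yP|^2=b^2\bigl(Ku^av^{b-1}+Lu^{a/2}v^{b/2-1}P\bigr),$$ for constants $K>0$ and $L\in\mathbb R$, where the terms involving $L$ are omitted unless $a,b$ are both even. Necessarily $$\frac{p-2}{a}=\frac{q-2}{b}.$$ In particular, $P$ restricts to an isoparametric function on $S^{p-1}\times S^{q-1}$.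
   Context: A Laplacian algebra is a graded polynomial algebra (containing the homogeneous components of each of its elements) that contains the squared radius $|z|^2$ and is closed under the Euclidean Laplacian $\Delta$. $\nabla_x,\Delta_x$ (resp. $\nabla_y,\Delta_y$) denote the gradient and Laplacian in the $x$ (resp. $y$) variables. Independent quadratic generators means linearly independent quadratic forms. A function $f$ on a Riemannian manifold is isoparametric if $|\nabla f|^2$ and $\Delta f$ are functions of $f$; $S^{p-1}\times S^{q-1}$ is the product of unit spheres. *)

theory Defs
  imports "HOL-Analysis.Analysis"
begin

text \<open>Polynomials on a Euclidean space are treated as polynomial functions
  (\<^const>\<open>real_polynomial_function\<close>); over the reals nothing is lost.\<close>

definition homogeneous_poly :: "nat \<Rightarrow> ('a::euclidean_space \<Rightarrow> real) \<Rightarrow> bool" where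
  "homogeneous_poly d f \<longleftrightarrow>
     real_polynomial_function f \<and> (\<forall>t z. f (t *\<^sub>R z) = t ^ d * f z)"

text \<open>The unital real algebra \<open>\<real>[G]\<close> generated by a set of functions \<open>G\<close>; the generators
  need not be algebraically independent.\<close>

inductive_set generated_algebra :: "('a \<Rightarrow> real) set \<Rightarrow> ('a \<Rightarrow> real) set"
  for G :: "('a \<Rightarrow> real) set" where
  const: "(\<lambda>z. c) \<in> generated_algebra G"
| gen: "f \<in> G \<Longrightarrow> f \<in> generated_algebra G"
| add: "f \<in> generated_algebra G \<Longrightarrow> g \<in> generated_algebra G \<Longrightarrow>
          (\<lambda>z. f z + g z) \<in> generated_algebra G"
| mult: "f \<in> generated_algebra G \<Longrightarrow> g \<in> generated_algebra G \<Longrightarrow>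
          (\<lambda>z. f z * g z) \<in> generated_algebra G"

text \<open>A splitting \<open>z = (x, y)\<close> of the coordinates is given by a set \<open>B\<close> of standard basis
  vectors: \<open>x\<close> collects the coordinates in \<open>B\<close>, \<open>y\<close> those in \<open>Basis - B\<close>, so that
  \<open>p = card B\<close> and \<open>q = card (Basis - B)\<close>. The gradient and the Laplacian below are taken
  in the coordinates from \<open>B\<close>; for \<open>B = Basis\<close> they are the full Euclidean ones.\<close>

definition part :: "'a::euclidean_space set \<Rightarrow> 'a \<Rightarrow> 'a" where
  "part B z = (\<Sum>b\<in>B. (z \<bullet> b) *\<^sub>R b)"

definition sqrad :: "'a::euclidean_space set \<Rightarrow> 'a \<Rightarrow> real" where
  "sqrad B z = (norm (part B z))\<^sup>2"

definition partial_deriv :: "'a::euclidean_space \<Rightarrow> ('a \<Rightarrow> real) \<Rightarrow> 'a \<Rightarrow> real" where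
  "partial_deriv b f z = frechet_derivative f (at z) b"

definition grad :: "'a::euclidean_space set \<Rightarrow> ('a \<Rightarrow> real) \<Rightarrow> 'a \<Rightarrow> 'a" where
  "grad B f z = (\<Sum>b\<in>B. partial_deriv b f z *\<^sub>R b)"

definition laplacian :: "'a::euclidean_space set \<Rightarrow> ('a \<Rightarrow> real) \<Rightarrow> 'a \<Rightarrow> real" where
  "laplacian B f z = (\<Sum>b\<in>B. partial_deriv b (partial_deriv b f) z)"

definition bihomogeneous_poly ::
  "'a::euclidean_space set \<Rightarrow> nat \<Rightarrow> nat \<Rightarrow> ('a \<Rightarrow> real) \<Rightarrow> bool" where
  "bihomogeneous_poly B a b f \<longleftrightarrow>
     real_polynomial_function f \<and>
     (\<forall>s t z. f (s *\<^sub>R part B z + t *\<^sub>R part (Basis - B) z) = s ^ a * t ^ b * f z)"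

text \<open>The fifth clause is the grading: whenever an element is written as a sum of homogeneous
  polynomials of degrees \<open>0, \<dots>, N\<close> (such a decomposition exists and is unique), the summands
  belong to the algebra.\<close>

definition laplacian_algebra :: "('a::euclidean_space \<Rightarrow> real) set \<Rightarrow> bool" where
  "laplacian_algebra A \<longleftrightarrow>
     (\<forall>f\<in>A. real_polynomial_function f) \<and>
     (\<forall>c. (\<lambda>z. c) \<in> A) \<and>
     (\<forall>f\<in>A. \<forall>g\<in>A. (\<lambda>z. f z + g z) \<in> A) \<and>
     (\<forall>f\<in>A. \<forall>g\<in>A. (\<lambda>z. f z * g z) \<in> A) \<and>
     (\<forall>f\<in>A. \<forall>N h. (\<forall>d\<le>N. homogeneous_poly d (h d)) \<and> f = (\<lambda>z. \<Sum>d\<le>N. h d z)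
        \<longrightarrow> (\<forall>d\<le>N. h d \<in> A)) \<and>
     (\<lambda>z. (norm z)\<^sup>2) \<in> A \<and>
     (\<forall>f\<in>A. laplacian Basis f \<in> A)"

text \<open>Riemannian gradient and Laplace--Beltrami operator on a submanifold \<open>M\<close> of a Euclidean
  space with the induced metric. Only the values on \<open>M\<close> matter: a derivative within \<open>M\<close> is
  determined exactly on the tangent vectors of \<open>M\<close>. As the Levi-Civita connection of \<open>M\<close> is the
  tangential part of the ambient directional derivative, the divergence of a tangent field \<open>G\<close> is
  the sum of \<open>G' e \<bullet> e\<close> over an orthonormal basis of the tangent space, \<open>G'\<close> being the derivative
  of \<open>G\<close> within \<open>M\<close>.\<close>

definition tangent_vectors :: "'a::euclidean_space set \<Rightarrow> 'a \<Rightarrow> 'a set" where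
  "tangent_vectors M z =
     {w. \<exists>\<gamma>. \<gamma> 0 = z \<and> (\<forall>\<^sub>F t in nhds 0. \<gamma> t \<in> M) \<and> (\<gamma> has_vector_derivative w) (at (0::real))}"

definition riemannian_gradient ::
  "'a::euclidean_space set \<Rightarrow> ('a \<Rightarrow> real) \<Rightarrow> ('a \<Rightarrow> 'a) \<Rightarrow> bool" where
  "riemannian_gradient M f G \<longleftrightarrow>
     (\<forall>z\<in>M. G z \<in> tangent_vectors M z \<and> (f has_derivative (\<lambda>h. G z \<bullet> h)) (at z within M))"

definition riemannian_divergence ::
  "'a::euclidean_space set \<Rightarrow> ('a \<Rightarrow> 'a) \<Rightarrow> ('a \<Rightarrow> real) \<Rightarrow> bool" where
  "riemannian_divergence M G D \<longleftrightarrow>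
     (\<forall>z\<in>M. \<exists>G' E. (G has_derivative G') (at z within M) \<and>
        pairwise orthogonal E \<and> (\<forall>e\<in>E. norm e = 1) \<and> span E = tangent_vectors M z \<and>
        D z = (\<Sum>e\<in>E. G' e \<bullet> e))"

definition isoparametric_on :: "'a::euclidean_space set \<Rightarrow> ('a \<Rightarrow> real) \<Rightarrow> bool" where
  "isoparametric_on M f \<longleftrightarrow>
     (\<exists>G D \<phi> \<psi>. riemannian_gradient M f G \<and> riemannian_divergence M G D \<and>
        (\<forall>z\<in>M. (norm (G z))\<^sup>2 = \<phi> (f z) \<and> D z = \<psi> (f z)))"

definition sphere_product :: "'a::euclidean_space set \<Rightarrow> 'a set" where
  "sphere_product B = {z. norm (part B z) = 1 \<and> norm (part (Basis - B) z) = 1}"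

end

theory Submission
  imports Defs
begin

text \<open>Write \<open>u = |x|\<^sup>2\<close>, \<open>v = |y|\<^sup>2\<close>, and let \<open>p\<close>, \<open>q\<close> be the numbers of \<open>x\<close>- and \<open>y\<close>-coordinates. The whole
argument is algebraic; it rests on the Leibniz rule
\<open>\<Delta>(f g) = f \<Delta>g + g \<Delta>f + 2 \<nabla>f \<cdot> \<nabla>g\<close> and on comparing homogeneous components.

Structure of the algebra. Closure applied to \<open>S\<^sup>2\<close> puts \<open>|\<nabla>S|\<^sup>2\<close> into the quadratic part, which is
spanned by \<open>R\<close> and \<open>S\<close>. Hence the symmetric operator of \<open>S\<close> satisfies a quadratic equation, has exactly two
eigenvalues, and \<open>u\<close>, \<open>v\<close> are the squared lengths of the projections to its eigenspaces
(\<open>two_eigenvalue_diagonalization\<close>). Closure applied to \<open>u F\<close> makes the algebra stable under the Euler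
operator \<open>E = x \<cdot> \<nabla>\<^sub>x\<close>, so that \<open>E F = \<lambda> F + h\<close> with a radial polynomial \<open>h\<close>. The component \<open>F\<^sub>i\<close> of degree
\<open>i\<close> in \<open>x\<close> satisfies \<open>(i - \<lambda>) F\<^sub>i = h\<^sub>i\<close>; all components but one are therefore radial, and the remaining
one, \<open>F\<^sub>a\<close>, is bihomogeneous. Its partial Laplacians have too low a degree to involve \<open>F\<close>, so they are multiples
of radial monomials. Subtracting a multiple of \<open>u\<^bsup>a/2\<^esup> v\<^bsup>b/2\<^esup>\<close> removes one of them, and then the other one vanishes
because \<open>\<Delta>\<^sub>x\<close> and \<open>\<Delta>\<^sub>y\<close> commute (\<open>separately_harmonic_generator\<close>).

Gradient identities. If \<open>\<real>[u, v, P]\<close> is closed, then \<open>|\<nabla>\<^sub>xP|\<^sup>2 + |\<nabla>\<^sub>yP|\<^sup>2 = \<Delta>(P\<^sup>2) / 2\<close> lies in it, hence so do both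
summands, which have different bidegrees. At most two monomials in \<open>u\<close>, \<open>v\<close>, \<open>P\<close> have the bidegree
\<open>(2a - 2, 2b)\<close>, which gives the first identity with constants \<open>K\<close>, \<open>L\<close>, and the second one with constants
\<open>K'\<close>, \<open>L'\<close> (\<open>grad_sq_form\<close>). Three facts finish this direction.

\<^item> The expressions \<open>\<nabla>\<^sub>y|\<nabla>\<^sub>xP|\<^sup>2 \<cdot> \<nabla>\<^sub>yP\<close> and \<open>\<nabla>\<^sub>x|\<nabla>\<^sub>yP|\<^sup>2 \<cdot> \<nabla>\<^sub>xP\<close> are both twice the mixed Hessian evaluated at the two
gradients. Inserting the identities gives a homogeneous quadratic relation between \<open>P\<close> and
\<open>W = u\<^bsup>a/2\<^esup> v\<^bsup>b/2\<^esup>\<close>. As \<open>W\<close> is not harmonic, \<open>P\<close> is not a multiple of it, so the relation is trivial: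
\<open>K = K'\<close> and \<open>L = L'\<close> (\<open>constants_agree\<close>).
\<^item> Likewise \<open>\<Delta>\<^sub>y|\<nabla>\<^sub>xP|\<^sup>2 = \<Delta>\<^sub>x|\<nabla>\<^sub>yP|\<^sup>2\<close>, and this relation forces \<open>(p - 2)/a = (q - 2)/b\<close>
(\<open>dimensions_proportional\<close>).
\<^item> Applying \<open>\<Delta>\<^sub>x\<close> to \<open>|\<nabla>\<^sub>xP|\<^sup>2\<close> repeatedly turns the left side into sums of squares of higher derivatives of the
harmonic \<open>P\<close>, and on the right it annihilates the term with \<open>L\<close> before the one with \<open>K\<close>. What remains is
\<open>K\<close> times a positive multiple of \<open>v\<^sup>b\<close>, so \<open>K > 0\<close> (\<open>K_pos\<close>).

Conversely, the identities say that the gradient pairings of the generators stay in the algebra, and the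
Leibniz rule extends this to all elements (\<open>generated_algebra_laplacian_closed\<close>). On the product of spheres
\<open>u = v = 1\<close> the Riemannian gradient of \<open>P\<close> is \<open>\<nabla>P - a P x - b P y\<close>; its squared norm and its divergence are
functions of \<open>P\<close> by the identities and Euler's relation.\<close>

section \<open>Calculus of polynomial functions\<close>

abbreviation polyfun :: "('a::real_normed_vector \<Rightarrow> real) \<Rightarrow> bool" where
  "polyfun \<equiv> real_polynomial_function"

abbreviation euler_op :: "'a::euclidean_space set \<Rightarrow> ('a \<Rightarrow> real) \<Rightarrow> 'a \<Rightarrow> real" where
  "euler_op B f z \<equiv> \<Sum>b\<in>B. (z \<bullet> b) * partial_deriv b f z"

abbreviation grad_pairing ::
  "'a::euclidean_space set \<Rightarrow> ('a \<Rightarrow> real) \<Rightarrow> ('a \<Rightarrow> real) \<Rightarrow> 'a \<Rightarrow> real" where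
  "grad_pairing B f g z \<equiv> \<Sum>b\<in>B. partial_deriv b f z * partial_deriv b g z"

lemmas polyfun_const = real_polynomial_function.intros(2)
lemmas polyfun_add = real_polynomial_function.intros(3)
lemmas polyfun_mult = real_polynomial_function.intros(4)

lemma polyfun_has_derivative:
  fixes f :: "'a::euclidean_space \<Rightarrow> real"
  assumes "polyfun f"
  shows "(f has_derivative (\<lambda>h. \<Sum>b\<in>Basis. (h \<bullet> b) * partial_deriv b f z)) (at z)"
proof -
  have D: "(f has_derivative frechet_derivative f (at z)) (at z)"
    using assms differentiable_at_real_polynomial_function frechet_derivative_works by blast
  have "frechet_derivative f (at z) = (\<lambda>h. \<Sum>b\<in>Basis. (h \<bullet> b) * partial_deriv b f z)"
  proof
    fix h :: 'a
    have "frechet_derivative f (at z) h =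
        frechet_derivative f (at z) (\<Sum>b\<in>Basis. (h \<bullet> b) *\<^sub>R b)"
      by (simp add: euclidean_representation)
    also have "\<dots> = (\<Sum>b\<in>Basis. (h \<bullet> b) * partial_deriv b f z)"
      using has_derivative_linear[OF D]
      by (simp add: linear_sum linear_cmul partial_deriv_def)
    finally show "frechet_derivative f (at z) h = (\<Sum>b\<in>Basis. (h \<bullet> b) * partial_deriv b f z)" .
  qed
  with D show ?thesis by simp
qed

lemma has_derivative_frechet_derivative_polynomial:
  fixes f :: "'a::euclidean_space \<Rightarrow> real"
  assumes "polyfun f"
  shows "(f has_derivative frechet_derivative f (at z)) (at z)"
  using assms differentiable_at_real_polynomial_function frechet_derivative_works by blast

lemma partial_deriv_eqI:
  "(f has_derivative f') (at z) \<Longrightarrow> partial_deriv b f z = f' b"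
  by (metis frechet_derivative_at partial_deriv_def)

lemma partial_deriv_const [simp]: "partial_deriv b (\<lambda>z. c) = (\<lambda>z. 0)"
  by (simp add: partial_deriv_def fun_eq_iff)

lemma partial_deriv_linear: "bounded_linear f \<Longrightarrow> partial_deriv b f = (\<lambda>z. f b)"
  by (intro ext partial_deriv_eqI bounded_linear_imp_has_derivative)

lemma partial_deriv_add:
  fixes f g :: "'a::euclidean_space \<Rightarrow> real"
  assumes "polyfun f" "polyfun g"
  shows "partial_deriv b (\<lambda>z. f z + g z) = (\<lambda>z. partial_deriv b f z + partial_deriv b g z)"
  using partial_deriv_eqI[OF has_derivative_add[OF assms[THEN has_derivative_frechet_derivative_polynomial]]]
  by (simp add: fun_eq_iff partial_deriv_def)

lemma partial_deriv_mult:
  fixes f g :: "'a::euclidean_space \<Rightarrow> real"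
  assumes "polyfun f" "polyfun g"
  shows "partial_deriv b (\<lambda>z. f z * g z) = (\<lambda>z. f z * partial_deriv b g z + partial_deriv b f z * g z)"
  using partial_deriv_eqI[OF has_derivative_mult[OF assms[THEN has_derivative_frechet_derivative_polynomial]]]
  by (simp add: fun_eq_iff partial_deriv_def)

lemma partial_deriv_cmult:
  fixes f :: "'a::euclidean_space \<Rightarrow> real"
  assumes "polyfun f"
  shows "partial_deriv b (\<lambda>z. c * f z) = (\<lambda>z. c * partial_deriv b f z)"
  using partial_deriv_mult[OF polyfun_const[of c] assms, of b] by simp

lemma partial_deriv_sum:
  fixes f :: "'i \<Rightarrow> 'a::euclidean_space \<Rightarrow> real"
  assumes "finite I" "\<And>i. i \<in> I \<Longrightarrow> polyfun (f i)"
  shows "partial_deriv b (\<lambda>z. \<Sum>i\<in>I. f i z) = (\<lambda>z. \<Sum>i\<in>I. partial_deriv b (f i) z)"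
  using assms
proof (induction I rule: finite_induct)
  case (insert i I)
  then show ?case
    using partial_deriv_add[of "f i" "\<lambda>z. \<Sum>i\<in>I. f i z" b] real_polynomial_function_sum[of I "\<lambda>x i. f i x"]
    by simp
qed simp

lemma partial_deriv_diff:
  fixes f g :: "'a::euclidean_space \<Rightarrow> real"
  assumes "polyfun f" "polyfun g"
  shows "partial_deriv b (\<lambda>z. f z - g z) = (\<lambda>z. partial_deriv b f z - partial_deriv b g z)"
  using partial_deriv_add[OF assms(1) polyfun_mult[OF polyfun_const[of "-1"] assms(2)], of b]
    partial_deriv_cmult[OF assms(2), of b "-1"]
  by simp

lemma polyfun_partial_deriv:
  fixes f :: "'a::euclidean_space \<Rightarrow> real"
  assumes "polyfun f"
  shows "polyfun (partial_deriv b f)"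
  using assms
proof (induction f rule: real_polynomial_function.induct)
  case (linear f)
  then show ?case by (simp add: partial_deriv_linear polyfun_const)
next
  case (const c)
  then show ?case by (simp add: polyfun_const)
next
  case (add f g)
  then show ?case by (simp add: partial_deriv_add polyfun_add)
next
  case (mult f g)
  then show ?case
    by (simp add: partial_deriv_mult polyfun_add polyfun_mult)
qed

lemmas polynomial_intros = polyfun_const polyfun_add
  polyfun_mult real_polynomial_function_diff real_polynomial_function_power
  polyfun_partial_deriv

lemma partial_deriv_commute:
  fixes f :: "'a::euclidean_space \<Rightarrow> real"
  assumes "polyfun f"
  shows "partial_deriv b (partial_deriv c f) = partial_deriv c (partial_deriv b f)"
  using assms
proof (induction f rule: real_polynomial_function.induct)
  case (linear f)
  then show ?case by (simp add: partial_deriv_linear)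
next
  case (const c)
  then show ?case by simp
next
  case (add f g)
  then show ?case by (simp add: partial_deriv_add polynomial_intros)
next
  case (mult f g)
  then show ?case
    by (simp add: partial_deriv_add partial_deriv_mult polynomial_intros algebra_simps)
qed

lemma grad_inner_grad:
  assumes "B \<subseteq> Basis"
  shows "grad B f z \<bullet> grad B g z = (grad_pairing B f g z)"
proof -
  have fin: "finite B" using assms finite_Basis finite_subset by blast
  have "grad B f z \<bullet> grad B g z =
      (\<Sum>b\<in>B. \<Sum>c\<in>B. partial_deriv b f z * (partial_deriv c g z * (b \<bullet> c)))"
    by (simp add: grad_def inner_sum_left inner_sum_right sum_distrib_left)
       (subst sum.swap, simp add: inner_commute mult_ac)
  also have "\<dots> = (\<Sum>b\<in>B. \<Sum>c\<in>B. if c = b then partial_deriv b f z * partial_deriv b g z else 0)"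
    using assms by (intro sum.cong refl) (auto simp: inner_Basis subset_iff)
  also have "\<dots> = (grad_pairing B f g z)"
    using fin by simp
  finally show ?thesis .
qed

lemma norm_grad_squared:
  assumes "B \<subseteq> Basis"
  shows "(norm (grad B f z))\<^sup>2 = (\<Sum>b\<in>B. (partial_deriv b f z)\<^sup>2)"
  using grad_inner_grad[OF assms, of f z f] unfolding power2_norm_eq_inner by (simp add: power2_eq_square)

lemma laplacian_const [simp]: "laplacian B (\<lambda>z. c) = (\<lambda>z. 0)"
  by (simp add: laplacian_def fun_eq_iff)

lemma laplacian_add:
  fixes f g :: "'a::euclidean_space \<Rightarrow> real"
  assumes "polyfun f" "polyfun g"
  shows "laplacian B (\<lambda>z. f z + g z) = (\<lambda>z. laplacian B f z + laplacian B g z)"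
  using assms
  by (simp add: laplacian_def fun_eq_iff partial_deriv_add polynomial_intros sum.distrib)

lemma laplacian_cmult:
  fixes f :: "'a::euclidean_space \<Rightarrow> real"
  assumes "polyfun f"
  shows "laplacian B (\<lambda>z. c * f z) = (\<lambda>z. c * laplacian B f z)"
  using assms
  by (simp add: laplacian_def fun_eq_iff partial_deriv_cmult polynomial_intros sum_distrib_left)

lemma laplacian_diff:
  fixes f g :: "'a::euclidean_space \<Rightarrow> real"
  assumes "polyfun f" "polyfun g"
  shows "laplacian B (\<lambda>z. f z - g z) = (\<lambda>z. laplacian B f z - laplacian B g z)"
  using assms
  by (simp add: laplacian_def fun_eq_iff partial_deriv_diff polynomial_intros sum_subtractf)

lemma laplacian_sum:
  fixes f :: "'i \<Rightarrow> 'a::euclidean_space \<Rightarrow> real"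
  assumes "finite I" "\<And>i. i \<in> I \<Longrightarrow> polyfun (f i)"
  shows "laplacian B (\<lambda>z. \<Sum>i\<in>I. f i z) = (\<lambda>z. \<Sum>i\<in>I. laplacian B (f i) z)"
proof -
  have "(\<Sum>b\<in>B. partial_deriv b (partial_deriv b (\<lambda>z. \<Sum>i\<in>I. f i z)) z) =
      (\<Sum>b\<in>B. \<Sum>i\<in>I. partial_deriv b (partial_deriv b (f i)) z)" for z
    using assms by (simp add: partial_deriv_sum polyfun_partial_deriv)
  then show ?thesis
    unfolding laplacian_def fun_eq_iff using sum.swap[of _ I B] by auto
qed

lemma laplacian_mult:
  fixes f g :: "'a::euclidean_space \<Rightarrow> real"
  assumes "polyfun f" "polyfun g"
  shows "laplacian B (\<lambda>z. f z * g z) = (\<lambda>z. f z * laplacian B g z + laplacian B f z * g z +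
    2 * (grad_pairing B f g z))"
  using assms
  by (simp add: laplacian_def fun_eq_iff partial_deriv_mult partial_deriv_add polynomial_intros
      sum.distrib sum_distrib_left sum_distrib_right algebra_simps)

lemma laplacian_partial_deriv:
  fixes f :: "'a::euclidean_space \<Rightarrow> real"
  assumes "polyfun f" "B \<subseteq> Basis"
  shows "laplacian B (partial_deriv c f) = partial_deriv c (laplacian B f)"
proof -
  have "finite B" using assms(2) finite_Basis finite_subset by blast
  then have "partial_deriv c (laplacian B f) =
      (\<lambda>z. \<Sum>b\<in>B. partial_deriv c (partial_deriv b (partial_deriv b f)) z)"
    unfolding laplacian_def using assms(1)
    by (intro partial_deriv_sum) (auto intro!: polynomial_intros)
  then show ?thesis
    using assms(1) by (simp add: laplacian_def fun_eq_iff partial_deriv_commute[of _ _ c] polynomial_intros)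
qed

lemma laplacian_split:
  assumes "B \<subseteq> Basis"
  shows "laplacian Basis f z = laplacian B f z + laplacian (Basis - B) f z"
  unfolding laplacian_def using sum.subset_diff[OF assms finite_Basis] by (simp add: add.commute)

lemma sum_Basis_split:
  assumes "B \<subseteq> Basis"
  shows "(\<Sum>b\<in>Basis. h b) = (\<Sum>b\<in>B. h b) + (\<Sum>b\<in>Basis - B. h b :: real)"
  using sum.subset_diff[OF assms finite_Basis] by (simp add: add.commute)

section \<open>Dilations of a block of coordinates\<close>

text \<open>For \<open>B = Basis\<close> this is scalar multiplication, so the notion of homogeneity below covers the total
degree as well as the degrees in \<open>x\<close> and in \<open>y\<close>.\<close>

definition dilate :: "'a::euclidean_space set \<Rightarrow> real \<Rightarrow> 'a \<Rightarrow> 'a" where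
  "dilate B s z = s *\<^sub>R part B z + part (Basis - B) z"

definition homogeneous_in :: "'a::euclidean_space set \<Rightarrow> nat \<Rightarrow> ('a \<Rightarrow> real) \<Rightarrow> bool" where
  "homogeneous_in B d f \<longleftrightarrow> (\<forall>s z. f (dilate B s z) = s ^ d * f z)"

lemma part_inner_Basis:
  assumes "B \<subseteq> Basis" "b \<in> Basis"
  shows "part B z \<bullet> b = (if b \<in> B then z \<bullet> b else 0)"
proof -
  have "finite B" using assms(1) finite_Basis finite_subset by blast
  moreover have "part B z \<bullet> b = (\<Sum>c\<in>B. if c = b then z \<bullet> b else 0)"
    unfolding part_def inner_sum_left using assms
    by (intro sum.cong refl) (auto simp: inner_Basis subset_iff)
  ultimately show ?thesis by simp
qed

lemma part_complement: "B \<subseteq> Basis \<Longrightarrow> part (Basis - B) z = z - part B z"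
  by (rule euclidean_eqI) (auto simp: part_inner_Basis inner_diff_left)

lemma linear_part: "linear (part B)"
  unfolding part_def[abs_def]
  by (intro linear_compose_sum ballI linearI) (simp_all add: inner_add_left scaleR_add_left)

lemma dilate_inner_Basis:
  assumes "B \<subseteq> Basis" "b \<in> Basis"
  shows "dilate B s z \<bullet> b = (if b \<in> B then s * (z \<bullet> b) else z \<bullet> b)"
  using assms by (simp add: dilate_def inner_add_left part_inner_Basis)

lemma bounded_linear_dilate: "bounded_linear (dilate B s)"
  unfolding linear_conv_bounded_linear[symmetric] dilate_def[abs_def]
  by (intro linear_compose_add linear_compose_scale_right linear_part)

lemma dilate_dilate: "B \<subseteq> Basis \<Longrightarrow> dilate B s (dilate B r z) = dilate B (s * r) z"
  by (rule euclidean_eqI) (auto simp: dilate_inner_Basis)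

lemma dilate_one: "B \<subseteq> Basis \<Longrightarrow> dilate B 1 z = z"
  by (rule euclidean_eqI) (auto simp: dilate_inner_Basis)

lemma dilate_Basis: "dilate Basis s z = s *\<^sub>R z"
  by (rule euclidean_eqI) (auto simp: dilate_inner_Basis)

lemma dilate_commute:
  "B \<subseteq> Basis \<Longrightarrow> C \<subseteq> Basis \<Longrightarrow> dilate B s (dilate C t z) = dilate C t (dilate B s z)"
  by (rule euclidean_eqI) (auto simp: dilate_inner_Basis)

lemma dilate_complement:
  "B \<subseteq> Basis \<Longrightarrow> dilate B s (dilate (Basis - B) t z) = s *\<^sub>R part B z + t *\<^sub>R part (Basis - B) z"
  by (rule euclidean_eqI) (auto simp: dilate_inner_Basis part_inner_Basis inner_add_left)

lemma dilate_both:
  "B \<subseteq> Basis \<Longrightarrow> dilate B s (dilate (Basis - B) s z) = s *\<^sub>R z"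
  by (rule euclidean_eqI) (auto simp: dilate_inner_Basis)

lemma homogeneous_poly_iff:
  "homogeneous_poly d f \<longleftrightarrow> polyfun f \<and> homogeneous_in Basis d f"
  by (simp add: homogeneous_poly_def homogeneous_in_def dilate_Basis)

lemma bihomogeneous_poly_iff:
  assumes "B \<subseteq> Basis"
  shows "bihomogeneous_poly B a b f \<longleftrightarrow>
    polyfun f \<and> homogeneous_in B a f \<and> homogeneous_in (Basis - B) b f"
proof -
  have "(\<forall>s t z. f (dilate B s (dilate (Basis - B) t z)) = s ^ a * t ^ b * f z) \<longleftrightarrow>
    homogeneous_in B a f \<and> homogeneous_in (Basis - B) b f" (is "?l \<longleftrightarrow> ?r")
  proof
    assume l: ?l
    have "f (dilate B s z) = s ^ a * f z" "f (dilate (Basis - B) s z) = s ^ b * f z" for s z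
      using l[rule_format, of s 1 z] l[rule_format, of 1 s z] assms by (simp_all add: dilate_one)
    then show ?r by (simp add: homogeneous_in_def)
  qed (simp add: homogeneous_in_def)
  then show ?thesis
    using assms by (simp add: bihomogeneous_poly_def dilate_complement)
qed

lemma homogeneous_in_const: "homogeneous_in B 0 (\<lambda>z. c)"
  by (simp add: homogeneous_in_def)

lemma homogeneous_in_mult:
  "homogeneous_in B d f \<Longrightarrow> homogeneous_in B e g \<Longrightarrow> homogeneous_in B (d + e) (\<lambda>z. f z * g z)"
  by (simp add: homogeneous_in_def power_add)

lemma homogeneous_in_cmult: "homogeneous_in B d f \<Longrightarrow> homogeneous_in B d (\<lambda>z. c * f z)"
  by (simp add: homogeneous_in_def)

lemma homogeneous_in_power: "homogeneous_in B d f \<Longrightarrow> homogeneous_in B (d * n) (\<lambda>z. f z ^ n)"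
  by (simp add: homogeneous_in_def power_mult power_mult_distrib)

lemma homogeneous_in_add:
  "homogeneous_in B d f \<Longrightarrow> homogeneous_in B d g \<Longrightarrow> homogeneous_in B d (\<lambda>z. f z + g z)"
  by (simp add: homogeneous_in_def distrib_left)

lemma homogeneous_in_diff:
  "homogeneous_in B d f \<Longrightarrow> homogeneous_in B d g \<Longrightarrow> homogeneous_in B d (\<lambda>z. f z - g z)"
  by (simp add: homogeneous_in_def right_diff_distrib)

lemma homogeneous_in_sum:
  "(\<And>i. i \<in> I \<Longrightarrow> homogeneous_in B d (f i)) \<Longrightarrow> homogeneous_in B d (\<lambda>z. \<Sum>i\<in>I. f i z)"
  by (simp add: homogeneous_in_def sum_distrib_left)

lemma polyfun_continuous_on:
  "polyfun f \<Longrightarrow> continuous_on S f"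
  using continuous_on_polymonial_function real_polynomial_function_eq by blast

text \<open>Differentiating or dividing a homogeneity relation yields it only for scaling factors other
than \<open>0\<close>; continuity supplies the remaining factor.\<close>

lemma continuous_eq_at_zero:
  fixes \<phi> \<psi> :: "real \<Rightarrow> real"
  assumes "continuous_on UNIV \<phi>" "continuous_on UNIV \<psi>" "\<And>t. t \<noteq> 0 \<Longrightarrow> \<phi> t = \<psi> t"
  shows "\<phi> t = \<psi> t"
proof (cases "t = 0")
  case True
  have "(\<phi> \<longlongrightarrow> \<phi> 0) (at 0)" "(\<psi> \<longlongrightarrow> \<psi> 0) (at 0)"
    using assms(1,2) by (auto simp: continuous_on_def)
  moreover have "(\<phi> \<longlongrightarrow> \<psi> 0) (at 0)"
    by (rule Lim_transform_eventually[OF calculation(2)])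
       (use assms(3) in \<open>auto simp: eventually_at_filter\<close>)
  ultimately show ?thesis using True tendsto_unique trivial_limit_at by blast
qed (use assms(3) in simp)

lemma continuous_on_dilate: "continuous_on UNIV (\<lambda>s. dilate B s z)"
  unfolding dilate_def by (intro continuous_intros)

lemma continuous_on_polynomial_dilate:
  assumes "polyfun f"
  shows "continuous_on UNIV (\<lambda>s. f (dilate B s z))"
  using continuous_on_compose2[OF polyfun_continuous_on[OF assms, of UNIV]
      continuous_on_dilate] by blast

lemma partial_deriv_compose_linear:
  fixes f :: "'a::euclidean_space \<Rightarrow> real"
  assumes "polyfun f" "bounded_linear L"
  shows "partial_deriv b (\<lambda>z. f (L z)) = (\<lambda>z. \<Sum>c\<in>Basis. (L b \<bullet> c) * partial_deriv c f (L z))"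
  by (intro ext partial_deriv_eqI[OF has_derivative_compose[OF
        bounded_linear_imp_has_derivative[OF assms(2)]
        polyfun_has_derivative[OF assms(1)]]])

lemma polyfun_compose_linear:
  assumes "polyfun f" "bounded_linear L"
  shows "polyfun (\<lambda>z. f (L z))"
  using real_polynomial_function_compose[OF polynomial_function_bounded_linear[OF assms(2)] assms(1)]
  by (simp add: o_def)

lemma partial_deriv_dilate:
  fixes f :: "'a::euclidean_space \<Rightarrow> real"
  assumes "polyfun f" "B \<subseteq> Basis" "b \<in> Basis"
  shows "partial_deriv b (\<lambda>z. f (dilate B s z)) z =
    (if b \<in> B then s else 1) * partial_deriv b f (dilate B s z)"
proof -
  have "partial_deriv b (\<lambda>z. f (dilate B s z)) z =
      (\<Sum>c\<in>Basis. if c = b then (if b \<in> B then s else 1) * partial_deriv b f (dilate B s z) else 0)"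
    unfolding partial_deriv_compose_linear[OF assms(1) bounded_linear_dilate]
    using assms(2,3)
    by (intro sum.cong refl) (auto simp: dilate_inner_Basis inner_Basis)
  then show ?thesis using assms(3) by simp
qed

lemma homogeneous_in_partial_deriv_complement:
  fixes f :: "'a::euclidean_space \<Rightarrow> real"
  assumes "polyfun f" "homogeneous_in B d f" "B \<subseteq> Basis" "b \<in> Basis - B"
  shows "homogeneous_in B d (partial_deriv b f)"
  unfolding homogeneous_in_def
proof (intro allI)
  fix s z
  have "(\<lambda>z. f (dilate B s z)) = (\<lambda>z. s ^ d * f z)"
    using assms(2) by (simp add: homogeneous_in_def)
  then show "partial_deriv b f (dilate B s z) = s ^ d * partial_deriv b f z"
    using partial_deriv_dilate[OF assms(1,3), of b s z] assms(1,4) by (simp add: partial_deriv_cmult)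
qed

text \<open>The truncated exponent is harmless: a function of degree \<open>0\<close> does not depend on the coordinates
in \<open>B\<close>, so its derivatives vanish.\<close>

lemma homogeneous_in_partial_deriv:
  fixes f :: "'a::euclidean_space \<Rightarrow> real"
  assumes "polyfun f" "homogeneous_in B d f" "B \<subseteq> Basis" "b \<in> B"
  shows "homogeneous_in B (d - 1) (partial_deriv b f)"
proof -
  have scale: "s * partial_deriv b f (dilate B s z) = s ^ d * partial_deriv b f z" for s z
  proof -
    have "(\<lambda>z. f (dilate B s z)) = (\<lambda>z. s ^ d * f z)"
      using assms(2) by (simp add: homogeneous_in_def)
    then show ?thesis
      using partial_deriv_dilate[OF assms(1,3), of b s z] assms(1,3,4)
      by (auto simp: partial_deriv_cmult)
  qed
  show ?thesis
  proof (cases d)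
    case 0
    then have "partial_deriv b f z = 0" for z
      using scale[of 0 z] by simp
    then show ?thesis by (simp add: homogeneous_in_def)
  next
    case (Suc n)
    have "partial_deriv b f (dilate B s z) = s ^ n * partial_deriv b f z" for s z
    proof (rule continuous_eq_at_zero[of "\<lambda>s. partial_deriv b f (dilate B s z)" "\<lambda>s. s ^ n * partial_deriv b f z" s])
      show "continuous_on UNIV (\<lambda>s. partial_deriv b f (dilate B s z))"
        by (intro continuous_on_polynomial_dilate polyfun_partial_deriv assms)
      show "continuous_on UNIV (\<lambda>s. s ^ n * partial_deriv b f z)"
        by (intro continuous_intros)
      show "partial_deriv b f (dilate B t z) = t ^ n * partial_deriv b f z" if "t \<noteq> 0" for t
        using scale[of t z] Suc that by simp
    qed
    then show ?thesis by (simp add: homogeneous_in_def Suc)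
  qed
qed

lemma homogeneous_in_laplacian:
  fixes f :: "'a::euclidean_space \<Rightarrow> real"
  assumes "polyfun f" "homogeneous_in B d f" "B \<subseteq> Basis"
  shows "homogeneous_in B (d - 2) (laplacian B f)"
proof -
  have "homogeneous_in B (d - 1 - 1) (partial_deriv b (partial_deriv b f))" if "b \<in> B" for b
    using assms that
    by (intro homogeneous_in_partial_deriv polyfun_partial_deriv) auto
  then show ?thesis
    unfolding laplacian_def
    by (intro homogeneous_in_sum) (simp add: diff_diff_left numeral_2_eq_2)
qed

lemma homogeneous_in_laplacian_complement:
  fixes f :: "'a::euclidean_space \<Rightarrow> real"
  assumes "polyfun f" "homogeneous_in B d f" "B \<subseteq> Basis"
  shows "homogeneous_in B d (laplacian (Basis - B) f)"
  unfolding laplacian_def using assms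
  by (intro homogeneous_in_sum homogeneous_in_partial_deriv_complement
      polyfun_partial_deriv)

lemma euler_homogeneous:
  fixes f :: "'a::euclidean_space \<Rightarrow> real"
  assumes "polyfun f" "homogeneous_in B d f" "B \<subseteq> Basis"
  shows "(euler_op B f z) = real d * f z"
proof -
  have fin: "finite B" using assms(3) finite_Basis finite_subset by blast
  have "((\<lambda>s. dilate B s z) has_derivative (\<lambda>h. h *\<^sub>R part B z)) (at 1)"
    unfolding dilate_def by (auto intro!: derivative_eq_intros)
  from has_derivative_compose[OF this, of f "\<lambda>h. \<Sum>b\<in>Basis. (h \<bullet> b) * partial_deriv b f z"]
  have "((\<lambda>s. f (dilate B s z)) has_derivative
      (\<lambda>h. \<Sum>b\<in>Basis. (h *\<^sub>R part B z \<bullet> b) * partial_deriv b f z)) (at 1)"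
    using polyfun_has_derivative[OF assms(1), of z] assms(3)
    by (simp add: dilate_one)
  moreover have "(\<Sum>b\<in>Basis. (h *\<^sub>R part B z \<bullet> b) * partial_deriv b f z) =
      (euler_op B f z) * h" for h
  proof -
    have "(\<Sum>b\<in>Basis. (h *\<^sub>R part B z \<bullet> b) * partial_deriv b f z) =
        (\<Sum>b\<in>Basis. if b \<in> B then h * (z \<bullet> b) * partial_deriv b f z else 0)"
      using assms(3) by (intro sum.cong) (auto simp: part_inner_Basis)
    also have "\<dots> = (\<Sum>b\<in>B. h * (z \<bullet> b) * partial_deriv b f z)"
      using assms(3) by (simp add: sum.inter_restrict[symmetric] Int_absorb1)
    also have "\<dots> = (euler_op B f z) * h"
      by (subst sum_distrib_right) (simp only: mult_ac)
    finally show ?thesis .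
  qed
  ultimately have "((\<lambda>s. f (dilate B s z)) has_field_derivative
      (euler_op B f z)) (at 1)"
    by (simp add: has_field_derivative_def mult.commute[of _ "euler_op B f z"])
  moreover have "((\<lambda>s. f (dilate B s z)) has_field_derivative real d * f z) (at 1)"
    using assms(2) unfolding homogeneous_in_def by (auto intro!: derivative_eq_intros)
  ultimately show ?thesis by (rule DERIV_unique)
qed

text \<open>Scaling both blocks by \<open>t\<close> is the full scaling, which gives \<open>t\<^sup>i f(x, t y) = t\<^sup>e f(x, y)\<close>. If \<open>i > e\<close>,
dividing by \<open>t\<^sup>e\<close> and letting \<open>t\<close> tend to \<open>0\<close> makes \<open>f\<close> vanish.\<close>

lemma homogeneous_in_complement:
  fixes f :: "'a::euclidean_space \<Rightarrow> real"
  assumes poly: "polyfun f" and B: "B \<subseteq> Basis"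
    and hB: "homogeneous_in B i f" and hT: "homogeneous_in Basis e f" and nz: "f z0 \<noteq> 0"
  shows "i \<le> e" "homogeneous_in (Basis - B) (e - i) f"
proof -
  have key: "t ^ i * f (dilate (Basis - B) t z) = t ^ e * f z" for t z
  proof -
    have "t ^ i * f (dilate (Basis - B) t z) = f (dilate B t (dilate (Basis - B) t z))"
      using hB by (simp add: homogeneous_in_def)
    also have "\<dots> = t ^ e * f z"
      using hT B by (simp add: homogeneous_in_def dilate_Basis dilate_both)
    finally show ?thesis .
  qed
  show le: "i \<le> e"
  proof (rule ccontr)
    assume n: "\<not> i \<le> e"
    have "t ^ (i - e) * f (dilate (Basis - B) t z0) = f z0" for t
    proof (rule continuous_eq_at_zero[of "\<lambda>t. t ^ (i - e) * f (dilate (Basis - B) t z0)" "\<lambda>_. f z0" t])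
      show "t ^ (i - e) * f (dilate (Basis - B) t z0) = f z0" if "t \<noteq> 0" for t
      proof -
        have "t ^ e * (t ^ (i - e) * f (dilate (Basis - B) t z0)) = t ^ e * f z0"
          using key[of t z0] n by (simp add: mult.assoc[symmetric] power_add[symmetric])
        then show ?thesis using that by simp
      qed
    qed (intro continuous_intros continuous_on_polynomial_dilate poly)+
    from this[of 0] n nz show False by (simp add: power_0_left)
  qed
  have "f (dilate (Basis - B) t z) = t ^ (e - i) * f z" for t z
  proof (rule continuous_eq_at_zero[of "\<lambda>t. f (dilate (Basis - B) t z)" "\<lambda>t. t ^ (e - i) * f z" t])
    show "f (dilate (Basis - B) t z) = t ^ (e - i) * f z" if "t \<noteq> 0" for t
    proof -
      have "t ^ i * f (dilate (Basis - B) t z) = t ^ i * (t ^ (e - i) * f z)"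
        using key[of t z] le by (simp add: mult.assoc[symmetric] power_add[symmetric])
      then show ?thesis using that by simp
    qed
  qed (intro continuous_intros continuous_on_polynomial_dilate poly)+
  then show "homogeneous_in (Basis - B) (e - i) f" by (simp add: homogeneous_in_def)
qed

text \<open>As a function of the scaling factor a polynomial function is a polynomial; its coefficients are
the homogeneous components.\<close>

lemma polynomial_dilate_expansion:
  fixes f :: "'a::euclidean_space \<Rightarrow> real"
  assumes "polyfun f"
  shows "\<exists>N g. (\<forall>i. polyfun (g i)) \<and> (\<forall>i>N. g i = (\<lambda>z. 0)) \<and>
    (\<forall>s z. f (dilate B s z) = (\<Sum>i\<le>N. g i z * s ^ i))"
  using assms
proof (induction f rule: real_polynomial_function.induct)
  case (linear f)
  define g where "g = (\<lambda>i::nat. if i = 0 then \<lambda>z. f (part (Basis - B) z)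
    else if i = 1 then \<lambda>z. f (part B z) else (\<lambda>z. 0))"
  have "bounded_linear (\<lambda>z. f (part C z))" for C
    using linear linear_part linear_conv_bounded_linear bounded_linear_compose by blast
  then have "\<forall>i. polyfun (g i)"
    by (simp add: g_def real_polynomial_function.intros)
  moreover have "\<forall>s z. f (dilate B s z) = (\<Sum>i\<le>1. g i z * s ^ i)"
    using bounded_linear.linear[OF linear] by (simp add: g_def dilate_def linear_add linear_cmul)
  moreover have "\<forall>i>1. g i = (\<lambda>z. 0)" by (simp add: g_def)
  ultimately show ?case by (intro exI[of _ 1] exI[of _ g] conjI)
next
  case (const c)
  show ?case
    by (intro exI[of _ 0] exI[of _ "\<lambda>i. if i = 0 then (\<lambda>z. c) else (\<lambda>z. 0)"])
      (auto intro: polyfun_const)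
next
  case (add f1 f2)
  from add.IH(1) obtain N1 g1 where
    1: "\<forall>i. polyfun (g1 i)" "\<forall>i>N1. g1 i = (\<lambda>z. 0)"
       "\<forall>s z. f1 (dilate B s z) = (\<Sum>i\<le>N1. g1 i z * s ^ i)"
    by (elim exE conjE) (rule that)
  from add.IH(2) obtain N2 g2 where
    2: "\<forall>i. polyfun (g2 i)" "\<forall>i>N2. g2 i = (\<lambda>z. 0)"
       "\<forall>s z. f2 (dilate B s z) = (\<Sum>i\<le>N2. g2 i z * s ^ i)"
    by (elim exE conjE) (rule that)
  have "(\<Sum>i\<le>N1. g1 i z * s ^ i) = (\<Sum>i\<le>max N1 N2. g1 i z * s ^ i)"
       "(\<Sum>i\<le>N2. g2 i z * s ^ i) = (\<Sum>i\<le>max N1 N2. g2 i z * s ^ i)" for s z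
    using 1(2) 2(2) by (auto intro!: sum.mono_neutral_left simp: not_le) (metis not_le)+
  moreover have "polyfun (\<lambda>z. g1 i z + g2 i z)" for i
    using 1(1) 2(1) by (blast intro: polyfun_add)
  ultimately show ?case
    using 1(2,3) 2(2,3)
    by (intro exI[of _ "max N1 N2"] exI[of _ "\<lambda>i z. g1 i z + g2 i z"])
      (simp add: sum.distrib distrib_right)
next
  case (mult f1 f2)
  from mult.IH(1) obtain N1 g1 where
    1: "\<forall>i. polyfun (g1 i)" "\<forall>i>N1. g1 i = (\<lambda>z. 0)"
       "\<forall>s z. f1 (dilate B s z) = (\<Sum>i\<le>N1. g1 i z * s ^ i)"
    by (elim exE conjE) (rule that)
  from mult.IH(2) obtain N2 g2 where
    2: "\<forall>i. polyfun (g2 i)" "\<forall>i>N2. g2 i = (\<lambda>z. 0)"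
       "\<forall>s z. f2 (dilate B s z) = (\<Sum>i\<le>N2. g2 i z * s ^ i)"
    by (elim exE conjE) (rule that)
  define g where "g = (\<lambda>r z. \<Sum>k\<le>r. g1 k z * g2 (r - k) z)"
  have "(\<Sum>i\<le>N1. g1 i z * s ^ i) * (\<Sum>i\<le>N2. g2 i z * s ^ i) = (\<Sum>r\<le>N1 + N2. g r z * s ^ r)" for s z
    unfolding g_def using 1(2) 2(2) by (intro polynomial_product) auto
  moreover have "g r = (\<lambda>z. 0)" if "r > N1 + N2" for r
  proof
    fix z
    have "g1 k z * g2 (r - k) z = 0" if "k \<le> r" for k
      using 1(2) 2(2) \<open>r > N1 + N2\<close> by (cases "k > N1") auto
    then show "g r z = 0" unfolding g_def by (intro sum.neutral) simp
  qed
  moreover have "polyfun (g r)" for r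
    unfolding g_def using 1(1) 2(1)
    by (intro real_polynomial_function_sum polyfun_mult) auto
  ultimately show ?case
    using 1(3) 2(3) by (intro exI[of _ "N1 + N2"] exI[of _ g]) simp
qed

lemma homogeneous_component_decomposition:
  fixes f :: "'a::euclidean_space \<Rightarrow> real"
  assumes poly: "polyfun f" and B: "B \<subseteq> Basis"
  shows "\<exists>N g. (\<forall>i. polyfun (g i) \<and> homogeneous_in B i (g i)) \<and>
    (\<forall>s z. f (dilate B s z) = (\<Sum>i\<le>N. g i z * s ^ i))"
proof -
  obtain N g where g: "\<forall>i. polyfun (g i)" "\<forall>i>N. g i = (\<lambda>z. 0)"
    "\<forall>s z. f (dilate B s z) = (\<Sum>i\<le>N. g i z * s ^ i)"
    using polynomial_dilate_expansion[OF poly, of B] by (elim exE conjE) (rule that)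
  have "g i (dilate B r z) = r ^ i * g i z" for i r z
  proof (cases "i \<le> N")
    case True
    have "(\<Sum>i\<le>N. g i (dilate B r z) * s ^ i) = (\<Sum>i\<le>N. (r ^ i * g i z) * s ^ i)" for s
      using g(3)[rule_format, of s "dilate B r z"] g(3)[rule_format, of "s * r" z] B
      by (simp add: dilate_dilate power_mult_distrib mult_ac)
    then show ?thesis
      using True polyfun_eq_coeffs[of "\<lambda>i. g i (dilate B r z)" N "\<lambda>i. r ^ i * g i z"] by simp
  qed (use g(2) in simp)
  then have "\<forall>i. polyfun (g i) \<and> homogeneous_in B i (g i)"
    using g(1) by (simp add: homogeneous_in_def)
  with g(3) show ?thesis by (intro exI conjI) assumption+
qed

section \<open>The squared radius of a block\<close>

lemma sqrad_eq_sum: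
  assumes "B \<subseteq> Basis"
  shows "sqrad B z = (\<Sum>b\<in>B. (z \<bullet> b)\<^sup>2)"
proof -
  have "sqrad B z = (\<Sum>b\<in>Basis. (part B z \<bullet> b)\<^sup>2)"
    unfolding sqrad_def power2_norm_eq_inner
    by (subst euclidean_inner) (simp add: power2_eq_square)
  also have "\<dots> = (\<Sum>b\<in>Basis. if b \<in> B then (z \<bullet> b)\<^sup>2 else 0)"
    using assms by (intro sum.cong) (auto simp: part_inner_Basis)
  also have "\<dots> = (\<Sum>b\<in>B. (z \<bullet> b)\<^sup>2)"
    using assms by (simp add: sum.inter_restrict[symmetric] Int_absorb1)
  finally show ?thesis .
qed

lemma sqrad_Basis: "sqrad Basis z = (norm z)\<^sup>2"
  by (simp add: sqrad_eq_sum norm_eq_sqrt_inner euclidean_inner[of z z] power2_eq_square sum_nonneg)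

lemma sqrad_split:
  assumes "B \<subseteq> Basis"
  shows "sqrad B z + sqrad (Basis - B) z = (norm z)\<^sup>2"
  using sum_Basis_split[OF assms, of "\<lambda>b. (z \<bullet> b)\<^sup>2"] assms sqrad_eq_sum[of Basis z]
  by (simp add: sqrad_eq_sum sqrad_Basis)

lemma polyfun_sqrad:
  assumes "B \<subseteq> Basis"
  shows "polyfun (sqrad B)"
proof -
  have "finite B" using assms finite_Basis finite_subset by blast
  then have "polyfun (\<lambda>z. \<Sum>b\<in>B. (z \<bullet> b)\<^sup>2)"
    by (intro real_polynomial_function_sum real_polynomial_function_power)
       (auto intro!: real_polynomial_function.intros(1) bounded_linear_inner_left)
  moreover have "sqrad B = (\<lambda>z. \<Sum>b\<in>B. (z \<bullet> b)\<^sup>2)"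
    using sqrad_eq_sum[OF assms] by blast
  ultimately show ?thesis by metis
qed

lemma sqrad_nonneg: "sqrad B z \<ge> 0"
  by (simp add: sqrad_def)

lemma homogeneous_in_sqrad: "B \<subseteq> Basis \<Longrightarrow> homogeneous_in B 2 (sqrad B)"
  by (auto simp: homogeneous_in_def sqrad_eq_sum dilate_inner_Basis subset_iff sum_distrib_left
      power_mult_distrib intro!: sum.cong)

lemma homogeneous_in_sqrad_complement: "B \<subseteq> Basis \<Longrightarrow> homogeneous_in B 0 (sqrad (Basis - B))"
  by (auto simp: homogeneous_in_def sqrad_eq_sum dilate_inner_Basis subset_iff intro!: sum.cong)

lemma partial_deriv_sqrad:
  assumes "B \<subseteq> Basis" "b \<in> Basis"
  shows "partial_deriv b (sqrad B) = (\<lambda>z. if b \<in> B then 2 * (z \<bullet> b) else 0)"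
proof
  fix z
  have fin: "finite B" using assms(1) finite_Basis finite_subset by blast
  have "((\<lambda>z. \<Sum>c\<in>B. (z \<bullet> c)\<^sup>2) has_derivative (\<lambda>h. \<Sum>c\<in>B. 2 * (z \<bullet> c) * (h \<bullet> c))) (at z)"
    by (auto intro!: derivative_eq_intros simp: mult_ac)
  moreover have "sqrad B = (\<lambda>z. \<Sum>b\<in>B. (z \<bullet> b)\<^sup>2)"
    using sqrad_eq_sum[OF assms(1)] by blast
  ultimately have "(sqrad B has_derivative (\<lambda>h. \<Sum>c\<in>B. 2 * (z \<bullet> c) * (h \<bullet> c))) (at z)"
    by metis
  then have "partial_deriv b (sqrad B) z = (\<Sum>c\<in>B. 2 * (z \<bullet> c) * (b \<bullet> c))"
    by (rule partial_deriv_eqI)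
  also have "\<dots> = (\<Sum>c\<in>B. if c = b then 2 * (z \<bullet> b) else 0)"
    using assms by (intro sum.cong) (auto simp: inner_Basis subset_iff)
  finally show "partial_deriv b (sqrad B) z = (if b \<in> B then 2 * (z \<bullet> b) else 0)"
    using fin by simp
qed

lemma laplacian_sqrad:
  assumes "B \<subseteq> Basis" "C \<subseteq> Basis"
  shows "laplacian C (sqrad B) = (\<lambda>z. 2 * real (card (B \<inter> C)))"
proof
  fix z
  have fin: "finite C" using assms finite_Basis finite_subset by blast
  have "partial_deriv b (partial_deriv b (sqrad B)) z = (if b \<in> B then 2 else 0)" if "b \<in> C" for b
  proof -
    have "b \<in> Basis" using that assms by blast
    moreover have "partial_deriv b (\<lambda>z. 2 * (z \<bullet> b)) = (\<lambda>z. 2 * (b \<bullet> b))"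
      by (intro partial_deriv_linear bounded_linear_intros)
    ultimately show ?thesis
      using assms by (simp add: partial_deriv_sqrad inner_Basis)
  qed
  then have "laplacian C (sqrad B) z = (\<Sum>b\<in>C. if b \<in> B then 2 else 0)"
    by (simp add: laplacian_def)
  then show "laplacian C (sqrad B) z = 2 * real (card (B \<inter> C))"
    using fin by (simp add: sum.inter_restrict[symmetric] Int_commute)
qed

lemma grad_sqrad_inner:
  assumes "B \<subseteq> Basis" "C \<subseteq> Basis"
  shows "(grad_pairing C (sqrad B) f z) =
    2 * (\<Sum>b\<in>B \<inter> C. (z \<bullet> b) * partial_deriv b f z)"
proof -
  have fin: "finite C" using assms finite_Basis finite_subset by blast
  have "(grad_pairing C (sqrad B) f z) =
      (\<Sum>b\<in>C. if b \<in> B then 2 * ((z \<bullet> b) * partial_deriv b f z) else 0)"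
    using assms by (intro sum.cong) (auto simp: partial_deriv_sqrad subset_iff)
  also have "\<dots> = 2 * (\<Sum>b\<in>B \<inter> C. (z \<bullet> b) * partial_deriv b f z)"
    using fin by (simp add: sum.inter_restrict[symmetric] Int_commute sum_distrib_left)
  finally show ?thesis .
qed

lemma laplacian_sqrad_mult:
  fixes f :: "'a::euclidean_space \<Rightarrow> real"
  assumes "B \<subseteq> Basis" "polyfun f" "homogeneous_in B d f"
  shows "laplacian B (\<lambda>z. sqrad B z * f z) =
    (\<lambda>z. sqrad B z * laplacian B f z + 2 * (real (card B) + 2 * real d) * f z)"
  unfolding laplacian_mult[OF polyfun_sqrad[OF assms(1)] assms(2)]
    grad_sqrad_inner[OF assms(1,1)] laplacian_sqrad[OF assms(1,1)] Int_absorb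
    euler_homogeneous[OF assms(2,3,1)]
  by (simp add: fun_eq_iff algebra_simps)

text \<open>Each factor \<open>u\<close> contributes through \<open>\<Delta>u = 2p\<close> and \<open>\<nabla>u \<cdot> \<nabla>f = 2 E f\<close>, where Euler's relation evaluates
the Euler operator \<open>E\<close>.\<close>

lemma laplacian_sqrad_power_mult:
  fixes f :: "'a::euclidean_space \<Rightarrow> real"
  assumes B: "B \<subseteq> Basis" and f: "polyfun f" "homogeneous_in B d f"
  shows "laplacian B (\<lambda>z. sqrad B z ^ k * f z) = (\<lambda>z. sqrad B z ^ k * laplacian B f z +
    2 * real k * (2 * real k + real (card B) - 2 + 2 * real d) * (sqrad B z ^ (k - 1) * f z))"
proof (induction k)
  case (Suc k)
  have "homogeneous_in B (2 * k + d) (\<lambda>z. sqrad B z ^ k * f z)"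
    by (intro homogeneous_in_mult homogeneous_in_power homogeneous_in_sqrad B f)
  moreover have "polyfun (\<lambda>z. sqrad B z ^ k * f z)"
    by (intro polynomial_intros polyfun_sqrad B f)
  ultimately have "laplacian B (\<lambda>z. sqrad B z * (sqrad B z ^ k * f z)) =
      (\<lambda>z. sqrad B z * laplacian B (\<lambda>z. sqrad B z ^ k * f z) z
        + 2 * (real (card B) + 2 * real (2 * k + d)) * (sqrad B z ^ k * f z))"
    using laplacian_sqrad_mult[OF B] by blast
  then show ?case
    unfolding Suc.IH by (cases k) (simp_all add: fun_eq_iff algebra_simps)
qed simp

lemma laplacian_sqrad_complement_power_mult:
  fixes f :: "'a::euclidean_space \<Rightarrow> real"
  assumes B: "B \<subseteq> Basis" and f: "polyfun f"
  shows "laplacian B (\<lambda>z. sqrad (Basis - B) z ^ k * f z) = (\<lambda>z. sqrad (Basis - B) z ^ k * laplacian B f z)"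
proof (induction k)
  case (Suc k)
  have "(Basis - B) \<inter> B = {}" by blast
  moreover have "polyfun (\<lambda>z. sqrad (Basis - B) z ^ k * f z)"
    by (intro polynomial_intros polyfun_sqrad f) auto
  ultimately have "laplacian B (\<lambda>z. sqrad (Basis - B) z * (sqrad (Basis - B) z ^ k * f z)) =
      (\<lambda>z. sqrad (Basis - B) z * laplacian B (\<lambda>z. sqrad (Basis - B) z ^ k * f z) z)"
    using B by (simp add: laplacian_mult polyfun_sqrad laplacian_sqrad
        grad_sqrad_inner fun_eq_iff del: Int_Diff)
  then show ?case unfolding Suc.IH by (simp add: mult.assoc)
qed simp

lemma exists_unit_point:
  assumes "B \<inter> C = {}" "B \<union> C = (Basis :: 'a::euclidean_space set)" "B \<noteq> {}" "C \<noteq> {}"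
  shows "\<exists>z::'a. sqrad B z = 1 \<and> sqrad C z = 1"
proof -
  obtain b0 c0 where bc: "b0 \<in> B" "c0 \<in> C" using assms by blast
  have sub: "B \<subseteq> Basis" "C \<subseteq> Basis" using assms(2) by auto
  have fin: "finite B" "finite C" using sub finite_Basis finite_subset by blast+
  have inner: "(b0 + c0) \<bullet> x = (if x = b0 \<or> x = c0 then 1 else 0)" if "x \<in> Basis" for x
  proof -
    have "b0 \<in> Basis" "c0 \<in> Basis" "b0 \<noteq> c0" using bc sub assms(1) by auto
    then show ?thesis using that by (auto simp: inner_add_left inner_Basis)
  qed
  have "sqrad B (b0 + c0) = (\<Sum>b\<in>B. if b = b0 then 1 else 0)"
    unfolding sqrad_eq_sum[OF sub(1)] using bc sub assms(1)
    by (intro sum.cong) (auto simp: inner subsetD)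
  moreover have "sqrad C (b0 + c0) = (\<Sum>c\<in>C. if c = c0 then 1 else 0)"
    unfolding sqrad_eq_sum[OF sub(2)] using bc sub assms(1)
    by (intro sum.cong) (auto simp: inner subsetD)
  ultimately show ?thesis using bc fin by (intro exI[of _ "b0 + c0"]) simp
qed

section \<open>Polynomial functions form an integral domain\<close>

text \<open>On the line through \<open>z0\<close> and \<open>w\<close> both functions are polynomials in one variable. The first one
has finitely many zeros, so the second one has infinitely many and vanishes on the whole line.\<close>

lemma polynomial_function_mult_eq_zero:
  fixes f g :: "'a::euclidean_space \<Rightarrow> real"
  assumes f: "polyfun f" and g: "polyfun g"
    and fg: "\<And>z. f z * g z = 0" and z0: "f z0 \<noteq> 0"
  shows "g w = 0"
proof -
  define L where "L = (\<lambda>t::real. z0 + t *\<^sub>R (w - z0))"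
  have L: "polynomial_function L"
    unfolding L_def
    by (intro polynomial_function_add polynomial_function_mult polynomial_function_const polynomial_function_id)
  obtain a n where a: "f \<circ> L = (\<lambda>x. \<Sum>i\<le>n. a i * x ^ i)"
    using real_polynomial_function_compose[OF L f] real_polynomial_function_iff_sum by blast
  obtain b m where b: "g \<circ> L = (\<lambda>x. \<Sum>i\<le>m. b i * x ^ i)"
    using real_polynomial_function_compose[OF L g] real_polynomial_function_iff_sum by blast
  have "f (L 0) \<noteq> 0" using z0 by (simp add: L_def)
  then have "(\<Sum>i\<le>n. a i * 0 ^ i) \<noteq> 0" using a by (metis comp_apply)
  then have fin: "finite {x. (\<Sum>i\<le>n. a i * x ^ i) = 0}"
    using polyfun_finite_roots[of a n] polyfun_eq_0[of a n] by blast
  have "(\<Sum>i\<le>n. a i * x ^ i) * (\<Sum>i\<le>m. b i * x ^ i) = 0" for x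
    using fg[of "L x"] fun_cong[OF a, of x] fun_cong[OF b, of x] by simp
  then have "- {x. (\<Sum>i\<le>n. a i * x ^ i) = 0} \<subseteq> {x. (\<Sum>i\<le>m. b i * x ^ i) = 0}"
    by auto
  moreover have "infinite (- {x. (\<Sum>i\<le>n. a i * x ^ i) = 0})"
    using fin by (metis Diff_infinite_finite Compl_eq_Diff_UNIV infinite_UNIV_char_0)
  ultimately have "infinite {x. (\<Sum>i\<le>m. b i * x ^ i) = 0}"
    using finite_subset by blast
  then have "(\<Sum>i\<le>m. b i * 1 ^ i) = 0"
    using polyfun_finite_roots[of b m] polyfun_eq_0[of b m] by auto
  moreover have "L 1 = w" by (simp add: L_def)
  ultimately show ?thesis using fun_cong[OF b, of 1] by simp
qed

section \<open>Monomials in the generators\<close>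

abbreviation radial_algebra :: "'a::euclidean_space set \<Rightarrow> 'a set \<Rightarrow> ('a \<Rightarrow> real) set" where
  "radial_algebra B C \<equiv> generated_algebra {sqrad B, sqrad C}"

lemma generated_algebra_mono: "G \<subseteq> H \<Longrightarrow> generated_algebra G \<subseteq> generated_algebra H"
proof
  fix f assume "f \<in> generated_algebra G" and "G \<subseteq> H"
  then show "f \<in> generated_algebra H"
    by (induction rule: generated_algebra.induct) (auto intro: generated_algebra.intros)
qed

lemma generated_algebra_cmult:
  "f \<in> generated_algebra G \<Longrightarrow> (\<lambda>z. c * f z) \<in> generated_algebra G"
  using generated_algebra.mult[OF generated_algebra.const] by blast

lemma generated_algebra_diff:
  "f \<in> generated_algebra G \<Longrightarrow> g \<in> generated_algebra G \<Longrightarrow> (\<lambda>z. f z - g z) \<in> generated_algebra G"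
  using generated_algebra.add[of f G "\<lambda>z. -1 * g z"] generated_algebra_cmult[of g G "-1"] by simp

lemma generated_algebra_power:
  "f \<in> generated_algebra G \<Longrightarrow> (\<lambda>z. f z ^ n) \<in> generated_algebra G"
  by (induction n) (auto intro: generated_algebra.intros)

lemma generated_algebra_monomial:
  assumes "g1 \<in> generated_algebra G" "g2 \<in> generated_algebra G" "g3 \<in> generated_algebra G"
  shows "(\<lambda>z. c * (g1 z ^ k * g2 z ^ l * g3 z ^ m)) \<in> generated_algebra G"
  by (intro generated_algebra_cmult generated_algebra.mult generated_algebra_power assms)

lemma generated_algebra_sum:
  "(\<And>i. i \<in> I \<Longrightarrow> f i \<in> generated_algebra G) \<Longrightarrow> (\<lambda>z. \<Sum>i\<in>I. f i z) \<in> generated_algebra G"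
  by (induction I rule: infinite_finite_induct) (auto intro: generated_algebra.intros)

lemma generated_algebra_subset:
  assumes "G \<subseteq> generated_algebra H"
  shows "generated_algebra G \<subseteq> generated_algebra H"
proof
  fix f assume "f \<in> generated_algebra G"
  then show "f \<in> generated_algebra H"
    by (induction rule: generated_algebra.induct) (use assms in \<open>auto intro: generated_algebra.intros\<close>)
qed

lemma generated_algebra_polynomial:
  assumes "f \<in> generated_algebra G" "\<And>g. g \<in> G \<Longrightarrow> polyfun g"
  shows "polyfun f"
  using assms(1) by induction (auto intro: polynomial_intros assms(2))

text \<open>The predicate \<open>Q\<close> restricts the exponents of the monomials that may occur. It speaks about a way of
writing an element, since the generators may satisfy algebraic relations and exponents are then not
determined by the function.\<close>

inductive_set monomial_span ::
  "('a \<Rightarrow> real) \<Rightarrow> ('a \<Rightarrow> real) \<Rightarrow> ('a \<Rightarrow> real) \<Rightarrow> (nat \<Rightarrow> nat \<Rightarrow> nat \<Rightarrow> bool) \<Rightarrow> ('a \<Rightarrow> real) set"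
  for g1 g2 g3 :: "'a \<Rightarrow> real" and Q :: "nat \<Rightarrow> nat \<Rightarrow> nat \<Rightarrow> bool" where
  zero: "(\<lambda>z. 0) \<in> monomial_span g1 g2 g3 Q"
| step: "f \<in> monomial_span g1 g2 g3 Q \<Longrightarrow> Q k l m \<Longrightarrow>
    (\<lambda>z. c * (g1 z ^ k * g2 z ^ l * g3 z ^ m) + f z) \<in> monomial_span g1 g2 g3 Q"

lemma monomial_span_mono:
  assumes "f \<in> monomial_span g1 g2 g3 Q" "\<And>k l m. Q k l m \<Longrightarrow> Q' k l m"
  shows "f \<in> monomial_span g1 g2 g3 Q'"
  using assms(1) by induction (auto intro: monomial_span.intros assms(2))

lemma monomial_span_add:
  assumes "f \<in> monomial_span g1 g2 g3 Q" "g \<in> monomial_span g1 g2 g3 Q"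
  shows "(\<lambda>z. f z + g z) \<in> monomial_span g1 g2 g3 Q"
  using assms by induction (auto intro: monomial_span.intros simp: add.assoc)

lemma monomial_span_monomial:
  "Q k l m \<Longrightarrow> (\<lambda>z. c * (g1 z ^ k * g2 z ^ l * g3 z ^ m)) \<in> monomial_span g1 g2 g3 Q"
  using monomial_span.step[OF monomial_span.zero, where Q=Q] by simp

lemma monomial_span_mult:
  assumes Q: "\<And>k l m k' l' m'. Q k l m \<Longrightarrow> Q k' l' m' \<Longrightarrow> Q (k + k') (l + l') (m + m')"
    and f: "f \<in> monomial_span g1 g2 g3 Q" and g: "g \<in> monomial_span g1 g2 g3 Q"
  shows "(\<lambda>z. f z * g z) \<in> monomial_span g1 g2 g3 Q"
  using f
proof induction
  case zero
  show ?case using monomial_span.zero[of g1 g2 g3 Q] by simp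
next
  case (step f k l m c)
  have "(\<lambda>z. c * (g1 z ^ k * g2 z ^ l * g3 z ^ m) * g z) \<in> monomial_span g1 g2 g3 Q"
    using g
  proof induction
    case zero
    show ?case using monomial_span.zero[of g1 g2 g3 Q] by simp
  next
    case (step g k' l' m' c')
    from monomial_span.step[OF step.IH Q[OF \<open>Q k l m\<close> step.hyps(2)], of "c * c'"]
    show ?case by (simp add: algebra_simps power_add)
  qed
  from monomial_span_add[OF this step.IH] show ?case by (simp add: distrib_right)
qed

lemma monomial_span_subset_generated_algebra:
  assumes "f \<in> monomial_span g1 g2 g3 Q"
  shows "f \<in> generated_algebra {g1, g2, g3}"
  using assms
  by induction (intro generated_algebra.const generated_algebra.add generated_algebra_monomial;
      simp add: generated_algebra.gen)+

lemma generated_algebra_eq_monomial_span: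
  "generated_algebra {g1, g2, g3} = monomial_span g1 g2 g3 (\<lambda>k l m. True)"
proof (intro equalityI subsetI)
  fix f assume "f \<in> generated_algebra {g1, g2, g3}"
  then show "f \<in> monomial_span g1 g2 g3 (\<lambda>k l m. True)"
  proof induction
    case (const c)
    show ?case using monomial_span_monomial[of "\<lambda>_ _ _. True" 0 0 0 c g1 g2 g3] by simp
  next
    case (gen f)
    then show ?case
      using monomial_span_monomial[of "\<lambda>_ _ _. True" 1 0 0 1 g1 g2 g3]
        monomial_span_monomial[of "\<lambda>_ _ _. True" 0 1 0 1 g1 g2 g3]
        monomial_span_monomial[of "\<lambda>_ _ _. True" 0 0 1 1 g1 g2 g3] by auto
  qed (auto intro: monomial_span_add monomial_span_mult)
qed (rule monomial_span_subset_generated_algebra)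

lemma generated_algebra_two_eq_monomial_span:
  "generated_algebra {g1, g2} = monomial_span g1 g2 g3 (\<lambda>k l m. m = 0)"
proof (intro equalityI subsetI)
  fix f assume "f \<in> generated_algebra {g1, g2}"
  then show "f \<in> monomial_span g1 g2 g3 (\<lambda>k l m. m = 0)"
  proof induction
    case (const c)
    show ?case using monomial_span_monomial[of "\<lambda>_ _ m. m = 0" 0 0 0 c g1 g2 g3] by simp
  next
    case (gen f)
    then show ?case
      using monomial_span_monomial[of "\<lambda>_ _ m. m = 0" 1 0 0 1 g1 g2 g3]
        monomial_span_monomial[of "\<lambda>_ _ m. m = 0" 0 1 0 1 g1 g2 g3] by auto
  qed (auto intro: monomial_span_add monomial_span_mult)
next
  fix f assume "f \<in> monomial_span g1 g2 g3 (\<lambda>k l m. m = 0)"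
  then show "f \<in> generated_algebra {g1, g2}"
  proof induction
    case (step f k l m c)
    then have "(\<lambda>z. c * (g1 z ^ k * g2 z ^ l * 1 ^ m)) \<in> generated_algebra {g1, g2}"
      by (intro generated_algebra_monomial generated_algebra.const generated_algebra.gen) auto
    from generated_algebra.add[OF this step.IH] show ?case using step.hyps by simp
  qed (rule generated_algebra.const)
qed

lemma monomial_span_weight_decomposition:
  assumes g: "homogeneous_in C w1 g1" "homogeneous_in C w2 g2" "homogeneous_in C w3 g3"
    and f: "f \<in> monomial_span g1 g2 g3 Q"
  shows "\<exists>M c. (\<forall>i. c i \<in> monomial_span g1 g2 g3 (\<lambda>k l m. Q k l m \<and> w1 * k + w2 * l + w3 * m = i)) \<and>
    (\<forall>i>M. c i = (\<lambda>z. 0)) \<and> (\<forall>s z. f (dilate C s z) = (\<Sum>i\<le>M. c i z * s ^ i))"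
  using f
proof induction
  case zero
  show ?case
    by (intro exI[of _ 0] exI[of _ "\<lambda>_ _. 0"]) (simp add: monomial_span.zero)
next
  case (step f k l m a)
  let ?S = "\<lambda>i. monomial_span g1 g2 g3 (\<lambda>k l m. Q k l m \<and> w1 * k + w2 * l + w3 * m = i)"
  from step.IH obtain M c where c: "\<forall>i. c i \<in> ?S i" "\<forall>i>M. c i = (\<lambda>z. 0)"
    "\<forall>s z. f (dilate C s z) = (\<Sum>i\<le>M. c i z * s ^ i)"
    by (elim exE conjE) (rule that)
  define d where "d = w1 * k + w2 * l + w3 * m"
  define g where "g = (\<lambda>z. a * (g1 z ^ k * g2 z ^ l * g3 z ^ m))"
  define c' where "c' = (\<lambda>i z. (if i = d then g z else 0) + c i z)"
  have gS: "g \<in> ?S d"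
    unfolding g_def using step.hyps by (intro monomial_span_monomial) (simp add: d_def)
  have hg: "homogeneous_in C d g"
    unfolding g_def d_def using g
    by (intro homogeneous_in_cmult homogeneous_in_mult homogeneous_in_power)
  have "(\<Sum>i\<le>M. c i z * s ^ i) = (\<Sum>i\<le>max M d. c i z * s ^ i)" for s z
    using c(2) by (auto intro!: sum.mono_neutral_left simp: not_le) (metis not_le)
  moreover have "(\<Sum>i\<le>max M d. (if i = d then g z else 0) * s ^ i) = s ^ d * g z" for s z
    by (simp add: if_distrib[of "\<lambda>x. x * _"] cong: if_cong)
  ultimately have "g (dilate C s z) + f (dilate C s z) = (\<Sum>i\<le>max M d. c' i z * s ^ i)" for s z
    using hg c(3) by (simp add: c'_def homogeneous_in_def distrib_right sum.distrib)
  moreover have "\<forall>i>max M d. c' i = (\<lambda>z. 0)" using c(2) by (auto simp: c'_def)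
  moreover have "c' i \<in> ?S i" for i
    using c(1)[rule_format, of i] monomial_span_add[OF gS c(1)[rule_format, of d]]
    by (cases "i = d") (simp_all add: c'_def)
  ultimately show ?case
    by (intro exI[of _ "max M d"] exI[of _ c'] conjI allI) (simp_all add: g_def)
qed

text \<open>Homogeneous components with respect to a dilation are coefficients of a polynomial in the scaling
factor, hence unique. They can therefore be read off from any expression of \<open>f\<close> by monomials.\<close>

lemma monomial_span_component:
  assumes g: "homogeneous_in C w1 g1" "homogeneous_in C w2 g2" "homogeneous_in C w3 g3"
    and f: "f \<in> monomial_span g1 g2 g3 Q"
    and h: "\<And>s z. f (dilate C s z) = (\<Sum>i\<le>N. h i z * s ^ i)" and i: "i \<le> N"
  shows "h i \<in> monomial_span g1 g2 g3 (\<lambda>k l m. Q k l m \<and> w1 * k + w2 * l + w3 * m = i)"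
proof -
  obtain M c where c: "\<forall>i. c i \<in> monomial_span g1 g2 g3 (\<lambda>k l m. Q k l m \<and> w1 * k + w2 * l + w3 * m = i)"
    "\<forall>i>M. c i = (\<lambda>z. 0)" "\<forall>s z. f (dilate C s z) = (\<Sum>i\<le>M. c i z * s ^ i)"
    using monomial_span_weight_decomposition[OF g f] by (elim exE conjE) (rule that)
  define h' where "h' = (\<lambda>i z. if i \<le> N then h i z else 0)"
  have "h i z = c i z" for z
  proof -
    have "(\<Sum>i\<le>N. h i z * s ^ i) = (\<Sum>i\<le>max M N. h' i z * s ^ i)" for s
      unfolding h'_def by (intro sum.mono_neutral_cong_left) auto
    moreover have "(\<Sum>i\<le>M. c i z * s ^ i) = (\<Sum>i\<le>max M N. c i z * s ^ i)" for s
      using c(2) by (auto intro!: sum.mono_neutral_left simp: not_le) (metis not_le)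
    ultimately have "(\<Sum>i\<le>max M N. h' i z * s ^ i) = (\<Sum>i\<le>max M N. c i z * s ^ i)" for s
      using h[of s z] c(3) by simp
    then have "h' i z = c i z"
      using i polyfun_eq_coeffs[of "\<lambda>i. h' i z" "max M N" "\<lambda>i. c i z"] by simp
    then show ?thesis using i by (simp add: h'_def)
  qed
  then have "h i = c i" by blast
  then show ?thesis using c(1) by simp
qed

text \<open>The form in which components are needed most: the sum of two partial Laplacians, or of two partial
gradient norms, is split into its summands.\<close>

lemma monomial_span_two_components:
  assumes g: "homogeneous_in C w1 g1" "homogeneous_in C w2 g2" "homogeneous_in C w3 g3"
    and f: "(\<lambda>z. f1 z + f2 z) \<in> monomial_span g1 g2 g3 Q"
    and h: "homogeneous_in C d1 f1" "homogeneous_in C d2 f2" "d1 \<noteq> d2"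
  shows "f1 \<in> monomial_span g1 g2 g3 (\<lambda>k l m. Q k l m \<and> w1 * k + w2 * l + w3 * m = d1)"
    and "f2 \<in> monomial_span g1 g2 g3 (\<lambda>k l m. Q k l m \<and> w1 * k + w2 * l + w3 * m = d2)"
proof -
  define H where "H = (\<lambda>i z. (if i = d1 then f1 z else 0) + (if i = d2 then f2 z else 0))"
  have "(\<Sum>i\<le>max d1 d2. (if i = d then x else 0) * s ^ i) = s ^ d * x"
    if "d \<le> max d1 d2" for d x and s :: real
    using that by (simp add: if_distrib[of "\<lambda>x. x * _"] cong: if_cong)
  then have "f1 (dilate C s z) + f2 (dilate C s z) = (\<Sum>i\<le>max d1 d2. H i z * s ^ i)" for s z
    using h by (simp add: H_def homogeneous_in_def distrib_right sum.distrib)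
  then have "H i \<in> monomial_span g1 g2 g3 (\<lambda>k l m. Q k l m \<and> w1 * k + w2 * l + w3 * m = i)"
    if "i \<le> max d1 d2" for i
    using monomial_span_component[OF g f, where N = "max d1 d2" and h = H and i = i] that by simp
  from this[of d1] this[of d2] show "f1 \<in> monomial_span g1 g2 g3 (\<lambda>k l m. Q k l m \<and> w1 * k + w2 * l + w3 * m = d1)"
    "f2 \<in> monomial_span g1 g2 g3 (\<lambda>k l m. Q k l m \<and> w1 * k + w2 * l + w3 * m = d2)"
    using h(3) by (simp_all add: H_def)
qed

lemma monomial_span_homogeneous:
  assumes g: "homogeneous_in C w1 g1" "homogeneous_in C w2 g2" "homogeneous_in C w3 g3"
    and f: "f \<in> monomial_span g1 g2 g3 Q" and h: "homogeneous_in C d f"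
  shows "f \<in> monomial_span g1 g2 g3 (\<lambda>k l m. Q k l m \<and> w1 * k + w2 * l + w3 * m = d)"
  using monomial_span_two_components(1)[OF g, of f "\<lambda>z. 0" Q d "Suc d"] f h
  by (simp add: homogeneous_in_def)

text \<open>A bidegree often leaves room for only two monomials.\<close>

lemma monomial_span_eq_two_terms:
  assumes "f \<in> monomial_span g1 g2 g3 Q"
    and "\<And>k l m. Q k l m \<Longrightarrow> (\<lambda>z. g1 z ^ k * g2 z ^ l * g3 z ^ m) = m1 \<or>
      (\<lambda>z. g1 z ^ k * g2 z ^ l * g3 z ^ m) = m2"
  shows "\<exists>\<alpha> \<beta>. \<forall>z. f z = \<alpha> * m1 z + \<beta> * m2 z"
  using assms(1)
proof induction
  case zero
  show ?case by (intro exI[of _ 0]) simp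
next
  case (step f k l m c)
  then obtain \<alpha> \<beta> where f: "\<forall>z. f z = \<alpha> * m1 z + \<beta> * m2 z" by blast
  from assms(2)[OF step.hyps(2)] show ?case
  proof
    assume "(\<lambda>z. g1 z ^ k * g2 z ^ l * g3 z ^ m) = m1"
    then show ?thesis using f by (intro exI[of _ "c + \<alpha>"] exI[of _ \<beta>]) (auto simp: fun_eq_iff algebra_simps)
  next
    assume "(\<lambda>z. g1 z ^ k * g2 z ^ l * g3 z ^ m) = m2"
    then show ?thesis using f by (intro exI[of _ \<alpha>] exI[of _ "c + \<beta>"]) (auto simp: fun_eq_iff algebra_simps)
  qed
qed

section \<open>Laplacian algebras with three homogeneous generators\<close>

text \<open>The gradient pairing is a derivation in each argument and the Laplacian satisfies the Leibniz
rule, so membership of the values at generators propagates to the whole algebra.\<close>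

lemma generated_algebra_laplacian_closed:
  fixes G :: "('a::euclidean_space \<Rightarrow> real) set"
  assumes G: "\<And>g. g \<in> G \<Longrightarrow> polyfun g"
    and lap: "\<And>g. g \<in> G \<Longrightarrow> laplacian C g \<in> generated_algebra G"
    and grad: "\<And>g h. g \<in> G \<Longrightarrow> h \<in> G \<Longrightarrow>
      (\<lambda>z. grad_pairing C g h z) \<in> generated_algebra G"
    and f: "f \<in> generated_algebra G"
  shows "laplacian C f \<in> generated_algebra G"
proof -
  let ?\<Gamma> = "\<lambda>f g z. grad_pairing C f g z"
  have poly: "polyfun f" if "f \<in> generated_algebra G" for f
    using generated_algebra_polynomial[OF that G] .
  have add: "?\<Gamma> (\<lambda>z. f z + g z) h = (\<lambda>z. ?\<Gamma> f h z + ?\<Gamma> g h z)"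
    and mult: "?\<Gamma> (\<lambda>z. f z * g z) h = (\<lambda>z. f z * ?\<Gamma> g h z + g z * ?\<Gamma> f h z)"
    if "f \<in> generated_algebra G" "g \<in> generated_algebra G" for f g h
    using that poly
    by (simp_all add: partial_deriv_add partial_deriv_mult fun_eq_iff sum.distrib
        sum_distrib_left algebra_simps)
  have 1: "?\<Gamma> f g \<in> generated_algebra G" if "f \<in> generated_algebra G" "g \<in> G" for f g
    using that(1)
  proof induction
    case (const c)
    show ?case using generated_algebra.const[of 0 G] by simp
  next
    case (gen f)
    then show ?case using grad that(2) by blast
  qed (simp_all only: add mult, auto intro: generated_algebra.intros)
  have 2: "?\<Gamma> g f \<in> generated_algebra G" if "f \<in> generated_algebra G" "g \<in> generated_algebra G" for f g
    using that(2)
  proof induction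
    case (const c)
    show ?case using generated_algebra.const[of 0 G] by simp
  next
    case (gen g)
    then show ?case using 1[OF that(1) gen] by (simp add: mult.commute)
  qed (simp_all only: add mult, auto intro: generated_algebra.intros that)
  show ?thesis using f
  proof induction
    case (const c)
    show ?case using generated_algebra.const[of 0 G] by simp
  next
    case (gen f)
    then show ?case using lap by blast
  next
    case (add f g)
    then show ?case using poly by (simp add: laplacian_add generated_algebra.add)
  next
    case (mult f g)
    show ?case unfolding laplacian_mult[OF poly[OF mult.hyps(1)] poly[OF mult.hyps(2)]]
      by (intro generated_algebra.add generated_algebra.mult generated_algebra_cmult mult 2)
  qed
qed

text \<open>The homogeneous components of an element are formed by those of its monomials in the generators that
have the degree in question, so they belong to the algebra.\<close>

lemma laplacian_algebraI:
  fixes g1 g2 g3 :: "'a::euclidean_space \<Rightarrow> real"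
  assumes g: "homogeneous_poly w1 g1" "homogeneous_poly w2 g2" "homogeneous_poly w3 g3"
    and nrm: "(\<lambda>z. (norm z)\<^sup>2) \<in> generated_algebra {g1, g2, g3}"
    and lap: "\<And>f. f \<in> generated_algebra {g1, g2, g3} \<Longrightarrow> laplacian Basis f \<in> generated_algebra {g1, g2, g3}"
  shows "laplacian_algebra (generated_algebra {g1, g2, g3})"
proof -
  have hom: "homogeneous_in Basis w1 g1" "homogeneous_in Basis w2 g2" "homogeneous_in Basis w3 g3"
    using g by (simp_all add: homogeneous_poly_iff)
  have poly: "polyfun f" if "f \<in> generated_algebra {g1, g2, g3}" for f
    by (rule generated_algebra_polynomial[OF that]) (use g in \<open>auto simp: homogeneous_poly_iff\<close>)
  have graded: "h d \<in> generated_algebra {g1, g2, g3}"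
    if f: "f \<in> generated_algebra {g1, g2, g3}" and h: "\<forall>d\<le>N. homogeneous_poly d (h d)"
      "f = (\<lambda>z. \<Sum>d\<le>N. h d z)" and "d \<le> N" for f N h d
  proof -
    have "f (dilate Basis s z) = (\<Sum>i\<le>N. h i z * s ^ i)" for s z
      using h(1) unfolding h(2) dilate_Basis homogeneous_poly_def
      by (intro sum.cong) (simp_all add: mult.commute)
    from monomial_span_component[OF hom f[unfolded generated_algebra_eq_monomial_span] this \<open>d \<le> N\<close>]
    show ?thesis by (rule monomial_span_subset_generated_algebra)
  qed
  show ?thesis
    unfolding laplacian_algebra_def
  proof (intro conjI ballI allI impI)
    fix f N h d
    assume "f \<in> generated_algebra {g1, g2, g3}" "d \<le> N"
      "(\<forall>d\<le>N. homogeneous_poly d (h d)) \<and> f = (\<lambda>z. \<Sum>d\<le>N. h d z)"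
    then show "h d \<in> generated_algebra {g1, g2, g3}" using graded by blast
  qed (assumption | rule poly nrm lap generated_algebra.const generated_algebra.add generated_algebra.mult)+
qed

section \<open>Separately harmonic polynomials\<close>

text \<open>The second block is a parameter of its own, rather than \<open>Basis - B\<close>, so that exchanging the roles of
\<open>x\<close> and \<open>y\<close> gives another instance of the locale.\<close>

locale separately_harmonic =
  fixes B C :: "'a::euclidean_space set" and P :: "'a \<Rightarrow> real" and a b :: nat
  assumes disjoint: "B \<inter> C = {}" and union: "B \<union> C = Basis"
    and card_B: "2 \<le> card B" and card_C: "2 \<le> card C"
    and a_pos: "0 < a" and b_pos: "0 < b"
    and poly: "polyfun P"
    and hom_B: "homogeneous_in B a P" and hom_C: "homogeneous_in C b P"
    and harm_B: "laplacian B P = (\<lambda>z. 0)" and harm_C: "laplacian C P = (\<lambda>z. 0)"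
    and nonzero: "\<exists>z. P z \<noteq> 0"
begin

lemma swap: "separately_harmonic C B P b a"
  using disjoint union card_B card_C a_pos b_pos poly hom_B hom_C harm_B harm_C nonzero
  by unfold_locales (auto simp: Int_commute Un_commute)

lemma C_eq: "C = Basis - B" and B_eq: "B = Basis - C"
  using disjoint union by auto

lemma sub: "B \<subseteq> Basis" "C \<subseteq> Basis"
  using union by auto

lemma finite: "finite B" "finite C"
  using sub finite_Basis finite_subset by blast+

abbreviation u where "u \<equiv> sqrad B"
abbreviation v where "v \<equiv> sqrad C"
abbreviation alg where "alg \<equiv> generated_algebra {u, v, P}"

text \<open>The right sides of the gradient identities for the two blocks, written so that exchanging the blocks
turns one into the other. The case distinction on the parity of the bidegree is expressed by the condition
that \<open>a\<close>, \<open>b\<close> are even or \<open>L = 0\<close>.\<close>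

abbreviation rhs_B where "rhs_B K L z \<equiv>
  (real a)\<^sup>2 * (K * u z ^ (a - 1) * v z ^ b + L * u z ^ (a div 2 - 1) * v z ^ (b div 2) * P z)"

abbreviation rhs_C where "rhs_C K L z \<equiv>
  (real b)\<^sup>2 * (K * v z ^ (b - 1) * u z ^ a + L * v z ^ (b div 2 - 1) * u z ^ (a div 2) * P z)"

lemma poly_uv: "polyfun u" "polyfun v"
  using sub by (auto intro: polyfun_sqrad)

lemma hom_uv: "homogeneous_in B 2 u" "homogeneous_in C 0 u" "homogeneous_in B 0 v" "homogeneous_in C 2 v"
  using sub homogeneous_in_sqrad homogeneous_in_sqrad_complement[of B]
    homogeneous_in_sqrad_complement[of C] by (auto simp flip: C_eq B_eq)

lemma sum_Basis: "(\<Sum>c\<in>Basis. h c) = (\<Sum>c\<in>B. h c) + (\<Sum>c\<in>C. h c :: real)"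
  using sum_Basis_split[OF sub(1)] by (simp flip: C_eq)

lemma unit_point: obtains z1 where "u z1 = 1" "v z1 = 1"
proof -
  have "B \<noteq> {}" "C \<noteq> {}" using card_B card_C by auto
  then show thesis using exists_unit_point[OF disjoint union] that by blast
qed

definition grad_sq :: "'a set \<Rightarrow> 'a \<Rightarrow> real" where
  "grad_sq D z = (\<Sum>c\<in>D. (partial_deriv c P z)\<^sup>2)"

lemma hom_grad_sq:
  "homogeneous_in B (2 * a - 2) (grad_sq B)" "homogeneous_in C (2 * b) (grad_sq B)"
proof -
  have "homogeneous_in B ((a - 1) * 2) (\<lambda>z. (partial_deriv c P z)\<^sup>2)" if "c \<in> B" for c
    using that by (intro homogeneous_in_power homogeneous_in_partial_deriv poly hom_B sub)
  moreover have "2 * a - 2 = (a - 1) * 2" by simp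
  ultimately show "homogeneous_in B (2 * a - 2) (grad_sq B)"
    unfolding grad_sq_def[abs_def] by (intro homogeneous_in_sum) simp_all
  have "homogeneous_in C (b * 2) (\<lambda>z. (partial_deriv c P z)\<^sup>2)" if "c \<in> B" for c
    using that sub
    by (intro homogeneous_in_power homogeneous_in_partial_deriv_complement[of P C] poly hom_C)
      (auto simp flip: B_eq)
  then show "homogeneous_in C (2 * b) (grad_sq B)"
    unfolding grad_sq_def[abs_def] by (intro homogeneous_in_sum) (simp add: mult.commute)
qed

text \<open>The gradient norm \<open>|\<nabla>\<^sub>xP|\<^sup>2\<close> has bidegree \<open>(2a - 2, 2b)\<close>. A monomial \<open>u\<^sup>k v\<^sup>l P\<^sup>m\<close> of this bidegree has
\<open>m < 2\<close>, and \<open>m = 1\<close> requires \<open>a\<close> and \<open>b\<close> to be even.\<close>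

lemma grad_sq_form:
  assumes "laplacian_algebra (alg)"
  shows "\<exists>K L. (even a \<and> even b \<or> L = 0) \<and> (\<forall>z. grad_sq B z = rhs_B K L z)"
proof -
  interpret sw: separately_harmonic C B P b a by (rule swap)
  have "(\<lambda>z. P z * P z) \<in> alg"
    by (intro generated_algebra.intros) simp_all
  then have "laplacian Basis (\<lambda>z. P z * P z) \<in> alg"
    using assms unfolding laplacian_algebra_def by blast
  moreover have "laplacian Basis P z = 0" for z
    using laplacian_split[OF sub(1), of P z] harm_B harm_C by (simp flip: C_eq)
  ultimately have "(\<lambda>z. 2 * (grad_pairing Basis P P z))
      \<in> alg"
    by (simp add: laplacian_mult poly)
  from generated_algebra_cmult[OF this, of "1/2"]
  have "(\<lambda>z. grad_sq B z + grad_sq C z) \<in> alg"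
    by (simp add: grad_sq_def sum_Basis power2_eq_square add_divide_distrib)
  then have "(\<lambda>z. grad_sq B z + grad_sq C z) \<in> monomial_span u v P (\<lambda>k l m. True)"
    by (simp add: generated_algebra_eq_monomial_span)
  moreover have "2 * a - 2 \<noteq> 2 * a" using a_pos by simp
  moreover have "homogeneous_in B (2 * a) (grad_sq C)"
    using sw.hom_grad_sq(2) unfolding sw.grad_sq_def grad_sq_def .
  ultimately have "grad_sq B \<in> monomial_span u v P (\<lambda>k l m. True \<and> 2 * k + 0 * l + a * m = 2 * a - 2)"
    using hom_grad_sq(1) by (intro monomial_span_two_components(1)[OF hom_uv(1,3) hom_B]) auto
  from monomial_span_homogeneous[OF hom_uv(2,4) hom_C this hom_grad_sq(2)]
  have ms: "grad_sq B \<in> monomial_span u v P (\<lambda>k l m. (True \<and> 2 * k + 0 * l + a * m = 2 * a - 2) \<and>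
      0 * k + 2 * l + b * m = 2 * b)" .
  define m2 where "m2 = (\<lambda>z. if even a \<and> even b then u z ^ (a div 2 - 1) * v z ^ (b div 2) * P z else 0)"
  have "(\<lambda>z. u z ^ k * v z ^ l * P z ^ m) = (\<lambda>z. u z ^ (a - 1) * v z ^ b) \<or>
      (\<lambda>z. u z ^ k * v z ^ l * P z ^ m) = m2"
    if "(True \<and> 2 * k + 0 * l + a * m = 2 * a - 2) \<and> 0 * k + 2 * l + b * m = 2 * b" for k l m
  proof -
    have m: "m < 2"
    proof (rule ccontr)
      assume "\<not> m < 2"
      then have "a * m \<ge> a * 2" by (intro mult_le_mono2) simp
      then show False using that a_pos by linarith
    qed
    show ?thesis
    proof (cases "m = 0")
      case True
      then have "k = a - 1" "l = b" using that by auto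
      then show ?thesis using True by simp
    next
      case False
      then have m1: "m = 1" using m by simp
      then have "2 * k + 2 = a" "2 * l = b" using that a_pos by auto
      then have "even a" "even b" "k = a div 2 - 1" "l = b div 2" by auto
      then show ?thesis using m1 by (simp add: m2_def)
    qed
  qed
  from monomial_span_eq_two_terms[OF ms this] obtain \<alpha> \<beta> where
    ab: "\<forall>z. grad_sq B z = \<alpha> * (u z ^ (a - 1) * v z ^ b) + \<beta> * m2 z" by blast
  show ?thesis
  proof (cases "even a \<and> even b")
    case True
    then show ?thesis using ab a_pos
      by (intro exI[of _ "\<alpha> / (real a)\<^sup>2"] exI[of _ "\<beta> / (real a)\<^sup>2"]) (simp add: m2_def field_simps)
  next
    case False
    then have "grad_sq B z = \<alpha> * (u z ^ (a - 1) * v z ^ b)" for z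
      using ab False by (auto simp: m2_def)
    then show ?thesis using a_pos
      by (intro exI[of _ "\<alpha> / (real a)\<^sup>2"] exI[of _ 0]) simp
  qed
qed

text \<open>For even \<open>a\<close> and \<open>b\<close> this is the radial monomial of the same bidegree as \<open>P\<close>.\<close>

definition W where "W z = u z ^ (a div 2) * v z ^ (b div 2)"

lemma poly_W: "polyfun W"
  unfolding W_def[abs_def] by (intro polynomial_intros poly_uv)

lemma W_nonzero: "\<exists>z. W z \<noteq> 0"
  using unit_point unfolding W_def by (metis mult_1 power_one zero_neq_one)

lemma W_squared: "even a \<Longrightarrow> even b \<Longrightarrow> W z * W z = u z ^ a * v z ^ b"
  unfolding W_def by (elim evenE) (simp add: mult_2 power_add)

text \<open>\<open>\<Delta>\<^sub>x W\<close> is the positive multiple \<open>a (a + p - 2)\<close> of a nonzero monomial, whereas \<open>P\<close> is harmonic and nonzero.\<close>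

lemma not_multiple_of_W:
  assumes "even a"
  shows "\<not> (\<forall>z. P z = c * W z)"
proof
  assume P: "\<forall>z. P z = c * W z"
  have v: "polyfun (\<lambda>z. v z ^ (b div 2))" by (intro polynomial_intros poly_uv)
  have hv: "homogeneous_in B 0 (\<lambda>z. v z ^ (b div 2))"
    using homogeneous_in_power[OF hom_uv(3), of "b div 2"] by simp
  have lv: "laplacian B (\<lambda>z. v z ^ (b div 2)) = (\<lambda>z. 0)"
    using laplacian_sqrad_complement_power_mult[OF sub(1) polyfun_const[of 1], of "b div 2"]
    by (simp flip: C_eq)
  have "real a * (real a + real (card B) - 2) \<noteq> 0" using a_pos card_B by simp
  moreover have "2 * real (a div 2) = real a" using assms by (simp add: real_of_nat_div)
  ultimately have LW: "laplacian B W = (\<lambda>z. real a * (real a + real (card B) - 2) * (u z ^ (a div 2 - 1) * v z ^ (b div 2)))"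
    using laplacian_sqrad_power_mult[OF sub(1) v hv, of "a div 2"] unfolding lv W_def[abs_def] by simp
  obtain z1 where z1: "u z1 = 1" "v z1 = 1" by (rule unit_point)
  have "P = (\<lambda>z. c * W z)" using P by blast
  then have "c * laplacian B W z1 = 0" using harm_B laplacian_cmult[OF poly_W, of B c] by metis
  then have "c = 0" using LW z1 a_pos card_B by simp
  then show False using P nonzero by simp
qed

text \<open>A nontrivial quadratic relation would factor: its discriminant is nonnegative because a multiple of
\<open>W\<^sup>2\<close> is exhibited as a square. In an integral domain one factor would vanish, making \<open>P\<close> a multiple of \<open>W\<close>.\<close>

lemma W_P_quadratic_zero:
  assumes ev: "even a" "even b" and eq: "\<And>z. \<gamma> * P z ^ 2 + \<beta> * W z * P z + \<alpha> * W z ^ 2 = 0"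
  shows "\<gamma> = 0" "\<beta> = 0"
proof -
  obtain w where w: "W w \<noteq> 0" using W_nonzero by blast
  have lin: False if "\<And>z. r * P z + s * W z = 0" "r \<noteq> 0" for r s
  proof -
    have "P z = (- s / r) * W z" for z
      using that(1)[of z] that(2) by (simp add: field_simps)
    then show False using not_multiple_of_W[OF ev(1)] by blast
  qed
  show g: "\<gamma> = 0"
  proof (rule ccontr)
    assume g: "\<gamma> \<noteq> 0"
    define D where "D = \<beta>\<^sup>2 - 4 * \<alpha> * \<gamma>"
    have sq: "(2 * \<gamma> * P z + \<beta> * W z)\<^sup>2 = D * (W z)\<^sup>2" for z
    proof -
      have "(2 * \<gamma> * P z + \<beta> * W z)\<^sup>2 - D * (W z)\<^sup>2 = 4 * \<gamma> * (\<gamma> * P z ^ 2 + \<beta> * W z * P z + \<alpha> * W z ^ 2)"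
        unfolding D_def by (simp add: power2_eq_square algebra_simps)
      then show ?thesis using eq[of z] by simp
    qed
    have "0 \<le> D * (W w)\<^sup>2" using sq[of w] by (metis zero_le_power2)
    then have D: "0 \<le> D" using w by (simp add: zero_le_mult_iff)
    \<comment> \<open>The two linear factors of the relation multiplied by \<open>4 \<gamma>\<close>.\<close>
    define f g where "f = (\<lambda>z. 2 * \<gamma> * P z + (\<beta> - sqrt D) * W z)" and "g = (\<lambda>z. 2 * \<gamma> * P z + (\<beta> + sqrt D) * W z)"
    have "polyfun f" "polyfun g"
      unfolding f_def g_def by (intro polynomial_intros poly poly_W)+
    moreover have "f z * g z = 0" for z
    proof -
      have "f z * g z = (2 * \<gamma> * P z + \<beta> * W z)\<^sup>2 - (sqrt D)\<^sup>2 * (W z)\<^sup>2"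
        unfolding f_def g_def by (simp add: power2_eq_square algebra_simps)
      then show ?thesis using sq D by simp
    qed
    ultimately have "(\<forall>z. f z = 0) \<or> (\<forall>z. g z = 0)"
      using polynomial_function_mult_eq_zero by blast
    then show False using lin g unfolding f_def g_def by (metis mult_eq_0_iff zero_neq_numeral)
  qed
  show "\<beta> = 0"
  proof (rule ccontr)
    assume b: "\<beta> \<noteq> 0"
    have "polyfun (\<lambda>z. \<beta> * P z + \<alpha> * W z)" by (intro polynomial_intros poly poly_W)
    moreover have "W z * (\<beta> * P z + \<alpha> * W z) = 0" for z
      using eq[of z] g by (simp add: power2_eq_square algebra_simps)
    ultimately have "\<beta> * P z + \<alpha> * W z = 0" for z
      using polynomial_function_mult_eq_zero[OF poly_W _ _ w] by blast
    then show False using lin b by blast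
  qed
qed

lemma gradient_pairing_monomial:
  assumes f: "polyfun f"
  shows "(grad_pairing C (\<lambda>z. u z ^ k * v z ^ l * f z) P z) =
    u z ^ k * (2 * real l * real b * v z ^ (l - 1) * P z * f z
      + v z ^ l * (grad_pairing C f P z))"
proof -
  let ?\<Gamma> = "\<lambda>f. grad_pairing C f P z"
  have mult: "?\<Gamma> (\<lambda>z. f z * g z) = f z * ?\<Gamma> g + ?\<Gamma> f * g z"
    if "polyfun f" "polyfun g" for f g
    using that by (simp add: partial_deriv_mult sum.distrib sum_distrib_left sum_distrib_right algebra_simps)
  have u: "?\<Gamma> u = 0" and v: "?\<Gamma> v = 2 * real b * P z"
    using grad_sqrad_inner[OF sub(1,2), of z P] grad_sqrad_inner[OF sub(2,2), of z P] disjoint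
      euler_homogeneous[OF poly hom_C sub(2), of z] by simp_all
  have uk: "?\<Gamma> (\<lambda>z. u z ^ k) = 0"
  proof (induction k)
    case (Suc k)
    have "?\<Gamma> (\<lambda>z. u z * u z ^ k) = u z * ?\<Gamma> (\<lambda>z. u z ^ k) + ?\<Gamma> u * u z ^ k"
      by (rule mult) (intro polynomial_intros poly_uv)+
    then show ?case unfolding Suc.IH u by simp
  qed simp
  have vl: "?\<Gamma> (\<lambda>z. v z ^ l) = 2 * real l * real b * v z ^ (l - 1) * P z"
  proof (induction l)
    case (Suc l)
    have "?\<Gamma> (\<lambda>z. v z * v z ^ l) = v z * ?\<Gamma> (\<lambda>z. v z ^ l) + ?\<Gamma> v * v z ^ l"
      by (rule mult) (intro polynomial_intros poly_uv)+
    then show ?case unfolding Suc.IH v by (cases l) (simp_all add: algebra_simps)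
  qed simp
  have "?\<Gamma> (\<lambda>z. u z ^ k * v z ^ l * f z) =
      u z ^ k * v z ^ l * ?\<Gamma> f + ?\<Gamma> (\<lambda>z. u z ^ k * v z ^ l) * f z"
    by (rule mult) (intro polynomial_intros poly_uv f)+
  moreover have "?\<Gamma> (\<lambda>z. u z ^ k * v z ^ l) = u z ^ k * ?\<Gamma> (\<lambda>z. v z ^ l) + ?\<Gamma> (\<lambda>z. u z ^ k) * v z ^ l"
    by (rule mult) (intro polynomial_intros poly_uv)+
  ultimately show ?thesis unfolding uk vl by (simp add: algebra_simps)
qed

text \<open>Both sides equal \<open>2 \<Sum> (\<partial>\<^sub>b\<partial>\<^sub>cP) (\<partial>\<^sub>bP) (\<partial>\<^sub>cP)\<close> in the first case and \<open>2 \<Sum> (\<partial>\<^sub>b\<partial>\<^sub>cP)\<^sup>2\<close> in the second, the sums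
running over \<open>b \<in> B\<close> and \<open>c \<in> C\<close>.\<close>

lemma mixed_hessian:
  "(grad_pairing C (grad_sq B) P z) =
   (grad_pairing B (grad_sq C) P z)"
  "laplacian C (grad_sq B) z = laplacian B (grad_sq C) z"
proof -
  have d: "partial_deriv c (grad_sq D) z =
      2 * (\<Sum>e\<in>D. partial_deriv e P z * partial_deriv c (partial_deriv e P) z)" if "finite D" for c D z
  proof -
    have "partial_deriv c (grad_sq D) z = (\<Sum>e\<in>D. partial_deriv c (\<lambda>z. partial_deriv e P z * partial_deriv e P z) z)"
      unfolding grad_sq_def[abs_def] power2_eq_square
      using partial_deriv_sum[OF that, of "\<lambda>e z. partial_deriv e P z * partial_deriv e P z"]
      by (simp add: polynomial_intros poly)
    then show ?thesis
      by (simp add: partial_deriv_mult polynomial_intros poly sum_distrib_left algebra_simps)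
  qed
  have com: "partial_deriv c (partial_deriv e P) z = partial_deriv e (partial_deriv c P) z" for c e
    using partial_deriv_commute[OF poly] by metis
  show "(grad_pairing C (grad_sq B) P z) =
    (grad_pairing B (grad_sq C) P z)"
    unfolding d[OF finite(1)] d[OF finite(2)] sum_distrib_left sum_distrib_right
    by (subst sum.swap) (simp add: mult_ac com)
  have l: "laplacian D (grad_sq E) z = 2 * (\<Sum>e\<in>E. \<Sum>c\<in>D. (partial_deriv c (partial_deriv e P) z)\<^sup>2)"
    if "finite E" "laplacian D P = (\<lambda>z. 0)" "D \<subseteq> Basis" for D E
  proof -
    have "laplacian D (grad_sq E) z = (\<Sum>e\<in>E. laplacian D (\<lambda>z. partial_deriv e P z * partial_deriv e P z) z)"
      unfolding grad_sq_def[abs_def] power2_eq_square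
      using laplacian_sum[OF that(1), of "\<lambda>e z. partial_deriv e P z * partial_deriv e P z"]
      by (simp add: polynomial_intros poly)
    then show ?thesis
      by (simp add: laplacian_mult polynomial_intros poly laplacian_partial_deriv[OF poly that(3)] that(2)
          sum_distrib_left power2_eq_square)
  qed
  show "laplacian C (grad_sq B) z = laplacian B (grad_sq C) z"
    unfolding l[OF finite(1) harm_C sub(2)] l[OF finite(2) harm_B sub(1)]
    by (subst sum.swap) (simp add: com)
qed

lemma laplacian_monomial:
  assumes "polyfun f" "homogeneous_in C d f"
  shows "laplacian C (\<lambda>z. u z ^ k * v z ^ l * f z) = (\<lambda>z. u z ^ k * (v z ^ l * laplacian C f z
    + 2 * real l * (2 * real l + real (card C) - 2 + 2 * real d) * (v z ^ (l - 1) * f z)))"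
proof -
  have "polyfun (\<lambda>z. v z ^ l * f z)" by (intro polynomial_intros poly_uv assms)
  from laplacian_sqrad_complement_power_mult[OF sub(2) this, of k]
  show ?thesis
    unfolding laplacian_sqrad_power_mult[OF sub(2) assms]
    by (simp add: mult.assoc flip: B_eq)
qed

lemma pairing_linear:
  assumes "polyfun f" "polyfun g"
  shows "(\<Sum>c\<in>C. partial_deriv c (\<lambda>z. r * f z + s * g z) z * h c) =
    r * (\<Sum>c\<in>C. partial_deriv c f z * h c) + s * (\<Sum>c\<in>C. partial_deriv c g z * h c)"
  using assms
  by (simp add: partial_deriv_add partial_deriv_cmult polynomial_intros sum.distrib
      sum_distrib_left algebra_simps)

context
  fixes K L :: real
  assumes parity: "even a \<and> even b \<or> L = 0"
    and law_B: "\<And>z. grad_sq B z = rhs_B K L z"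
begin

lemma grad_sq_B_eq: "grad_sq B = (\<lambda>z. (real a)\<^sup>2 * K * (u z ^ (a - 1) * v z ^ b * 1) +
    (real a)\<^sup>2 * L * (u z ^ (a div 2 - 1) * v z ^ (b div 2) * P z))"
  using law_B by (simp add: fun_eq_iff algebra_simps)

lemma polys:
  "polyfun (\<lambda>z. u z ^ k * v z ^ l * 1)"
  "polyfun (\<lambda>z. u z ^ k * v z ^ l * P z)"
  by (intro polynomial_intros poly_uv poly)+

lemma power_pred:
  "u z * u z ^ (a - 1) = u z ^ a" "v z * v z ^ (b - 1) = v z ^ b"
  "even a \<Longrightarrow> u z * u z ^ (a div 2 - 1) = u z ^ (a div 2)"
  "even b \<Longrightarrow> v z * v z ^ (b div 2 - 1) = v z ^ (b div 2)"
  "even a \<Longrightarrow> 2 * real (a div 2) = real a"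
  "even b \<Longrightarrow> 2 * real (b div 2) = real b"
  using a_pos b_pos by (auto simp: power_eq_if real_of_nat_div elim!: evenE)

text \<open>Multiplication by \<open>u v\<close> clears the exponents that are lowered by one. The term \<open>|\<nabla>\<^sub>yP|\<^sup>2\<close> produced by
differentiating the factor \<open>P\<close> is eliminated by the second identity.\<close>

lemma scaled_pairing:
  assumes law_C: "\<And>z. grad_sq C z = rhs_C K' L' z"
  shows "u z * v z * (grad_pairing C (grad_sq B) P z) =
    (real a)\<^sup>2 * (real b)\<^sup>2 * (2 * K * (u z ^ a * v z ^ b) * P z +
      L * W z * ((P z)\<^sup>2 + K' * (u z ^ a * v z ^ b) + L' * W z * P z))"
proof -
  have gC: "(grad_pairing C P P z) = grad_sq C z"
    by (simp add: grad_sq_def power2_eq_square)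
  have "u z * v z * (grad_pairing C (grad_sq B) P z) =
    (real a)\<^sup>2 * K * (2 * (real b)\<^sup>2 * (u z * u z ^ (a - 1)) * (v z * v z ^ (b - 1)) * P z) +
    (real a)\<^sup>2 * L * (u z * u z ^ (a div 2 - 1)) * ((2 * real (b div 2)) * real b * (v z * v z ^ (b div 2 - 1)) * (P z)\<^sup>2 +
        v z ^ (b div 2) * (v z * grad_sq C z))"
    unfolding grad_sq_B_eq pairing_linear[OF polys] gradient_pairing_monomial[OF poly]
      gradient_pairing_monomial[OF polyfun_const] gC
    by (simp add: algebra_simps power2_eq_square)
  also have "\<dots> = (real a)\<^sup>2 * (real b)\<^sup>2 * (2 * K * (u z ^ a * v z ^ b) * P z +
      L * W z * ((P z)\<^sup>2 + K' * (u z ^ a * v z ^ b) + L' * W z * P z))"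
  proof (cases "L = 0")
    case True
    then show ?thesis unfolding power_pred by simp
  next
    case False
    then have ev: "even a" "even b" using parity by auto
    have "v z * grad_sq C z = (real b)\<^sup>2 * (K' * (v z * v z ^ (b - 1)) * u z ^ a +
        L' * (v z * v z ^ (b div 2 - 1)) * u z ^ (a div 2) * P z)"
      unfolding law_C by (simp add: algebra_simps)
    then show ?thesis
      unfolding power_pred(1,2) power_pred(3)[OF ev(1)] power_pred(4,6)[OF ev(2)] W_def
      by (simp add: algebra_simps power2_eq_square)
  qed
  finally show ?thesis .
qed

lemma scaled_laplacian:
  "u z * v z * laplacian C (grad_sq B) z = (real a)\<^sup>2 *
    (2 * real b * (2 * real b + real (card C) - 2) * K * (u z ^ a * v z ^ b) +
     L * real b * (3 * real b + real (card C) - 2) * (W z * P z))"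
proof -
  have "u z * v z * laplacian C (grad_sq B) z =
    (real a)\<^sup>2 * K * ((u z * u z ^ (a - 1)) * (2 * real b * (2 * real b + real (card C) - 2) * (v z * v z ^ (b - 1)))) +
    (real a)\<^sup>2 * L * ((u z * u z ^ (a div 2 - 1)) * ((2 * real (b div 2)) *
      ((2 * real (b div 2)) + real (card C) - 2 + 2 * real b) * ((v z * v z ^ (b div 2 - 1)) * P z)))"
    unfolding grad_sq_B_eq
    by (simp add: laplacian_add laplacian_cmult polys[simplified] polynomial_intros poly_uv poly
        laplacian_monomial[OF poly hom_C] harm_C
        laplacian_monomial[OF polyfun_const[of 1] homogeneous_in_const, simplified])
      (simp add: algebra_simps)
  also have "\<dots> = (real a)\<^sup>2 *
    (2 * real b * (2 * real b + real (card C) - 2) * K * (u z ^ a * v z ^ b) +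
     L * real b * (3 * real b + real (card C) - 2) * (W z * P z))"
  proof (cases "L = 0")
    case True
    then show ?thesis unfolding power_pred by simp
  next
    case False
    then have ev: "even a" "even b" using parity by auto
    show ?thesis
      unfolding power_pred(1,2) power_pred(3)[OF ev(1)] power_pred(4,6)[OF ev(2)] W_def
      by (simp add: algebra_simps)
  qed
  finally show ?thesis .
qed

end

text \<open>By \<open>mixed_hessian\<close> the right side of \<open>scaled_pairing\<close> is unchanged when the two blocks are
exchanged. For even \<open>a\<close>, \<open>b\<close> the factor \<open>W\<close> cancels and a quadratic relation between \<open>P\<close> and \<open>W\<close> with the
coefficients \<open>L - L'\<close>, \<open>2 (K - K')\<close>, \<open>L K' - L' K\<close> remains; otherwise \<open>L = L' = 0\<close> and \<open>(K - K') P = 0\<close>.\<close>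

lemma constants_agree:
  assumes parity: "even a \<and> even b \<or> L = 0" "even a \<and> even b \<or> L' = 0"
    and law_B: "\<And>z. grad_sq B z = rhs_B K L z"
    and law_C: "\<And>z. grad_sq C z = rhs_C K' L' z"
  shows "K = K'" "L = L'"
proof -
  interpret sw: separately_harmonic C B P b a by (rule swap)
  have parity': "even b \<and> even a \<or> L' = 0" using parity by blast
  define U where "U z = u z ^ a * v z ^ b" for z
  have poly_U: "polyfun U"
    unfolding U_def[abs_def] by (intro polynomial_intros poly_uv)
  have sW: "sw.W z = W z" for z by (simp add: W_def sw.W_def mult.commute)
  have eq: "2 * K * U z * P z + L * W z * ((P z)\<^sup>2 + K' * U z + L' * W z * P z) =
      2 * K' * U z * P z + L' * W z * ((P z)\<^sup>2 + K * U z + L * W z * P z)" for z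
  proof -
    have "(real a)\<^sup>2 * (real b)\<^sup>2 * (2 * K * U z * P z + L * W z * ((P z)\<^sup>2 + K' * U z + L' * W z * P z)) =
      (real a)\<^sup>2 * (real b)\<^sup>2 * (2 * K' * U z * P z + L' * W z * ((P z)\<^sup>2 + K * U z + L * W z * P z))"
    proof -
      have "(real a)\<^sup>2 * (real b)\<^sup>2 * (2 * K * U z * P z + L * W z * ((P z)\<^sup>2 + K' * U z + L' * W z * P z)) =
          u z * v z * (grad_pairing C (grad_sq B) P z)"
        unfolding scaled_pairing[OF parity(1) law_B law_C, of z] U_def ..
      also have "\<dots> = v z * u z * (grad_pairing B (grad_sq C) P z)"
        unfolding mixed_hessian(1)[of z] by (simp add: mult.commute)
      also have "\<dots> = (real a)\<^sup>2 * (real b)\<^sup>2 * (2 * K' * U z * P z + L' * W z * ((P z)\<^sup>2 + K * U z + L * W z * P z))"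
        unfolding sw.scaled_pairing[OF parity' law_C law_B, of z] sW U_def by (simp add: mult_ac)
      finally show ?thesis .
    qed
    then show ?thesis using a_pos b_pos by simp
  qed
  have "K = K' \<and> L = L'"
  proof (cases "even a \<and> even b")
    case True
    obtain w where w: "W w \<noteq> 0" using W_nonzero by blast
    have "polyfun (\<lambda>z. (L - L') * P z ^ 2 + 2 * (K - K') * W z * P z + (L * K' - L' * K) * W z ^ 2)"
      by (intro polynomial_intros poly poly_W)
    moreover have "W z * ((L - L') * P z ^ 2 + 2 * (K - K') * W z * P z + (L * K' - L' * K) * W z ^ 2) = 0" for z
    proof -
      have "U z = W z * W z" using W_squared True by (simp add: U_def)
      then show ?thesis using eq[of z] by (simp add: algebra_simps power2_eq_square)
    qed
    ultimately have "(L - L') * P z ^ 2 + 2 * (K - K') * W z * P z + (L * K' - L' * K) * W z ^ 2 = 0" for z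
      using polynomial_function_mult_eq_zero[OF poly_W _ _ w] by blast
    from W_P_quadratic_zero[OF _ _ this] True show ?thesis by auto
  next
    case False
    then have L: "L = 0" "L' = 0" using parity by auto
    obtain z1 where "u z1 = 1" "v z1 = 1" by (rule unit_point)
    then have "U z1 \<noteq> 0" by (simp add: U_def)
    moreover have "U z * ((K - K') * P z) = 0" for z
      using eq[of z] L by (simp add: algebra_simps)
    moreover have "polyfun (\<lambda>z. (K - K') * P z)" by (intro polynomial_intros poly)
    ultimately have "(K - K') * P z = 0" for z
      using polynomial_function_mult_eq_zero[OF poly_U] by blast
    then show ?thesis using nonzero L by auto
  qed
  then show "K = K'" "L = L'" by auto
qed

text \<open>Here the quantity that is symmetric in the two blocks is the one of \<open>scaled_laplacian\<close>. Linear
independence of \<open>W\<close> and \<open>P\<close> allows the coefficients of \<open>K\<close> to be compared alone.\<close>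

lemma dimensions_proportional:
  assumes parity: "even a \<and> even b \<or> L = 0" and K: "K \<noteq> 0"
    and law_B: "\<And>z. grad_sq B z = rhs_B K L z"
    and law_C: "\<And>z. grad_sq C z = rhs_C K L z"
  shows "(real (card B) - 2) / real a = (real (card C) - 2) / real b"
proof -
  interpret sw: separately_harmonic C B P b a by (rule swap)
  have parity': "even b \<and> even a \<or> L = 0" using parity by blast
  define p q where "p = real (card B)" and "q = real (card C)"
  define \<kappa> where "\<kappa> = (real a)\<^sup>2 * (2 * real b * (2 * real b + q - 2)) - (real b)\<^sup>2 * (2 * real a * (2 * real a + p - 2))"
  define \<mu> where "\<mu> = (real a)\<^sup>2 * (real b * (3 * real b + q - 2)) - (real b)\<^sup>2 * (real a * (3 * real a + p - 2))"
  define U where "U z = u z ^ a * v z ^ b" for z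
  have sW: "sw.W z = W z" for z by (simp add: W_def sw.W_def mult.commute)
  have eq: "\<kappa> * K * U z + \<mu> * L * (W z * P z) = 0" for z
  proof -
    have "(real a)\<^sup>2 * (2 * real b * (2 * real b + q - 2) * K * U z +
        L * real b * (3 * real b + q - 2) * (W z * P z)) =
      (real b)\<^sup>2 * (2 * real a * (2 * real a + p - 2) * K * U z +
        L * real a * (3 * real a + p - 2) * (W z * P z))"
    proof -
      have "(real a)\<^sup>2 * (2 * real b * (2 * real b + q - 2) * K * U z +
          L * real b * (3 * real b + q - 2) * (W z * P z)) = u z * v z * laplacian C (grad_sq B) z"
        unfolding scaled_laplacian[OF parity law_B, of z] U_def q_def ..
      also have "\<dots> = v z * u z * laplacian B (grad_sq C) z"
        unfolding mixed_hessian(2)[of z] by (simp only: mult.commute)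
      also have "\<dots> = (real b)\<^sup>2 * (2 * real a * (2 * real a + p - 2) * K * U z +
          L * real a * (3 * real a + p - 2) * (W z * P z))"
        unfolding sw.scaled_laplacian[OF parity' law_C, of z] sW U_def p_def by (simp add: mult_ac)
      finally show ?thesis .
    qed
    then show ?thesis unfolding \<kappa>_def \<mu>_def by (simp add: algebra_simps)
  qed
  have "\<kappa> = 0"
  proof (cases "L = 0")
    case True
    obtain z1 where "u z1 = 1" "v z1 = 1" by (rule unit_point)
    then show ?thesis using eq[of z1] True K by (simp add: U_def)
  next
    case False
    then have ev: "even a" "even b" using parity by auto
    have "0 * P z ^ 2 + (\<mu> * L) * W z * P z + (\<kappa> * K) * W z ^ 2 = 0" for z
      using eq[of z] W_squared[OF ev, of z] by (simp add: U_def power2_eq_square algebra_simps)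
    from W_P_quadratic_zero(2)[OF ev this] have "\<mu> * L = 0" .
    moreover obtain z1 where "u z1 = 1" "v z1 = 1" by (rule unit_point)
    ultimately show ?thesis using eq[of z1] K by (auto simp: U_def)
  qed
  then have "2 * real a * real b * (real a * (q - 2) - real b * (p - 2)) = 0"
    unfolding \<kappa>_def by (simp add: algebra_simps power2_eq_square)
  then have "real a * (q - 2) = real b * (p - 2)" using a_pos b_pos by simp
  then show ?thesis using a_pos b_pos by (simp add: p_def q_def field_simps)
qed

end

text \<open>The squared norm of the tensor of all derivatives of order \<open>j\<close> in the directions of \<open>B\<close>. The recursion
runs over the innermost derivative, which suits induction over harmonic functions: they are preserved by
differentiation.\<close>

primrec derivs_sq :: "nat \<Rightarrow> 'a::euclidean_space set \<Rightarrow> ('a \<Rightarrow> real) \<Rightarrow> 'a \<Rightarrow> real" where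
  "derivs_sq 0 B f = (\<lambda>z. (f z)\<^sup>2)"
| "derivs_sq (Suc j) B f = (\<lambda>z. \<Sum>b\<in>B. derivs_sq j B (partial_deriv b f) z)"

lemma derivs_sq_nonneg: "0 \<le> derivs_sq j B f z"
  by (induction j arbitrary: f) (auto intro: sum_nonneg)

lemma polyfun_derivs_sq:
  fixes f :: "'a::euclidean_space \<Rightarrow> real"
  assumes "polyfun f" "finite B"
  shows "polyfun (derivs_sq j B f)"
  using assms(1)
  by (induction j arbitrary: f) (auto intro!: polynomial_intros real_polynomial_function_sum assms(2))

lemma laplacian_derivs_sq:
  fixes f :: "'a::euclidean_space \<Rightarrow> real"
  assumes "polyfun f" "B \<subseteq> Basis" "laplacian B f = (\<lambda>z. 0)"
  shows "laplacian B (derivs_sq j B f) = (\<lambda>z. 2 * derivs_sq (Suc j) B f z)"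
  using assms(1,3)
proof (induction j arbitrary: f)
  case 0
  then show ?case
    by (simp add: power2_eq_square laplacian_mult)
next
  case (Suc j)
  have fin: "finite B" using assms(2) finite_Basis finite_subset by blast
  have "laplacian B (partial_deriv b f) = (\<lambda>z. 0)" for b
    using laplacian_partial_deriv[OF Suc.prems(1) assms(2), of b] Suc.prems(2) by simp
  then have "laplacian B (derivs_sq j B (partial_deriv b f)) = (\<lambda>z. 2 * derivs_sq (Suc j) B (partial_deriv b f) z)" for b
    by (rule Suc.IH[OF polyfun_partial_deriv[OF Suc.prems(1)]])
  moreover have "laplacian B (derivs_sq (Suc j) B f) =
      (\<lambda>z. \<Sum>b\<in>B. laplacian B (derivs_sq j B (partial_deriv b f)) z)"
    unfolding derivs_sq.simps using fin Suc.prems(1)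
    by (intro laplacian_sum polyfun_derivs_sq polyfun_partial_deriv)
  ultimately show ?case
    unfolding derivs_sq.simps(2)[of "Suc j"] by (simp only: sum_distrib_left)
qed

text \<open>If all derivatives of some order \<open>j \<le> d\<close> vanish, so do those of order \<open>j - 1\<close>, because these are
homogeneous of positive degree and Euler's relation recovers them from their gradients.\<close>

lemma derivs_sq_eq_zero:
  fixes f :: "'a::euclidean_space \<Rightarrow> real"
  assumes "polyfun f" "B \<subseteq> Basis" "homogeneous_in B d f" "j \<le> d"
    and "\<And>z. derivs_sq j B f z = 0"
  shows "f z = 0"
  using assms(1,3-5)
proof (induction j arbitrary: f d z)
  case 0
  show ?case using "0.prems"(4)[of z] by simp
next
  case (Suc j)
  have fin: "finite B" using assms(2) finite_Basis finite_subset by blast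
  have "partial_deriv b f w = 0" if b: "b \<in> B" for b w
  proof -
    have zero: "derivs_sq j B (partial_deriv b f) z = 0" for z
    proof -
      have "(\<Sum>c\<in>B. derivs_sq j B (partial_deriv c f) z) = 0"
        using Suc.prems(4)[of z] by simp
      then show ?thesis
        using sum_nonneg_eq_0_iff[OF fin, of "\<lambda>c. derivs_sq j B (partial_deriv c f) z"] b
        by (simp add: derivs_sq_nonneg)
    qed
    have le: "j \<le> d - 1" using Suc.prems(3) by simp
    show ?thesis
      by (rule Suc.IH[OF polyfun_partial_deriv[OF Suc.prems(1)]
          homogeneous_in_partial_deriv[OF Suc.prems(1,2) assms(2) b] le zero])
  qed
  then have "(euler_op B f z) = 0" by (intro sum.neutral) simp
  then have "real d * f z = 0"
    using euler_homogeneous[OF Suc.prems(1,2) assms(2), of z] by argo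
  moreover have "d \<noteq> 0" using Suc.prems(3) by simp
  ultimately show ?case by simp
qed

context separately_harmonic
begin

text \<open>Start from the identity for \<open>|\<nabla>\<^sub>xP|\<^sup>2\<close>, the case \<open>j = 1\<close> of \<open>derivs_sq\<close>, and apply \<open>\<Delta>\<^sub>x\<close> exactly \<open>a - 1\<close> times. The
power \<open>u\<^bsup>a-1\<^esup>\<close> survives with a positive factor, while \<open>u\<^bsup>a/2-1\<^esup> P\<close> is annihilated after \<open>a/2\<close> steps. Hence
\<open>K\<close> times a positive multiple of \<open>v\<^sup>b\<close> is a sum of squares that cannot vanish identically.\<close>

lemma K_pos:
  assumes parity: "even a \<and> even b \<or> L = 0"
    and law_B: "\<And>z. grad_sq B z = rhs_B K L z"
  shows "K > 0"
proof -
  define p where "p = real (card B)"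
  have p: "p \<ge> 2" using card_B by (simp add: p_def)
  have "j < a \<Longrightarrow> \<exists>\<kappa> \<beta>. \<kappa> > 0 \<and> (\<beta> = 0 \<or> even a \<and> j < a div 2) \<and>
    derivs_sq (Suc j) B P = (\<lambda>z. K * \<kappa> * (u z ^ (a - 1 - j) * v z ^ b) +
      \<beta> * (u z ^ (a div 2 - 1 - j) * (v z ^ (b div 2) * P z)))" for j
  proof (induction j)
    case 0
    have "derivs_sq (Suc 0) B P = grad_sq B" by (simp add: grad_sq_def fun_eq_iff)
    then show ?case
      using a_pos parity
      by (intro exI[of _ "(real a)\<^sup>2"] exI[of _ "(real a)\<^sup>2 * L"])
        (auto simp: fun_eq_iff law_B algebra_simps elim!: evenE)
  next
    case (Suc j)
    then obtain \<kappa> \<beta> where \<kappa>: "\<kappa> > 0" and \<beta>: "\<beta> = 0 \<or> even a \<and> j < a div 2" and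
      eq: "derivs_sq (Suc j) B P = (\<lambda>z. K * \<kappa> * (u z ^ (a - 1 - j) * v z ^ b) +
        \<beta> * (u z ^ (a div 2 - 1 - j) * (v z ^ (b div 2) * P z)))" by auto
    define k where "k = real (a - 1 - j)"
    define k' where "k' = real (a div 2 - 1 - j)"
    define \<kappa>' where "\<kappa>' = \<kappa> * (k * (2 * k + p - 2))"
    define \<beta>' where "\<beta>' = \<beta> * (k' * (2 * k' + p - 2 + 2 * real a))"
    have k: "k > 0" using Suc.prems by (simp add: k_def)
    then have "\<kappa>' > 0" using \<kappa> p by (simp add: \<kappa>'_def)
    moreover have "\<beta>' = 0 \<or> even a \<and> Suc j < a div 2"
      using \<beta> by (cases "Suc j < a div 2") (auto simp: \<beta>'_def k'_def)
    moreover have "derivs_sq (Suc (Suc j)) B P = (\<lambda>z. K * \<kappa>' * (u z ^ (a - 1 - Suc j) * v z ^ b) +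
      \<beta>' * (u z ^ (a div 2 - 1 - Suc j) * (v z ^ (b div 2) * P z)))"
    proof -
      have vl: "laplacian B (\<lambda>z. v z ^ l) = (\<lambda>z. 0)" for l
        using laplacian_sqrad_complement_power_mult[OF sub(1) polyfun_const[of 1], of l]
        by (simp flip: C_eq)
      have vP: "laplacian B (\<lambda>z. v z ^ l * P z) = (\<lambda>z. 0)" for l
        using laplacian_sqrad_complement_power_mult[OF sub(1) poly, of l] harm_B by (simp flip: C_eq)
      have hv: "homogeneous_in B 0 (\<lambda>z. v z ^ l)" for l
        using homogeneous_in_power[OF hom_uv(3), of l] by simp
      have hvP: "homogeneous_in B a (\<lambda>z. v z ^ l * P z)" for l
        using homogeneous_in_mult[OF hv hom_B] by simp
      have pv: "polyfun (\<lambda>z. v z ^ l)" "polyfun (\<lambda>z. v z ^ l * P z)"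
        "polyfun (\<lambda>z. u z ^ i * v z ^ l)" "polyfun (\<lambda>z. u z ^ i * (v z ^ l * P z))" for i l
        by (intro polynomial_intros poly poly_uv)+
      have "(\<lambda>z. 2 * derivs_sq (Suc (Suc j)) B P z) = laplacian B (derivs_sq (Suc j) B P)"
        by (rule laplacian_derivs_sq[OF poly sub(1) harm_B, symmetric])
      also have "\<dots> = (\<lambda>z. K * \<kappa> * (2 * k * (2 * k + p - 2) * (u z ^ (a - 1 - j - 1) * v z ^ b)) +
          \<beta> * (2 * k' * (2 * k' + p - 2 + 2 * real a) * (u z ^ (a div 2 - 1 - j - 1) * (v z ^ (b div 2) * P z))))"
        unfolding eq k_def k'_def p_def
        using pv by (simp add: laplacian_add laplacian_cmult polynomial_intros
            laplacian_sqrad_power_mult[OF sub(1) pv(1) hv] laplacian_sqrad_power_mult[OF sub(1) pv(2) hvP] vl vP)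
      finally have "2 * derivs_sq (Suc (Suc j)) B P z = 2 * (K * \<kappa>' * (u z ^ (a - 1 - j - 1) * v z ^ b) +
          \<beta>' * (u z ^ (a div 2 - 1 - j - 1) * (v z ^ (b div 2) * P z)))" for z
        unfolding \<kappa>'_def \<beta>'_def by (simp add: fun_eq_iff algebra_simps)
      then have "derivs_sq (Suc (Suc j)) B P z = K * \<kappa>' * (u z ^ (a - 1 - j - 1) * v z ^ b) +
          \<beta>' * (u z ^ (a div 2 - 1 - j - 1) * (v z ^ (b div 2) * P z))" for z
        by (rule mult_left_cancel[THEN iffD1, rotated]) simp
      then show ?thesis by (simp add: fun_eq_iff del: derivs_sq.simps)
    qed
    ultimately show ?case by blast
  qed
  \<comment> \<open>At \<open>j = a - 1\<close> the second alternative for \<open>\<beta>\<close> would give \<open>a - 1 < a/2\<close>, which no even \<open>a > 0\<close> satisfies.\<close>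
  from this[of "a - 1"] obtain \<kappa> \<beta> where \<kappa>: "\<kappa> > 0" "\<beta> = 0 \<or> even a \<and> a - 1 < a div 2" and
    eq: "derivs_sq (Suc (a - 1)) B P = (\<lambda>z. K * \<kappa> * (u z ^ (a - 1 - (a - 1)) * v z ^ b) +
      \<beta> * (u z ^ (a div 2 - 1 - (a - 1)) * (v z ^ (b div 2) * P z)))"
    using a_pos by auto
  have "\<beta> = 0" using \<kappa>(2) a_pos by (auto elim!: evenE)
  then have D: "derivs_sq a B P z = K * \<kappa> * v z ^ b" for z
    using eq a_pos by (simp del: derivs_sq.simps)
  show "K > 0"
  proof (rule ccontr)
    assume "\<not> K > 0"
    then have "derivs_sq a B P z \<le> 0" for z
      unfolding D using \<kappa>(1) by (intro mult_nonpos_nonneg) (simp_all add: mult_nonpos_nonneg sqrad_nonneg)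
    then have "derivs_sq a B P z = 0" for z using derivs_sq_nonneg[of a B P z] by (simp add: order.antisym)
    from derivs_sq_eq_zero[OF poly sub(1) hom_B order.refl this] show False using nonzero by blast
  qed
qed

end

section \<open>Closure and the gradient identities\<close>

lemma homogeneous_in_Basis:
  assumes "B \<subseteq> Basis" "homogeneous_in B a f" "homogeneous_in (Basis - B) b f"
  shows "homogeneous_in Basis (a + b) f"
  using assms unfolding homogeneous_in_def dilate_Basis
  by (metis dilate_both power_add mult.assoc)

context separately_harmonic
begin

lemma gradient_identities_of_closed:
  assumes "laplacian_algebra (alg)"
  shows "\<exists>K L. K > 0 \<and> (even a \<and> even b \<or> L = 0) \<and>
    (\<forall>z. grad_sq B z = rhs_B K L z) \<and>
    (\<forall>z. grad_sq C z = rhs_C K L z)"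
proof -
  interpret sw: separately_harmonic C B P b a by (rule swap)
  obtain K L where KL: "even a \<and> even b \<or> L = 0" "\<And>z. grad_sq B z = rhs_B K L z"
    using grad_sq_form[OF assms] by blast
  have "laplacian_algebra (generated_algebra {v, u, P})"
    using assms by (simp add: insert_commute)
  then obtain K' L' where KL': "even b \<and> even a \<or> L' = 0" "\<And>z. grad_sq C z = rhs_C K' L' z"
    using sw.grad_sq_form by blast
  have "even a \<and> even b \<or> L' = 0" using KL'(1) by blast
  from constants_agree[OF KL(1) this KL(2) KL'(2)] have "K = K'" "L = L'" .
  moreover have "K > 0" using K_pos[OF KL] .
  ultimately show ?thesis using KL KL' by blast
qed

lemma closed_of_gradient_identities:
  assumes "\<And>z. grad_sq B z = m1 z" "m1 \<in> alg"
    and "\<And>z. grad_sq C z = m2 z" "m2 \<in> alg"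
  shows "laplacian_algebra (alg)"
proof (rule laplacian_algebraI)
  let ?A = "alg"
  let ?\<Gamma> = "\<lambda>f g z. grad_pairing Basis f g z"
  have gens: "u \<in> ?A" "v \<in> ?A" "P \<in> ?A" by (simp_all add: generated_algebra.gen)
  show "homogeneous_poly 2 u"
    using homogeneous_in_Basis[OF sub(1) hom_uv(1), of 0] hom_uv(2) poly_uv
    by (simp add: homogeneous_poly_iff flip: C_eq)
  show "homogeneous_poly 2 v"
    using homogeneous_in_Basis[OF sub(1) hom_uv(3), of 2] hom_uv(4) poly_uv
    by (simp add: homogeneous_poly_iff numeral_2_eq_2 flip: C_eq)
  show "homogeneous_poly (a + b) P"
    using homogeneous_in_Basis[OF sub(1) hom_B] hom_C poly
    by (simp add: homogeneous_poly_iff flip: C_eq)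
  have "(\<lambda>z. (norm z)\<^sup>2) = (\<lambda>z. u z + v z)"
    using sqrad_split[OF sub(1)] by (simp add: fun_eq_iff flip: C_eq)
  then show "(\<lambda>z. (norm z)\<^sup>2) \<in> ?A" using gens generated_algebra.add[of u _ v] by simp
  have uf: "?\<Gamma> u f z = 2 * (euler_op B f z)"
    and vf: "?\<Gamma> v f z = 2 * (euler_op C f z)" for f z
    using grad_sqrad_inner[OF sub(1) order.refl] grad_sqrad_inner[OF sub(2) order.refl] sub
    by (simp_all add: Int_absorb2)
  have "?\<Gamma> u u = (\<lambda>z. 4 * u z)" "?\<Gamma> u v = (\<lambda>z. 0)" "?\<Gamma> v v = (\<lambda>z. 4 * v z)"
    "?\<Gamma> u P = (\<lambda>z. 2 * real a * P z)" "?\<Gamma> v P = (\<lambda>z. 2 * real b * P z)"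
    unfolding uf vf
    using euler_homogeneous[OF poly_uv(1) hom_uv(1) sub(1)] euler_homogeneous[OF poly_uv(2) hom_uv(3) sub(1)]
      euler_homogeneous[OF poly_uv(2) hom_uv(4) sub(2)]
      euler_homogeneous[OF poly hom_B sub(1)] euler_homogeneous[OF poly hom_C sub(2)]
    by (simp_all add: mult.assoc)
  moreover have "?\<Gamma> P P = (\<lambda>z. m1 z + m2 z)"
    unfolding sum_Basis using assms(1,3) by (simp add: fun_eq_iff grad_sq_def power2_eq_square)
  ultimately have \<Gamma>: "?\<Gamma> u u \<in> ?A" "?\<Gamma> u v \<in> ?A" "?\<Gamma> v v \<in> ?A" "?\<Gamma> u P \<in> ?A" "?\<Gamma> v P \<in> ?A" "?\<Gamma> P P \<in> ?A"
    by (simp_all only:) (intro generated_algebra.const generated_algebra.add generated_algebra_cmult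
        gens assms(2,4))+
  have "laplacian Basis P = (\<lambda>z. 0)"
    using laplacian_split[OF sub(1), of P] harm_B harm_C by (simp add: fun_eq_iff flip: C_eq)
  then have "laplacian Basis u \<in> ?A" "laplacian Basis v \<in> ?A" "laplacian Basis P \<in> ?A"
    using laplacian_sqrad[OF sub(1) order.refl] laplacian_sqrad[OF sub(2) order.refl]
    by (simp_all add: generated_algebra.const)
  then have lap: "laplacian Basis g \<in> ?A" if "g \<in> {u, v, P}" for g using that by blast
  have "?\<Gamma> v u \<in> ?A" "?\<Gamma> P u \<in> ?A" "?\<Gamma> P v \<in> ?A"
    using \<Gamma>(2,4,5) by (simp_all only: mult.commute)
  with \<Gamma> have grad: "?\<Gamma> g h \<in> ?A" if "g \<in> {u, v, P}" "h \<in> {u, v, P}" for g h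
    using that by blast
  have gpoly: "polyfun g" if "g \<in> {u, v, P}" for g
    using that poly_uv poly by blast
  show "laplacian Basis f \<in> ?A" if "f \<in> ?A" for f
    by (rule generated_algebra_laplacian_closed[OF gpoly lap grad that])
qed

lemma norm_grad_eq_grad_sq: "(norm (grad B P z))\<^sup>2 = grad_sq B z" "(norm (grad C P z))\<^sup>2 = grad_sq C z"
  using norm_grad_squared[OF sub(1)] norm_grad_squared[OF sub(2)] by (simp_all add: grad_sq_def)

theorem closed_iff_gradient_identities:
  "laplacian_algebra (alg) \<longleftrightarrow>
    (\<exists>K L. K > 0 \<and>
      (\<forall>z. (norm (grad B P z))\<^sup>2 = (real a)\<^sup>2 * (K * u z ^ (a - 1) * v z ^ b +
        (if even a \<and> even b then L * u z ^ (a div 2 - 1) * v z ^ (b div 2) * P z else 0))) \<and>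
      (\<forall>z. (norm (grad C P z))\<^sup>2 = (real b)\<^sup>2 * (K * u z ^ a * v z ^ (b - 1) +
        (if even a \<and> even b then L * u z ^ (a div 2) * v z ^ (b div 2 - 1) * P z else 0))))"
    (is "?closed \<longleftrightarrow> ?laws")
proof
  assume ?closed
  then obtain K L where "K > 0" and par: "even a \<and> even b \<or> L = 0" and laws: "\<And>z. grad_sq B z = rhs_B K L z"
    "\<And>z. grad_sq C z = rhs_C K L z"
    using gradient_identities_of_closed by blast
  then show ?laws
    unfolding norm_grad_eq_grad_sq
    by (intro exI[of _ K] exI[of _ L]) (auto simp: mult_ac)
next
  assume ?laws
  then obtain K L where laws: "\<And>z. grad_sq B z = (real a)\<^sup>2 * (K * u z ^ (a - 1) * v z ^ b +
        (if even a \<and> even b then L * u z ^ (a div 2 - 1) * v z ^ (b div 2) * P z else 0))"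
      "\<And>z. grad_sq C z = (real b)\<^sup>2 * (K * u z ^ a * v z ^ (b - 1) +
        (if even a \<and> even b then L * u z ^ (a div 2) * v z ^ (b div 2 - 1) * P z else 0))"
    unfolding norm_grad_eq_grad_sq by blast
  have mem: "(\<lambda>z. r * (K * u z ^ i * v z ^ j + (if Q then L * u z ^ k * v z ^ l * P z else 0)))
      \<in> alg" for r i j k l Q
    by (cases Q) (simp_all only: if_True if_False, intro generated_algebra_cmult generated_algebra.add generated_algebra.mult
        generated_algebra_power generated_algebra.const generated_algebra.gen; simp)+
  show ?closed by (rule closed_of_gradient_identities[OF laws(1) mem laws(2) mem])
qed

end

section \<open>The product of two spheres\<close>

lemma part_inner: "B \<subseteq> Basis \<Longrightarrow> part B z \<bullet> w = (\<Sum>b\<in>B. (z \<bullet> b) * (w \<bullet> b))"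
  unfolding part_def inner_sum_left by (simp add: inner_commute)

lemma part_inner_part: "B \<subseteq> Basis \<Longrightarrow> part B z \<bullet> part B w = part B z \<bullet> w"
  by (simp only: part_inner[of B z]) (auto intro!: sum.cong simp: part_inner_Basis subsetD)

lemma sqrad_has_derivative:
  assumes "B \<subseteq> Basis"
  shows "(sqrad B has_derivative (\<lambda>h. 2 * (part B z \<bullet> h))) (at z)"
proof -
  have "(\<Sum>b\<in>Basis. (h \<bullet> b) * partial_deriv b (sqrad B) z) = 2 * (part B z \<bullet> h)" for h
    using grad_sqrad_inner[OF assms order.refl, of z "\<lambda>w. h \<bullet> w"] assms
    by (simp add: partial_deriv_linear bounded_linear_inner_right Int_absorb2 part_inner mult.commute)
  then show ?thesis
    using polyfun_has_derivative[OF polyfun_sqrad[OF assms], of z] by simp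
qed

text \<open>The divergence is defined by a trace over a tangent space; comparison with the full trace needs a basis
adapted to the tangent space.\<close>

lemma trace_orthonormal:
  fixes A :: "'a::euclidean_space \<Rightarrow> 'a"
  assumes "linear A" and E: "pairwise orthogonal E" "\<And>e. e \<in> E \<Longrightarrow> norm e = 1" "span E = UNIV" "finite E"
  shows "(\<Sum>e\<in>E. A e \<bullet> e) = (\<Sum>b\<in>Basis. A b \<bullet> b)"
proof -
  have "(\<Sum>e\<in>E. A e \<bullet> e) = (\<Sum>e\<in>E. \<Sum>b\<in>Basis. (e \<bullet> b) * (A b \<bullet> e))"
  proof (rule sum.cong)
    fix e
    have "A e = A (\<Sum>b\<in>Basis. (e \<bullet> b) *\<^sub>R b)" by (simp add: euclidean_representation)
    also have "\<dots> = (\<Sum>b\<in>Basis. (e \<bullet> b) *\<^sub>R A b)"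
      using assms(1) by (simp add: linear_sum linear_cmul)
    finally have "A e \<bullet> e = (\<Sum>b\<in>Basis. (e \<bullet> b) *\<^sub>R A b) \<bullet> e" by simp
    then show "A e \<bullet> e = (\<Sum>b\<in>Basis. (e \<bullet> b) * (A b \<bullet> e))" by (simp add: inner_sum_left)
  qed simp
  also have "\<dots> = (\<Sum>b\<in>Basis. A b \<bullet> (\<Sum>e\<in>E. (b \<bullet> e) *\<^sub>R e))"
    by (subst sum.swap) (simp add: inner_sum_right inner_commute)
  also have "\<dots> = (\<Sum>b\<in>Basis. A b \<bullet> b)"
    using orthonormal_basis_expand[OF E(1,2) _ E(4)] E(3) by simp
  finally show ?thesis .
qed

context separately_harmonic
begin

lemma sphere_product_iff: "z \<in> sphere_product B \<longleftrightarrow> u z = 1 \<and> v z = 1"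
  unfolding sphere_product_def sqrad_def by (simp flip: C_eq add: power2_eq_1_iff) (smt (verit) norm_ge_zero)

lemma part_add: "part B z + part C z = z"
  using part_complement[OF sub(1), of z] by (simp flip: C_eq)

lemma part_orthogonal: "part B z \<bullet> part C w = 0"
  unfolding part_inner[OF sub(1)] using sub disjoint
  by (intro sum.neutral) (auto simp: part_inner_Basis subset_iff)

lemma part_part:
  "part B (part B w) = part B w" "part B (part C w) = 0"
  "part C (part C w) = part C w" "part C (part B w) = 0"
  using sub disjoint by - (rule euclidean_eqI, force simp: part_inner_Basis)+

text \<open>One inclusion differentiates the constants \<open>u\<close> and \<open>v\<close> along a curve. For the other one the curve
\<open>z + t w\<close> is projected back to the product of spheres, block by block; as \<open>w\<close> is orthogonal to both
radial directions, the normalizing factors are stationary at \<open>t = 0\<close>.\<close>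

lemma tangent_vectors_sphere_product:
  assumes z: "z \<in> sphere_product B"
  shows "tangent_vectors (sphere_product B) z = {w. part B z \<bullet> w = 0 \<and> part C z \<bullet> w = 0}"
proof (intro equalityI subsetI CollectI conjI)
  fix w assume "w \<in> tangent_vectors (sphere_product B) z"
  then obtain \<gamma> where \<gamma>: "\<gamma> 0 = z" "\<forall>\<^sub>F t in nhds 0. \<gamma> t \<in> sphere_product B"
    "(\<gamma> has_vector_derivative w) (at (0::real))"
    by (auto simp: tangent_vectors_def)
  have "part D z \<bullet> w = 0" if D: "D \<subseteq> Basis" "\<And>y. y \<in> sphere_product B \<Longrightarrow> sqrad D y = 1" for D
  proof -
    have "((\<lambda>t. sqrad D (\<gamma> t)) has_derivative (\<lambda>t. 2 * (part D z \<bullet> (t *\<^sub>R w)))) (at 0)"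
      using has_derivative_compose[OF \<gamma>(3)[unfolded has_vector_derivative_def], of "sqrad D" "\<lambda>h. 2 * (part D z \<bullet> h)"]
        sqrad_has_derivative[OF D(1), of z] \<gamma>(1) by simp
    moreover have "((\<lambda>t. sqrad D (\<gamma> t)) has_derivative (\<lambda>t. 0)) (at 0)"
    proof (rule has_derivative_transform_eventually[OF has_derivative_const[of "1::real"]])
      have "\<forall>\<^sub>F t in at 0. \<gamma> t \<in> sphere_product B"
        using \<gamma>(2) by (auto simp: eventually_at_filter elim: eventually_mono)
      then show "\<forall>\<^sub>F t in at 0. 1 = sqrad D (\<gamma> t)"
        by (rule eventually_mono) (use D(2) in simp)
      show "1 = sqrad D (\<gamma> 0)" using D(2)[OF z] \<gamma>(1) by simp
    qed simp
    ultimately have "(\<lambda>t. 2 * (part D z \<bullet> (t *\<^sub>R w))) = (\<lambda>t. 0)" by (rule has_derivative_unique)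
    from fun_cong[OF this, of 1] show ?thesis by simp
  qed
  from this[of B] this[of C] show "part B z \<bullet> w = 0" "part C z \<bullet> w = 0"
    using sub by (simp_all add: sphere_product_iff)
next
  fix w assume "w \<in> {w. part B z \<bullet> w = 0 \<and> part C z \<bullet> w = 0}"
  then have w: "part B z \<bullet> w = 0" "part C z \<bullet> w = 0" by auto
  have uv: "u z = 1" "v z = 1" using z by (simp_all add: sphere_product_iff)
  define \<gamma> where "\<gamma> t = (1 / sqrt (1 + t\<^sup>2 * u w)) *\<^sub>R (part B z + t *\<^sub>R part B w)
    + (1 / sqrt (1 + t\<^sup>2 * v w)) *\<^sub>R (part C z + t *\<^sub>R part C w)" for t
  have pB: "part B (\<gamma> t) = (1 / sqrt (1 + t\<^sup>2 * u w)) *\<^sub>R (part B z + t *\<^sub>R part B w)"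
    and pC: "part C (\<gamma> t) = (1 / sqrt (1 + t\<^sup>2 * v w)) *\<^sub>R (part C z + t *\<^sub>R part C w)" for t
    unfolding \<gamma>_def
    by (simp_all add: linear_add[OF linear_part] linear_cmul[OF linear_part] part_part)
  have nrm: "(part D z + t *\<^sub>R part D w) \<bullet> (part D z + t *\<^sub>R part D w) = 1 + t\<^sup>2 * sqrad D w"
    if "D \<subseteq> Basis" "sqrad D z = 1" "part D z \<bullet> w = 0" for D t
  proof -
    have "(part D z + t *\<^sub>R part D w) \<bullet> (part D z + t *\<^sub>R part D w) =
        part D z \<bullet> part D z + 2 * t * (part D z \<bullet> part D w) + t\<^sup>2 * (part D w \<bullet> part D w)"
      by (simp add: inner_add_left inner_add_right power2_eq_square inner_commute)
    moreover have "part D z \<bullet> part D z = 1" "part D w \<bullet> part D w = sqrad D w"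
      using that by (simp_all add: sqrad_def power2_norm_eq_inner)
    ultimately show ?thesis using part_inner_part[OF that(1), of z w] that(3) by simp
  qed
  have pos: "0 < 1 + t\<^sup>2 * sqrad D w" for t D
    by (simp add: add_pos_nonneg sqrad_nonneg)
  have unit: "sqrad D (\<gamma> t) = 1"
    if D: "D \<subseteq> Basis" "sqrad D z = 1" "part D z \<bullet> w = 0"
      and p: "part D (\<gamma> t) = (1 / sqrt (1 + t\<^sup>2 * sqrad D w)) *\<^sub>R (part D z + t *\<^sub>R part D w)" for D t
  proof -
    have "sqrad D (\<gamma> t) = (1 / sqrt (1 + t\<^sup>2 * sqrad D w)) * (1 / sqrt (1 + t\<^sup>2 * sqrad D w)) *
        ((part D z + t *\<^sub>R part D w) \<bullet> (part D z + t *\<^sub>R part D w))"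
      unfolding sqrad_def[of D "\<gamma> t"] power2_norm_eq_inner p inner_scaleR_left inner_scaleR_right
      by (simp only: mult.assoc)
    also have "\<dots> = 1"
      unfolding nrm[OF D] using pos[of t D] by simp
    finally show ?thesis .
  qed
  have "\<gamma> t \<in> sphere_product B" for t
    unfolding sphere_product_iff
    using unit[OF sub(1) uv(1) w(1) pB] unit[OF sub(2) uv(2) w(2) pC] by blast
  moreover have "\<gamma> 0 = z" by (simp add: \<gamma>_def part_add)
  moreover have "(\<gamma> has_vector_derivative w) (at 0)"
  proof -
    have d: "((\<lambda>t. 1 / sqrt (1 + t\<^sup>2 * c)) has_real_derivative 0) (at 0)" for c :: real
      by (auto intro!: derivative_eq_intros)
    have l: "((\<lambda>t. p + t *\<^sub>R q) has_vector_derivative q) (at 0)" for p q :: 'a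
      by (auto intro!: derivative_eq_intros)
    have k: "((\<lambda>t. (1 / sqrt (1 + t\<^sup>2 * c)) *\<^sub>R (p + t *\<^sub>R q)) has_vector_derivative q) (at 0)" for c and p q :: 'a
      using has_vector_derivative_scaleR[OF d[of c] l[of p q]] by simp
    have "(\<gamma> has_vector_derivative part B w + part C w) (at 0)"
      unfolding \<gamma>_def[abs_def] by (rule has_vector_derivative_add[OF k k])
    then show ?thesis by (simp add: part_add)
  qed
  ultimately show "w \<in> tangent_vectors (sphere_product B) z"
    unfolding tangent_vectors_def by (intro CollectI exI[of _ \<gamma>] conjI always_eventually allI)
qed

definition \<kappa> :: "'a \<Rightarrow> real" where
  "\<kappa> c = (if c \<in> B then real a else real b)"

lemma \<kappa>_block: "c \<in> B \<Longrightarrow> \<kappa> c = real a" "c \<in> C \<Longrightarrow> \<kappa> c = real b"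
  using disjoint by (auto simp: \<kappa>_def)

text \<open>The coordinates of \<open>\<nabla>P - a P x - b P y\<close>: the radial parts of the gradient, known from Euler's
relation on the product of spheres, are removed. The components are polynomials on the whole space, which
provides the derivative required for the divergence.\<close>

definition tangential_component :: "'a \<Rightarrow> 'a \<Rightarrow> real" where
  "tangential_component c z = partial_deriv c P z - \<kappa> c * (P z * (z \<bullet> c))"

definition tangential_gradient :: "'a \<Rightarrow> 'a" where
  "tangential_gradient z = (\<Sum>c\<in>Basis. tangential_component c z *\<^sub>R c)"

lemma poly_coordinate: "polyfun (\<lambda>z. z \<bullet> c)"
  by (intro real_polynomial_function.intros(1) bounded_linear_inner_left)

lemma poly_tangential_component: "polyfun (tangential_component c)"
  unfolding tangential_component_def[abs_def] by (intro polynomial_intros poly poly_coordinate)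

lemma tangential_gradient_inner: "tangential_gradient z \<bullet> h = (\<Sum>c\<in>Basis. tangential_component c z * (h \<bullet> c))"
  unfolding tangential_gradient_def inner_sum_left by (simp add: inner_commute)

lemma part_inner_tangential_gradient:
  "part B z \<bullet> tangential_gradient z = real a * P z * (1 - u z)"
  "part C z \<bullet> tangential_gradient z = real b * P z * (1 - v z)"
proof -
  have sum: "part D z \<bullet> tangential_gradient z = (euler_op D P z) - k * P z * sqrad D z"
    if D: "D \<subseteq> Basis" "\<And>c. c \<in> D \<Longrightarrow> \<kappa> c = k" for D k
  proof -
    have "part D z \<bullet> tangential_gradient z = (\<Sum>c\<in>D. (z \<bullet> c) * tangential_component c z)"
      unfolding part_inner[OF D(1)] tangential_gradient_inner
      using D(1) by (intro sum.cong refl) (auto simp: inner_Basis if_distrib cong: if_cong)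
    also have "\<dots> = (\<Sum>c\<in>D. (z \<bullet> c) * partial_deriv c P z - k * P z * (z \<bullet> c)\<^sup>2)"
      using D(2) by (intro sum.cong) (simp_all add: tangential_component_def algebra_simps power2_eq_square)
    finally show ?thesis
      unfolding sqrad_eq_sum[OF D(1)] by (simp add: sum_subtractf sum_distrib_left)
  qed
  have "part B z \<bullet> tangential_gradient z = (euler_op B P z) - real a * P z * u z"
    "part C z \<bullet> tangential_gradient z = (euler_op C P z) - real b * P z * v z"
    using sum[OF sub(1) \<kappa>_block(1)] sum[OF sub(2) \<kappa>_block(2)] by simp_all
  then show "part B z \<bullet> tangential_gradient z = real a * P z * (1 - u z)"
    "part C z \<bullet> tangential_gradient z = real b * P z * (1 - v z)"
    unfolding euler_homogeneous[OF poly hom_B sub(1)] euler_homogeneous[OF poly hom_C sub(2)]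
    by (simp_all add: algebra_simps)
qed

text \<open>Subtracting multiples of \<open>u\<close> and \<open>v\<close> changes \<open>P\<close> on the product of spheres only by a constant. The
multiples are chosen such that the gradient of the difference at \<open>z\<close> is the tangential one.\<close>

lemma riemannian_gradient_tangential_gradient:
  "riemannian_gradient (sphere_product B) P tangential_gradient"
  unfolding riemannian_gradient_def
proof (intro ballI conjI)
  fix z assume z: "z \<in> sphere_product B"
  then have uv: "u z = 1" "v z = 1" by (simp_all add: sphere_product_iff)
  then show "tangential_gradient z \<in> tangent_vectors (sphere_product B) z"
    by (simp add: tangent_vectors_sphere_product[OF z] part_inner_tangential_gradient)
  let ?r = "real a * P z / 2" and ?s = "real b * P z / 2"
  have "((\<lambda>w. P w - ?r * u w - ?s * v w + (?r + ?s)) has_derivative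
      (\<lambda>h. (\<Sum>c\<in>Basis. (h \<bullet> c) * partial_deriv c P z) - ?r * (2 * (part B z \<bullet> h)) - ?s * (2 * (part C z \<bullet> h)) + 0)) (at z)"
    by (intro has_derivative_add has_derivative_diff has_derivative_mult_right has_derivative_const
        polyfun_has_derivative[OF poly] sqrad_has_derivative sub)
  moreover have "(\<Sum>c\<in>Basis. (h \<bullet> c) * partial_deriv c P z) - ?r * (2 * (part B z \<bullet> h)) - ?s * (2 * (part C z \<bullet> h)) + 0
      = tangential_gradient z \<bullet> h" for h
  proof -
    have "(\<Sum>c\<in>Basis. \<kappa> c * (P z * (z \<bullet> c)) * (h \<bullet> c)) =
        (\<Sum>c\<in>B. real a * P z * ((z \<bullet> c) * (h \<bullet> c))) + (\<Sum>c\<in>C. real b * P z * ((z \<bullet> c) * (h \<bullet> c)))"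
      unfolding sum_Basis using disjoint
      by (intro arg_cong2[of _ _ _ _ "(+)"] sum.cong) (auto simp: \<kappa>_def)
    then have "(\<Sum>c\<in>Basis. \<kappa> c * (P z * (z \<bullet> c)) * (h \<bullet> c)) =
        real a * P z * (part B z \<bullet> h) + real b * P z * (part C z \<bullet> h)"
      by (simp add: part_inner[OF sub(1)] part_inner[OF sub(2)] sum_distrib_left)
    moreover have "tangential_gradient z \<bullet> h = (\<Sum>c\<in>Basis. (h \<bullet> c) * partial_deriv c P z) -
        (\<Sum>c\<in>Basis. \<kappa> c * (P z * (z \<bullet> c)) * (h \<bullet> c))"
      unfolding tangential_gradient_inner tangential_component_def sum_subtractf[symmetric]
      by (intro sum.cong refl) (simp add: algebra_simps)
    ultimately show ?thesis by simp
  qed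
  ultimately have "((\<lambda>w. P w - ?r * u w - ?s * v w + (?r + ?s)) has_derivative
      (\<lambda>h. tangential_gradient z \<bullet> h)) (at z within sphere_product B)"
    using has_derivative_at_withinI by (simp add: has_derivative_at_withinI)
  then show "(P has_derivative (\<lambda>h. tangential_gradient z \<bullet> h)) (at z within sphere_product B)"
    by (rule has_derivative_transform[OF z, rotated]) (simp add: sphere_product_iff)
qed

lemma partial_deriv_tangential_component:
  "partial_deriv d (tangential_component c) z =
    partial_deriv d (partial_deriv c P) z - \<kappa> c * (partial_deriv d P z * (z \<bullet> c) + P z * (d \<bullet> c))"
proof -
  have "partial_deriv d (\<lambda>z. z \<bullet> c) = (\<lambda>z. d \<bullet> c)"
    by (intro partial_deriv_linear bounded_linear_inner_left)
  then show ?thesis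
    unfolding tangential_component_def[abs_def]
    by (simp add: partial_deriv_diff partial_deriv_cmult partial_deriv_mult polynomial_intros
        poly poly_coordinate algebra_simps)
qed

text \<open>Along the radial direction of a block \<open>\<partial>\<^sub>cP\<close> is homogeneous of degree \<open>d - 1\<close> and \<open>P x\<^sub>c\<close> of degree \<open>d + 1\<close>, so
the contribution to the trace is \<open>d (d - 1) P - d (d + 1) P\<close>.\<close>

lemma normal_derivative:
  assumes D: "D \<subseteq> Basis" "homogeneous_in D d P" "\<And>c. c \<in> D \<Longrightarrow> \<kappa> c = real d" "0 < d" "sqrad D z = 1"
  shows "(\<Sum>c\<in>D. \<Sum>e\<in>D. (z \<bullet> c) * ((z \<bullet> e) * partial_deriv e (tangential_component c) z)) = - 2 * real d * P z"
proof -
  have fin: "finite D" using D(1) finite_Basis finite_subset by blast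
  have "(euler_op D (tangential_component c) z) =
      (real d - 1) * partial_deriv c P z - real d * (real d + 1) * (P z * (z \<bullet> c))" if c: "c \<in> D" for c
  proof -
    have e1: "(euler_op D (partial_deriv c P) z) = (real d - 1) * partial_deriv c P z"
      using euler_homogeneous[OF polyfun_partial_deriv[OF poly]
          homogeneous_in_partial_deriv[OF poly D(2,1) c] D(1), of z] D(4) by (simp add: of_nat_diff)
    have e2: "(euler_op D P z) = real d * P z"
      by (rule euler_homogeneous[OF poly D(2,1)])
    have e3: "(\<Sum>e\<in>D. (z \<bullet> e) * (e \<bullet> c)) = z \<bullet> c"
    proof -
      have "(\<Sum>e\<in>D. (z \<bullet> e) * (e \<bullet> c)) = (\<Sum>e\<in>D. if e = c then z \<bullet> c else 0)"
        using D(1) c by (intro sum.cong) (auto simp: inner_Basis subset_iff)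
      then show ?thesis using c fin by simp
    qed
    have "(euler_op D (tangential_component c) z) =
        (euler_op D (partial_deriv c P) z) -
        real d * ((z \<bullet> c) * (euler_op D P z) + P z * (\<Sum>e\<in>D. (z \<bullet> e) * (e \<bullet> c)))"
      unfolding partial_deriv_tangential_component D(3)[OF c] sum_distrib_left sum.distrib[symmetric] sum_subtractf[symmetric]
      by (intro sum.cong refl) (simp add: algebra_simps)
    then show ?thesis unfolding e1 e2 e3 by (simp add: algebra_simps)
  qed
  then have "(\<Sum>c\<in>D. \<Sum>e\<in>D. (z \<bullet> c) * ((z \<bullet> e) * partial_deriv e (tangential_component c) z)) =
      (\<Sum>c\<in>D. (z \<bullet> c) * ((real d - 1) * partial_deriv c P z - real d * (real d + 1) * (P z * (z \<bullet> c))))"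
    by (intro sum.cong refl) (simp flip: sum_distrib_left)
  also have "\<dots> = (\<Sum>c\<in>D. (real d - 1) * ((z \<bullet> c) * partial_deriv c P z) - real d * (real d + 1) * P z * (z \<bullet> c)\<^sup>2)"
    by (intro sum.cong refl) (simp add: algebra_simps power2_eq_square)
  also have "\<dots> = (real d - 1) * (real d * P z) - real d * (real d + 1) * P z * sqrad D z"
    unfolding sum_subtractf sum_distrib_left[symmetric] euler_homogeneous[OF poly D(2,1)] sqrad_eq_sum[OF D(1)] ..
  finally show ?thesis using D(5) by (simp add: algebra_simps)
qed

text \<open>The tangential trace is the full trace minus the contributions of the two unit normals \<open>x\<close> and \<open>y\<close>. In
the full trace harmonicity leaves only the terms from the radial correction.\<close>

lemma riemannian_divergence_tangential_gradient:
  "riemannian_divergence (sphere_product B) tangential_gradient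
    (\<lambda>z. - (real a * (real a + real (card B) - 2) + real b * (real b + real (card C) - 2)) * P z)"
  unfolding riemannian_divergence_def
proof
  fix z assume z: "z \<in> sphere_product B"
  then have uv: "u z = 1" "v z = 1" by (simp_all add: sphere_product_iff)
  define x y where "x = part B z" and "y = part C z"
  define A where "A h = (\<Sum>c\<in>Basis. (\<Sum>e\<in>Basis. (h \<bullet> e) * partial_deriv e (tangential_component c) z) *\<^sub>R c)" for h
  have "(tangential_gradient has_derivative A) (at z)"
    unfolding tangential_gradient_def[abs_def] A_def[abs_def]
    by (intro has_derivative_sum has_derivative_scaleR_left
        polyfun_has_derivative poly_tangential_component)
  then have dA: "(tangential_gradient has_derivative A) (at z within sphere_product B)"
    by (rule has_derivative_at_withinI)
  have linA: "linear A" by (rule has_derivative_linear[OF dA])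
  have A_inner: "A h \<bullet> k = (\<Sum>c\<in>Basis. \<Sum>e\<in>Basis. (k \<bullet> c) * ((h \<bullet> e) * partial_deriv e (tangential_component c) z))" for h k
    unfolding A_def inner_sum_left by (simp add: sum_distrib_right sum_distrib_left mult_ac inner_commute)
  define T where "T = {w. x \<bullet> w = 0 \<and> y \<bullet> w = 0}"
  have "subspace T" unfolding T_def subspace_def by (simp add: inner_add_right)
  then obtain E where E: "E \<subseteq> T" "pairwise orthogonal E" "\<And>e. e \<in> E \<Longrightarrow> norm e = 1" "independent E"
      "card E = dim T" "span E = T"
    by (rule orthonormal_basis_subspace) (rule that; blast)
  have finE: "finite E" using E(4) independent_imp_finite by blast
  have xx: "x \<bullet> x = 1" "y \<bullet> y = 1" "x \<bullet> y = 0" "y \<bullet> x = 0"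
    using uv part_orthogonal[of z z] by (simp_all add: x_def y_def sqrad_def power2_norm_eq_inner inner_commute)
  then have nxy: "norm x = 1" "norm y = 1" "x \<noteq> y" "x \<notin> E" "y \<notin> E"
    using E(1) by (auto simp: norm_eq_sqrt_inner T_def)
  let ?E = "insert x (insert y E)"
  have orth: "pairwise orthogonal ?E"
    using E(1,2) xx by (auto simp: pairwise_insert orthogonal_def T_def inner_commute)
  have "w \<in> span ?E" for w
  proof -
    have "w - (x \<bullet> w) *\<^sub>R x - (y \<bullet> w) *\<^sub>R y \<in> T"
      using xx by (simp add: T_def inner_diff_right)
    then have "w - (x \<bullet> w) *\<^sub>R x - (y \<bullet> w) *\<^sub>R y \<in> span ?E"
      using E(6) span_mono[of E ?E] by blast
    moreover have "(x \<bullet> w) *\<^sub>R x + (y \<bullet> w) *\<^sub>R y \<in> span ?E"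
      by (intro span_add span_scale span_base) auto
    ultimately have "(w - (x \<bullet> w) *\<^sub>R x - (y \<bullet> w) *\<^sub>R y) + ((x \<bullet> w) *\<^sub>R x + (y \<bullet> w) *\<^sub>R y) \<in> span ?E"
      by (rule span_add)
    then show ?thesis by simp
  qed
  then have "(\<Sum>e\<in>?E. A e \<bullet> e) = (\<Sum>c\<in>Basis. A c \<bullet> c)"
    using orth nxy E(3) finE by (intro trace_orthonormal linA) auto
  then have tr: "(\<Sum>e\<in>E. A e \<bullet> e) = (\<Sum>c\<in>Basis. A c \<bullet> c) - A x \<bullet> x - A y \<bullet> y"
    using nxy finE by simp
  have full: "(\<Sum>c\<in>Basis. A c \<bullet> c) = - (real a * (real a + real (card B)) + real b * (real b + real (card C))) * P z"
  proof -
    have diag: "A c \<bullet> c = partial_deriv c (tangential_component c) z" if "c \<in> Basis" for c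
    proof -
      have "A c \<bullet> c = (\<Sum>d\<in>Basis. if d = c then \<Sum>e\<in>Basis. (c \<bullet> e) * partial_deriv e (tangential_component c) z else 0)"
        unfolding A_inner using that by (intro sum.cong refl) (auto simp: inner_Basis)
      also have "\<dots> = (\<Sum>e\<in>Basis. (c \<bullet> e) * partial_deriv e (tangential_component c) z)"
        using that by simp
      also have "\<dots> = (\<Sum>e\<in>Basis. if e = c then partial_deriv c (tangential_component c) z else 0)"
        using that by (intro sum.cong refl) (auto simp: inner_Basis)
      finally show ?thesis using that by simp
    qed
    have block: "(\<Sum>c\<in>D. A c \<bullet> c) = laplacian D P z - k * (euler_op D P z) - k * real (card D) * P z"
      if "D \<subseteq> Basis" "\<And>c. c \<in> D \<Longrightarrow> \<kappa> c = k" for D k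
    proof -
      have "(\<Sum>c\<in>D. A c \<bullet> c) = (\<Sum>c\<in>D. partial_deriv c (partial_deriv c P) z - k * ((z \<bullet> c) * partial_deriv c P z) - k * P z)"
        using that by (intro sum.cong) (auto simp: diag partial_deriv_tangential_component inner_Basis subset_iff algebra_simps)
      then show ?thesis by (simp add: sum_subtractf sum_distrib_left laplacian_def)
    qed
    have "(\<Sum>c\<in>B. A c \<bullet> c) = laplacian B P z - real a * (euler_op B P z) - real a * real (card B) * P z"
      "(\<Sum>c\<in>C. A c \<bullet> c) = laplacian C P z - real b * (euler_op C P z) - real b * real (card C) * P z"
      using block[OF sub(1) \<kappa>_block(1)] block[OF sub(2) \<kappa>_block(2)] by simp_all
    then show ?thesis
      unfolding sum_Basis harm_B harm_C euler_homogeneous[OF poly hom_B sub(1)] euler_homogeneous[OF poly hom_C sub(2)]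
      by (simp add: algebra_simps)
  qed
  have normal: "A (part D z) \<bullet> part D z = - 2 * real d * P z"
    if D: "D \<subseteq> Basis" "homogeneous_in D d P" "\<And>c. c \<in> D \<Longrightarrow> \<kappa> c = real d" "0 < d" "sqrad D z = 1" for D d
  proof -
    have r: "(\<Sum>c\<in>Basis. (part D z \<bullet> c) * h c) = (\<Sum>c\<in>D. (z \<bullet> c) * h c)" for h :: "'a \<Rightarrow> real"
    proof -
      have "(\<Sum>c\<in>Basis. (part D z \<bullet> c) * h c) = (\<Sum>c\<in>Basis. if c \<in> D then (z \<bullet> c) * h c else 0)"
        using D(1) by (intro sum.cong) (auto simp: part_inner_Basis)
      then show ?thesis using D(1) by (simp add: sum.inter_restrict[symmetric] Int_absorb1)
    qed
    show ?thesis
      unfolding A_inner sum_distrib_left[symmetric] r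
      using normal_derivative[OF D] by (simp add: sum_distrib_left)
  qed
  have "A x \<bullet> x = - 2 * real a * P z" "A y \<bullet> y = - 2 * real b * P z"
    unfolding x_def y_def
    using normal[OF sub(1) hom_B \<kappa>_block(1) a_pos uv(1)] normal[OF sub(2) hom_C \<kappa>_block(2) b_pos uv(2)] by simp_all
  then have "- (real a * (real a + real (card B) - 2) + real b * (real b + real (card C) - 2)) * P z = (\<Sum>e\<in>E. A e \<bullet> e)"
    unfolding tr full by (simp add: algebra_simps)
  moreover have "span E = tangent_vectors (sphere_product B) z"
    unfolding tangent_vectors_sphere_product[OF z] E(6) T_def x_def y_def ..
  ultimately show "\<exists>G' E. (tangential_gradient has_derivative G') (at z within sphere_product B) \<and>
      pairwise orthogonal E \<and> (\<forall>e\<in>E. norm e = 1) \<and> span E = tangent_vectors (sphere_product B) z \<and>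
      - (real a * (real a + real (card B) - 2) + real b * (real b + real (card C) - 2)) * P z = (\<Sum>e\<in>E. G' e \<bullet> e)"
    using dA E(2,3) by blast
qed

lemma dimensions_of_closed:
  assumes "laplacian_algebra (alg)"
  shows "(real (card B) - 2) / real a = (real (card C) - 2) / real b"
proof -
  obtain K L where "K > 0" "even a \<and> even b \<or> L = 0" and laws: "\<And>z. grad_sq B z = rhs_B K L z"
    "\<And>z. grad_sq C z = rhs_C K L z"
    using gradient_identities_of_closed[OF assms] by blast
  then show ?thesis using dimensions_proportional[OF _ _ laws] by simp
qed

theorem isoparametric_on_sphere_product:
  assumes "laplacian_algebra (alg)"
  shows "isoparametric_on (sphere_product B) P"
proof -
  obtain K L where laws: "\<And>z. grad_sq B z = rhs_B K L z"
    "\<And>z. grad_sq C z = rhs_C K L z"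
    using gradient_identities_of_closed[OF assms] by blast
  have "(norm (tangential_gradient z))\<^sup>2 = ((real a)\<^sup>2 + (real b)\<^sup>2) * (K + L * P z - (P z)\<^sup>2)"
    if "z \<in> sphere_product B" for z
  proof -
    have uv: "u z = 1" "v z = 1" using that by (simp_all add: sphere_product_iff)
    have norm: "(norm (tangential_gradient z))\<^sup>2 = (\<Sum>c\<in>Basis. (tangential_component c z)\<^sup>2)"
      unfolding power2_norm_eq_inner tangential_gradient_inner[of z "tangential_gradient z"]
      by (intro sum.cong refl) (simp add: tangential_gradient_def power2_eq_square)
    have split: "(\<Sum>c\<in>D. (tangential_component c z)\<^sup>2) = grad_sq D z - k\<^sup>2 * (P z)\<^sup>2"
      if D: "D \<subseteq> Basis" "\<And>c. c \<in> D \<Longrightarrow> \<kappa> c = k" "sqrad D z = 1"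
        "(euler_op D P z) = k * P z" for D k
    proof -
      have "(\<Sum>c\<in>D. (tangential_component c z)\<^sup>2) =
          (\<Sum>c\<in>D. (partial_deriv c P z)\<^sup>2 - 2 * k * P z * ((z \<bullet> c) * partial_deriv c P z) + k\<^sup>2 * (P z)\<^sup>2 * (z \<bullet> c)\<^sup>2)"
        using D(2) by (intro sum.cong) (simp_all add: tangential_component_def power2_eq_square algebra_simps)
      also have "\<dots> = grad_sq D z - 2 * k * P z * (k * P z) + k\<^sup>2 * (P z)\<^sup>2 * sqrad D z"
        by (simp only: sum.distrib sum_subtractf sum_distrib_left[symmetric] D(4) sqrad_eq_sum[OF D(1)] grad_sq_def)
      finally show ?thesis using D(3) by (simp add: power2_eq_square)
    qed
    have "(\<Sum>c\<in>B. (tangential_component c z)\<^sup>2) = grad_sq B z - (real a)\<^sup>2 * (P z)\<^sup>2"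
      using split[OF sub(1) \<kappa>_block(1) uv(1) euler_homogeneous[OF poly hom_B sub(1)]] by simp
    moreover have "(\<Sum>c\<in>C. (tangential_component c z)\<^sup>2) = grad_sq C z - (real b)\<^sup>2 * (P z)\<^sup>2"
      using split[OF sub(2) \<kappa>_block(2) uv(2) euler_homogeneous[OF poly hom_C sub(2)]] by simp
    ultimately have "(\<Sum>c\<in>Basis. (tangential_component c z)\<^sup>2) =
        grad_sq B z - (real a)\<^sup>2 * (P z)\<^sup>2 + (grad_sq C z - (real b)\<^sup>2 * (P z)\<^sup>2)"
      unfolding sum_Basis by simp
    then show ?thesis unfolding norm laws uv by (simp add: algebra_simps)
  qed
  then show ?thesis
    unfolding isoparametric_on_def
    using riemannian_gradient_tangential_gradient riemannian_divergence_tangential_gradient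
    by (intro exI[of _ tangential_gradient]
        exI[of _ "\<lambda>z. - (real a * (real a + real (card B) - 2) + real b * (real b + real (card C) - 2)) * P z"]
        exI[of _ "\<lambda>t. ((real a)\<^sup>2 + (real b)\<^sup>2) * (K + L * t - t\<^sup>2)"]
        exI[of _ "\<lambda>t. - (real a * (real a + real (card B) - 2) + real b * (real b + real (card C) - 2)) * t"])
      simp
qed

end

section \<open>Splitting off a separately harmonic generator\<close>

lemma laplacian_commute:
  fixes f :: "'a::euclidean_space \<Rightarrow> real"
  assumes "polyfun f" "B \<subseteq> Basis" "C \<subseteq> Basis"
  shows "laplacian B (laplacian C f) = laplacian C (laplacian B f)"
proof -
  have fin: "finite C" using assms(3) finite_Basis finite_subset by blast
  have "laplacian B (laplacian C f) = (\<lambda>z. \<Sum>c\<in>C. laplacian B (partial_deriv c (partial_deriv c f)) z)"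
    unfolding laplacian_def[of C] using assms(1) fin
    by (intro laplacian_sum) (auto intro!: polynomial_intros)
  also have "\<dots> = (\<lambda>z. \<Sum>c\<in>C. partial_deriv c (partial_deriv c (laplacian B f)) z)"
    using laplacian_partial_deriv[OF _ assms(2)] assms(1)
    by (simp add: polyfun_partial_deriv)
  finally show ?thesis unfolding laplacian_def[of C] .
qed

text \<open>The derivatives of such a function do not depend on the coordinates in \<open>B\<close>.\<close>

lemma laplacian_low_degree:
  fixes f :: "'a::euclidean_space \<Rightarrow> real"
  assumes "polyfun f" "B \<subseteq> Basis" "homogeneous_in B d f" "d < 2"
  shows "laplacian B f = (\<lambda>z. 0)"
proof -
  have "partial_deriv b (partial_deriv b f) z = 0" if b: "b \<in> B" for b z
  proof -
    let ?g = "partial_deriv b f"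
    have g: "polyfun ?g" by (rule polyfun_partial_deriv[OF assms(1)])
    have "homogeneous_in B 0 ?g"
      using homogeneous_in_partial_deriv[OF assms(1,3,2) b] assms(4) by (cases d) auto
    then have "(\<lambda>z. ?g (dilate B 0 z)) = ?g" by (simp add: homogeneous_in_def)
    then show ?thesis using partial_deriv_dilate[OF g assms(2), of b 0 z] b assms(2) by auto
  qed
  then show ?thesis by (simp add: laplacian_def fun_eq_iff)
qed

lemma laplacian_two_powers:
  assumes "B \<inter> C = {}" "B \<union> C = (Basis :: 'a::euclidean_space set)"
  shows "laplacian B (\<lambda>z::'a. sqrad B z ^ k * sqrad C z ^ l) =
    (\<lambda>z. 2 * real k * (2 * real k + real (card B) - 2) * (sqrad B z ^ (k - 1) * sqrad C z ^ l))"
proof -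
  have sub: "B \<subseteq> Basis" "C = Basis - B" using assms by auto
  have poly: "polyfun (\<lambda>z. sqrad C z ^ l)"
    unfolding sub by (intro polynomial_intros polyfun_sqrad) auto
  have hom: "homogeneous_in B 0 (\<lambda>z. sqrad C z ^ l)"
    using homogeneous_in_power[OF homogeneous_in_sqrad_complement[OF sub(1)], of l] sub(2) by simp
  have "laplacian B (\<lambda>z. sqrad C z ^ l) = (\<lambda>z. 0)"
    using laplacian_sqrad_complement_power_mult[OF sub(1) polyfun_const[of 1], of l]
    unfolding sub(2) by simp
  then show ?thesis using laplacian_sqrad_power_mult[OF sub(1) poly hom, of k] by simp
qed

text \<open>The multiple \<open>t\<close> of \<open>W = u\<^bsup>a/2\<^esup> v\<^bsup>b/2\<^esup>\<close> is chosen to kill \<open>\<Delta>\<^sub>x\<close>, which is possible as \<open>\<Delta>\<^sub>x W\<close> has the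
factor \<open>a (a + p - 2) > 0\<close>. What is left of \<open>\<Delta>\<^sub>y\<close> is a multiple of a radial monomial that contains \<open>u\<close>; \<open>\<Delta>\<^sub>x\<close>
annihilates it because the Laplacians commute, and so the multiple is zero.\<close>

lemma harmonic_correction:
  assumes blocks: "B \<inter> C = {}" "B \<union> C = (Basis :: 'a::euclidean_space set)" "B \<noteq> {}" "C \<noteq> {}"
    and ev: "even a" "even b" "2 \<le> a"
    and P: "polyfun (P :: 'a \<Rightarrow> real)"
    and LB: "\<And>z. laplacian B P z = c1 * (sqrad B z ^ (a div 2 - 1) * sqrad C z ^ (b div 2))"
    and LC: "\<And>z. laplacian C P z = c2 * (sqrad C z ^ (b div 2 - 1) * sqrad B z ^ (a div 2))"
  shows "\<exists>t. \<forall>z. laplacian B (\<lambda>z. P z - t * (sqrad B z ^ (a div 2) * sqrad C z ^ (b div 2))) z = 0 \<and>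
    laplacian C (\<lambda>z. P z - t * (sqrad B z ^ (a div 2) * sqrad C z ^ (b div 2))) z = 0"
proof -
  have sub: "B \<subseteq> Basis" "C \<subseteq> Basis" using blocks by auto
  have "finite B" using sub finite_Basis finite_subset by blast
  then have p: "real (card B) \<ge> 1" using blocks(3) card_gt_0_iff[of B] by (simp add: Suc_le_eq)
  have a2: "2 * real (a div 2) = real a" using ev by (simp add: real_of_nat_div)
  define W where "W z = sqrad B z ^ (a div 2) * sqrad C z ^ (b div 2)" for z
  have poly_W: "polyfun W"
    unfolding W_def[abs_def] by (intro polynomial_intros polyfun_sqrad sub)
  define \<kappa> where "\<kappa> = real a * (real a + real (card B) - 2)"
  have \<kappa>: "\<kappa> > 0" using p ev(3) by (simp add: \<kappa>_def)
  have blocks': "C \<inter> B = {}" "C \<union> B = Basis" using blocks by auto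
  have LBW: "laplacian B W = (\<lambda>z. \<kappa> * (sqrad B z ^ (a div 2 - 1) * sqrad C z ^ (b div 2)))"
    unfolding W_def[abs_def] laplacian_two_powers[OF blocks(1,2)] a2 \<kappa>_def ..
  define \<mu> where "\<mu> = 2 * real (b div 2) * (2 * real (b div 2) + real (card C) - 2)"
  have LCW: "laplacian C W = (\<lambda>z. \<mu> * (sqrad C z ^ (b div 2 - 1) * sqrad B z ^ (a div 2)))"
    using laplacian_two_powers[OF blocks', of "b div 2" "a div 2"]
    unfolding W_def[abs_def] \<mu>_def by (simp add: mult.commute)
  define t where "t = c1 / \<kappa>"
  define Q where "Q = (\<lambda>z. P z - t * W z)"
  have poly_Q: "polyfun Q" unfolding Q_def by (intro polynomial_intros P poly_W)
  have lap_Q: "laplacian D Q z = laplacian D P z - t * laplacian D W z" for D z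
    using P poly_W unfolding Q_def by (simp add: laplacian_diff laplacian_cmult polynomial_intros)
  have QB: "laplacian B Q = (\<lambda>z. 0)"
    unfolding fun_eq_iff lap_Q LB LBW using \<kappa> by (simp add: t_def)
  have QC: "laplacian C Q = (\<lambda>z. (c2 - t * \<mu>) * (sqrad B z ^ (a div 2) * sqrad C z ^ (b div 2 - 1)))"
    unfolding fun_eq_iff lap_Q LC LCW by (simp add: algebra_simps)
  have "laplacian B (laplacian C Q) = (\<lambda>z. 0)"
    unfolding laplacian_commute[OF poly_Q sub] QB by simp
  moreover have "polyfun (\<lambda>z. sqrad B z ^ (a div 2) * sqrad C z ^ (b div 2 - 1))"
    by (intro polynomial_intros polyfun_sqrad sub)
  then have "laplacian B (laplacian C Q) = (\<lambda>z. (c2 - t * \<mu>) *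
      laplacian B (\<lambda>z. sqrad B z ^ (a div 2) * sqrad C z ^ (b div 2 - 1)) z)"
    unfolding QC by (rule laplacian_cmult)
  then have "laplacian B (laplacian C Q) =
      (\<lambda>z. (c2 - t * \<mu>) * (\<kappa> * (sqrad B z ^ (a div 2 - 1) * sqrad C z ^ (b div 2 - 1))))"
    by (simp only: laplacian_two_powers[OF blocks(1,2)] a2 \<kappa>_def)
  moreover obtain z1 :: 'a where z1: "sqrad B z1 = 1" "sqrad C z1 = 1"
    using exists_unit_point[OF blocks] by blast
  ultimately have "(\<lambda>z. (c2 - t * \<mu>) * (\<kappa> * (sqrad B z ^ (a div 2 - 1) * sqrad C z ^ (b div 2 - 1)))) = (\<lambda>z. 0)"
    by argo
  from fun_cong[OF this, of z1] have "c2 - t * \<mu> = 0" using \<kappa> z1 by simp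
  then have "laplacian C Q = (\<lambda>z. 0)" unfolding QC by simp
  with QB have "\<forall>z. laplacian B Q z = 0 \<and> laplacian C Q z = 0" by simp
  then show ?thesis unfolding Q_def W_def by (rule exI)
qed

text \<open>The two partial Laplacians have different degrees in \<open>x\<close>, so \<open>\<Delta>\<^sub>xP\<close> is itself a polynomial in \<open>u\<close> and \<open>v\<close>,
and its bidegree leaves one monomial at most.\<close>

lemma laplacian_two_block_monomial:
  assumes blocks: "B \<inter> C = {}" "B \<union> C = (Basis :: 'a::euclidean_space set)"
    and P: "polyfun (P :: 'a \<Rightarrow> real)" "homogeneous_in B a P" "homogeneous_in C b P"
    and mem: "laplacian Basis P \<in> radial_algebra B C"
  shows "\<exists>c. (even a \<and> even b \<or> c = 0) \<and>
    (\<forall>z. laplacian B P z = c * (sqrad B z ^ (a div 2 - 1) * sqrad C z ^ (b div 2)))"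
proof (cases "a < 2")
  case True
  have "B \<subseteq> Basis" using blocks by auto
  from laplacian_low_degree[OF P(1) this P(2) True] show ?thesis by (intro exI[of _ 0]) simp
next
  case False
  have sub: "B \<subseteq> Basis" "C \<subseteq> Basis" and CB: "C = Basis - B" "B = Basis - C" using blocks by auto
  have uv: "homogeneous_in B 2 (sqrad B)" "homogeneous_in B 0 (sqrad C)"
    "homogeneous_in C 0 (sqrad B)" "homogeneous_in C 2 (sqrad C)"
    using homogeneous_in_sqrad[OF sub(1)] homogeneous_in_sqrad[OF sub(2)]
      homogeneous_in_sqrad_complement[OF sub(1)] homogeneous_in_sqrad_complement[OF sub(2)]
    by (simp_all flip: CB)
  have one: "homogeneous_in B 0 (\<lambda>z. 1)" "homogeneous_in C 0 (\<lambda>z. 1)" by (rule homogeneous_in_const)+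
  have "(\<lambda>z. laplacian B P z + laplacian C P z) = laplacian Basis P"
    using laplacian_split[OF sub(1), of P] by (simp add: fun_eq_iff flip: CB)
  then have "(\<lambda>z. laplacian B P z + laplacian C P z) \<in> monomial_span (sqrad B) (sqrad C) (\<lambda>z. 1) (\<lambda>k l m. m = 0)"
    using mem by (simp add: generated_algebra_two_eq_monomial_span[of _ _ "\<lambda>z. 1"])
  moreover have "a - 2 \<noteq> a" using False by simp
  moreover have "homogeneous_in B a (laplacian C P)"
    using homogeneous_in_laplacian_complement[OF P(1,2) sub(1)] by (simp flip: CB)
  ultimately have "laplacian B P \<in> monomial_span (sqrad B) (sqrad C) (\<lambda>z. 1)
      (\<lambda>k l m. m = 0 \<and> 2 * k + 0 * l + 0 * m = a - 2)"
    using homogeneous_in_laplacian[OF P(1,2) sub(1)]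
    by (intro monomial_span_two_components(1)[OF uv(1,2) one(1)]) auto
  moreover have "homogeneous_in C b (laplacian B P)"
    using homogeneous_in_laplacian_complement[OF P(1,3) sub(2)] by (simp flip: CB)
  ultimately have ms: "laplacian B P \<in> monomial_span (sqrad B) (sqrad C) (\<lambda>z. 1)
      (\<lambda>k l m. (m = 0 \<and> 2 * k + 0 * l + 0 * m = a - 2) \<and> 0 * k + 2 * l + 0 * m = b)"
    by (rule monomial_span_homogeneous[OF uv(3,4) one(2)])
  define m1 where "m1 z = (if even a \<and> even b then sqrad B z ^ (a div 2 - 1) * sqrad C z ^ (b div 2) else 0)" for z
  have "(\<lambda>z. sqrad B z ^ k * sqrad C z ^ l * 1 ^ m) = m1 \<or> (\<lambda>z. sqrad B z ^ k * sqrad C z ^ l * 1 ^ m) = m1"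
    if "(m = 0 \<and> 2 * k + 0 * l + 0 * m = a - 2) \<and> 0 * k + 2 * l + 0 * m = b" for k l m
  proof -
    have "2 * (k + 1) = a" "2 * l = b" using that False by auto
    then have "even a" "even b" "k = a div 2 - 1" "l = b div 2" by auto
    then show ?thesis by (simp add: m1_def fun_eq_iff)
  qed
  from monomial_span_eq_two_terms[OF ms this] obtain \<alpha> \<beta> where "\<forall>z. laplacian B P z = \<alpha> * m1 z + \<beta> * m1 z"
    by blast
  then show ?thesis
    by (intro exI[of _ "if even a \<and> even b then \<alpha> + \<beta> else 0"]) (auto simp: m1_def algebra_simps)
qed

lemma homogeneous_component_decomposition_total:
  fixes f :: "'a::euclidean_space \<Rightarrow> real"
  assumes poly: "polyfun f" and B: "B \<subseteq> Basis" and hom: "homogeneous_in Basis e f"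
  shows "\<exists>N g. (\<forall>i. polyfun (g i) \<and> homogeneous_in B i (g i)) \<and>
    (\<forall>i\<le>N. homogeneous_in Basis e (g i)) \<and> (\<forall>s z. f (dilate B s z) = (\<Sum>i\<le>N. g i z * s ^ i))"
proof -
  obtain N g where g: "\<forall>i. polyfun (g i) \<and> homogeneous_in B i (g i)"
    "\<forall>s z. f (dilate B s z) = (\<Sum>i\<le>N. g i z * s ^ i)"
    using homogeneous_component_decomposition[OF poly B] by (elim exE conjE) (rule that)
  have "g i (dilate Basis r z) = r ^ e * g i z" if "i \<le> N" for i r z
  proof -
    have "(\<Sum>i\<le>N. g i (dilate Basis r z) * s ^ i) = (\<Sum>i\<le>N. (r ^ e * g i z) * s ^ i)" for s
    proof -
      have "(\<Sum>i\<le>N. g i (dilate Basis r z) * s ^ i) = f (dilate Basis r (dilate B s z))"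
        by (subst dilate_commute[OF order.refl B]) (simp add: g(2))
      also have "\<dots> = r ^ e * f (dilate B s z)" using hom by (simp add: homogeneous_in_def)
      also have "\<dots> = (\<Sum>i\<le>N. (r ^ e * g i z) * s ^ i)"
        using g(2) by (simp add: sum_distrib_left mult.assoc)
      finally show ?thesis .
    qed
    then show ?thesis
      using that polyfun_eq_coeffs[of "\<lambda>i. g i (dilate Basis r z)" N "\<lambda>i. r ^ e * g i z"] by simp
  qed
  then have "\<forall>i\<le>N. homogeneous_in Basis e (g i)" by (simp add: homogeneous_in_def)
  with g show ?thesis by (intro exI conjI) assumption+
qed

text \<open>\<open>\<Delta>(u F) = u \<Delta>F + 2p F + 4 E F\<close> for the Euler operator \<open>E\<close> of the block.\<close>

lemma euler_in_algebra:
  fixes F :: "'a::euclidean_space \<Rightarrow> real"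
  assumes B: "B \<subseteq> Basis" and F: "polyfun F" "F \<in> generated_algebra G"
    and u: "sqrad B \<in> generated_algebra G"
    and closed: "\<And>f. f \<in> generated_algebra G \<Longrightarrow> laplacian Basis f \<in> generated_algebra G"
  shows "(\<lambda>z. euler_op B F z) \<in> generated_algebra G"
proof -
  let ?A = "generated_algebra G"
  let ?E = "\<lambda>z. euler_op B F z"
  have "laplacian Basis (\<lambda>z. sqrad B z * F z) =
      (\<lambda>z. sqrad B z * laplacian Basis F z + 2 * real (card B) * F z + 2 * (2 * ?E z))"
    using laplacian_mult[OF polyfun_sqrad[OF B] F(1), of Basis]
      laplacian_sqrad[OF B order.refl] grad_sqrad_inner[OF B order.refl] B
    by (simp add: Int_absorb2)
  then have E: "?E = (\<lambda>z. (1/4) * (laplacian Basis (\<lambda>z. sqrad B z * F z) z -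
      (sqrad B z * laplacian Basis F z + 2 * real (card B) * F z)))"
    by (simp add: fun_eq_iff)
  show ?thesis
    by (subst E) (intro generated_algebra_cmult generated_algebra_diff generated_algebra.add
        generated_algebra.mult closed F u)
qed

lemma homogeneous_in_euler:
  fixes F :: "'a::euclidean_space \<Rightarrow> real"
  assumes "B \<subseteq> Basis" "polyfun F" "homogeneous_in Basis e F" "0 < e"
  shows "homogeneous_in Basis e (\<lambda>z. euler_op B F z)"
proof (rule homogeneous_in_sum)
  fix b assume "b \<in> B"
  then have "homogeneous_in Basis (e - 1) (partial_deriv b F)"
    using assms by (intro homogeneous_in_partial_deriv) auto
  moreover have "homogeneous_in Basis 1 (\<lambda>z. z \<bullet> b)" by (simp add: homogeneous_in_def dilate_Basis)
  ultimately have "homogeneous_in Basis (1 + (e - 1)) (\<lambda>z. (z \<bullet> b) * partial_deriv b F z)"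
    by (intro homogeneous_in_mult)
  then show "homogeneous_in Basis e (\<lambda>z. (z \<bullet> b) * partial_deriv b F z)" using assms(4) by simp
qed

lemma top_degree_part:
  assumes g: "homogeneous_in Basis 2 g1" "homogeneous_in Basis 2 g2" "homogeneous_in Basis e g3" "0 < e"
    and f: "f \<in> generated_algebra {g1, g2, g3}" "homogeneous_in Basis e f"
  shows "\<exists>r h. h \<in> generated_algebra {g1, g2} \<and> (\<forall>z. f z = r * g3 z + h z)"
proof -
  have "f \<in> monomial_span g1 g2 g3 (\<lambda>k l m. True \<and> 2 * k + 2 * l + e * m = e)"
    using f by (intro monomial_span_homogeneous[OF g(1-3)]) (simp_all add: generated_algebra_eq_monomial_span)
  then show ?thesis
  proof induction
    case zero
    show ?case by (intro exI[of _ 0] exI[of _ "\<lambda>z. 0"]) (simp add: generated_algebra.const)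
  next
    case (step f k l m c)
    then obtain r h where rh: "h \<in> generated_algebra {g1, g2}" "\<And>z. f z = r * g3 z + h z" by blast
    have "m = 0 \<or> m = 1 \<and> k = 0 \<and> l = 0"
    proof -
      have "m < 2"
      proof (rule ccontr)
        assume "\<not> m < 2"
        then have "e * m \<ge> e * 2" by (intro mult_le_mono2) simp
        then show False using step.hyps(2) g(4) by linarith
      qed
      then have "m = 0 \<or> m = 1" by auto
      then show ?thesis using step.hyps(2) by auto
    qed
    then show ?case
    proof
      assume m: "m = 0"
      have "(\<lambda>z. c * (g1 z ^ k * g2 z ^ l * 1 ^ 0)) \<in> generated_algebra {g1, g2}"
        by (intro generated_algebra_monomial generated_algebra.gen generated_algebra.const) auto
      then have "(\<lambda>z. c * (g1 z ^ k * g2 z ^ l) + h z) \<in> generated_algebra {g1, g2}"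
        using generated_algebra.add rh(1) by simp
      then show ?thesis using m rh(2) by (intro exI[of _ r] exI[of _ "\<lambda>z. c * (g1 z ^ k * g2 z ^ l) + h z"]) simp
    next
      assume "m = 1 \<and> k = 0 \<and> l = 0"
      then show ?thesis using rh by (intro exI[of _ "c + r"] exI[of _ h]) (simp add: algebra_simps)
    qed
  qed
qed

lemma low_degree_part:
  assumes g: "homogeneous_in Basis 2 g1" "homogeneous_in Basis 2 g2" "homogeneous_in Basis e g3"
    and f: "f \<in> generated_algebra {g1, g2, g3}" "homogeneous_in Basis d f" and d: "d < e"
  shows "f \<in> generated_algebra {g1, g2}"
proof -
  have "f \<in> monomial_span g1 g2 g3 (\<lambda>k l m. True \<and> 2 * k + 2 * l + e * m = d)"
    using f by (intro monomial_span_homogeneous[OF g(1-3)]) (simp_all add: generated_algebra_eq_monomial_span)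
  then have "f \<in> monomial_span g1 g2 g3 (\<lambda>k l m. m = 0)"
  proof (rule monomial_span_mono)
    show "m = 0" if "True \<and> 2 * k + 2 * l + e * m = d" for k l m
      using that d by (cases m) auto
  qed
  then show ?thesis by (simp add: generated_algebra_two_eq_monomial_span[of g1 g2 g3])
qed

text \<open>The radial correction is a multiple of \<open>u\<^bsup>a/2\<^esup> v\<^bsup>b/2\<^esup>\<close>. As \<open>a + b > 2\<close>, one of the two even degrees is at
least \<open>2\<close>, and that block takes the first role in \<open>harmonic_correction\<close>.\<close>

lemma separately_harmonic_correction:
  assumes blocks: "B \<inter> C = {}" "B \<union> C = (Basis :: 'a::euclidean_space set)" "B \<noteq> {}" "C \<noteq> {}"
    and P: "polyfun (P :: 'a \<Rightarrow> real)" "homogeneous_in B a P" "homogeneous_in C b P"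
    and ab: "2 < a + b" and mem: "laplacian Basis P \<in> radial_algebra B C"
  shows "\<exists>W. W \<in> radial_algebra B C \<and> homogeneous_in B a W \<and> homogeneous_in C b W \<and>
    (\<forall>z. laplacian B (\<lambda>z. P z - W z) z = 0 \<and> laplacian C (\<lambda>z. P z - W z) z = 0)"
proof -
  have blocks': "C \<inter> B = {}" "C \<union> B = Basis" using blocks by auto
  have sub: "B \<subseteq> Basis" "C \<subseteq> Basis" and CB: "C = Basis - B" "B = Basis - C" using blocks by auto
  have mem': "laplacian Basis P \<in> generated_algebra {sqrad C, sqrad B}"
    using mem by (simp add: insert_commute)
  obtain c1 where c1: "even a \<and> even b \<or> c1 = 0"
    "\<And>z. laplacian B P z = c1 * (sqrad B z ^ (a div 2 - 1) * sqrad C z ^ (b div 2))"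
    using laplacian_two_block_monomial[OF blocks(1,2) P mem] by blast
  obtain c2 where c2: "even b \<and> even a \<or> c2 = 0"
    "\<And>z. laplacian C P z = c2 * (sqrad C z ^ (b div 2 - 1) * sqrad B z ^ (a div 2))"
    using laplacian_two_block_monomial[OF blocks' P(1,3,2) mem'] by blast
  show ?thesis
  proof (cases "even a \<and> even b")
    case False
    then have "laplacian B P z = 0" "laplacian C P z = 0" for z using c1 c2 by auto
    then show ?thesis
      by (intro exI[of _ "\<lambda>z. 0"]) (simp add: generated_algebra.const homogeneous_in_def)
  next
    case True
    let ?W = "\<lambda>t z. t * (sqrad B z ^ (a div 2) * sqrad C z ^ (b div 2))"
    have "\<exists>t. \<forall>z. laplacian B (\<lambda>z. P z - ?W t z) z = 0 \<and> laplacian C (\<lambda>z. P z - ?W t z) z = 0"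
    proof (cases "2 \<le> a")
      case a: True
      show ?thesis
        using harmonic_correction[OF blocks _ _ a P(1) c1(2) c2(2)] True by blast
    next
      case False
      then have "a = 0" using True by presburger
      then have "2 \<le> b" using ab by simp
      then obtain t where "\<forall>z. laplacian C (\<lambda>z. P z - t * (sqrad C z ^ (b div 2) * sqrad B z ^ (a div 2))) z = 0 \<and>
          laplacian B (\<lambda>z. P z - t * (sqrad C z ^ (b div 2) * sqrad B z ^ (a div 2))) z = 0"
        using harmonic_correction[OF blocks' blocks(4,3) _ _ _ P(1) c2(2) c1(2)] True by blast
      then show ?thesis by (intro exI[of _ t]) (simp add: mult.commute)
    qed
    then obtain t where t: "\<forall>z. laplacian B (\<lambda>z. P z - ?W t z) z = 0 \<and> laplacian C (\<lambda>z. P z - ?W t z) z = 0" ..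
    have "?W t \<in> radial_algebra B C"
      by (intro generated_algebra_cmult generated_algebra.mult generated_algebra_power generated_algebra.gen) auto
    moreover have "homogeneous_in B (2 * (a div 2) + 0 * (b div 2)) (?W t)"
      using homogeneous_in_sqrad_complement[OF sub(1)]
      by (intro homogeneous_in_cmult homogeneous_in_mult homogeneous_in_power homogeneous_in_sqrad sub)
        (simp flip: CB)
    moreover have "homogeneous_in C (0 * (a div 2) + 2 * (b div 2)) (?W t)"
      using homogeneous_in_sqrad_complement[OF sub(2)]
      by (intro homogeneous_in_cmult homogeneous_in_mult homogeneous_in_power homogeneous_in_sqrad sub)
        (simp flip: CB)
    ultimately show ?thesis using t True by (intro exI[of _ "?W t"]) simp
  qed
qed

text \<open>The Euler operator \<open>E\<close> of the first block acts on the part of degree \<open>e\<close>, and modulo radial polynomials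
this part is the line spanned by \<open>F\<close>. So \<open>E F = r F + h\<close> with \<open>h\<close> radial, and comparing components of degree
\<open>i\<close> gives \<open>(i - r) F\<^sub>i = h\<^sub>i\<close>. As \<open>F\<close> is not radial, \<open>r\<close> is one of the degrees that occur.\<close>

lemma separately_harmonic_generator:
  fixes F :: "'a::euclidean_space \<Rightarrow> real"
  assumes blocks: "B \<inter> C = {}" "B \<union> C = (Basis :: 'a set)" "B \<noteq> {}" "C \<noteq> {}"
    and F: "homogeneous_poly e F" "2 < e" "F \<notin> radial_algebra B C"
    and closed: "\<And>f. f \<in> generated_algebra {sqrad B, sqrad C, F} \<Longrightarrow>
      laplacian Basis f \<in> generated_algebra {sqrad B, sqrad C, F}"
  shows "\<exists>H\<in>radial_algebra B C. \<exists>P a b. P = (\<lambda>z. F z - H z) \<and> a + b = e \<and>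
    bihomogeneous_poly B a b P \<and> (\<forall>z. laplacian B P z = 0 \<and> laplacian C P z = 0)"
proof -
  let ?A = "generated_algebra {sqrad B, sqrad C, F}"
  let ?R = "radial_algebra B C"
  have sub: "B \<subseteq> Basis" "C \<subseteq> Basis" and CB: "C = Basis - B" "B = Basis - C" using blocks by auto
  have RA: "?R \<subseteq> ?A" by (rule generated_algebra_mono) auto
  have polyF: "polyfun F" and homF: "homogeneous_in Basis e F"
    using F(1) by (simp_all add: homogeneous_poly_iff)
  have uvB: "homogeneous_in B 2 (sqrad B)" "homogeneous_in B 0 (sqrad C)" "homogeneous_in B 0 (\<lambda>z. 1)"
    using homogeneous_in_sqrad[OF sub(1)] homogeneous_in_sqrad_complement[OF sub(1)] homogeneous_in_const
    by (auto simp flip: CB)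
  have uvC: "homogeneous_in C 0 (sqrad B)" "homogeneous_in C 2 (sqrad C)"
    using homogeneous_in_sqrad[OF sub(2)] homogeneous_in_sqrad_complement[OF sub(2)] by (auto simp flip: CB)
  have hu: "homogeneous_in Basis 2 (sqrad B)" and hv: "homogeneous_in Basis 2 (sqrad C)"
    using homogeneous_in_Basis[OF sub(1) uvB(1), of 0] homogeneous_in_Basis[OF sub(1) uvB(2), of 2] uvC
    by (simp_all add: numeral_2_eq_2 flip: CB)
  define E where "E z = (euler_op B F z)" for z
  have "E \<in> ?A" unfolding E_def[abs_def]
    by (rule euler_in_algebra[OF sub(1) polyF _ _ closed]) (auto intro: generated_algebra.gen)
  moreover have "homogeneous_in Basis e E" unfolding E_def[abs_def]
    using F(2) by (intro homogeneous_in_euler sub polyF homF) simp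
  ultimately obtain r h where h: "h \<in> ?R" "\<And>z. E z = r * F z + h z"
    using top_degree_part[OF hu hv homF, of E] F(2) by auto
  obtain N g where g: "\<And>i. polyfun (g i)" "\<And>i. homogeneous_in B i (g i)"
    "\<And>i. i \<le> N \<Longrightarrow> homogeneous_in Basis e (g i)" "\<And>s z. F (dilate B s z) = (\<Sum>i\<le>N. g i z * s ^ i)"
    using homogeneous_component_decomposition_total[OF polyF sub(1) homF] by blast
  have F_sum: "F = (\<lambda>z. \<Sum>i\<le>N. g i z)"
    using g(4)[of 1] sub by (simp add: dilate_one fun_eq_iff)
  have E_sum: "E z = (\<Sum>i\<le>N. real i * g i z)" for z
  proof -
    have "E z = (\<Sum>b\<in>B. \<Sum>i\<le>N. (z \<bullet> b) * partial_deriv b (g i) z)"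
      unfolding E_def F_sum using g(1) by (simp add: partial_deriv_sum sum_distrib_left)
    also have "\<dots> = (\<Sum>i\<le>N. euler_op B (g i) z)" by (rule sum.swap)
    also have "\<dots> = (\<Sum>i\<le>N. real i * g i z)"
      by (intro sum.cong refl euler_homogeneous g sub)
    finally show ?thesis .
  qed
  have h_sum: "h z = (\<Sum>i\<le>N. (real i - r) * g i z)" for z
    using h(2)[of z] E_sum[of z] F_sum by (simp add: left_diff_distrib sum_subtractf sum_distrib_left)
  have comp: "g i \<in> ?R" if i: "i \<le> N" "real i \<noteq> r" for i
  proof -
    have "h (dilate B s z) = (\<Sum>i\<le>N. ((real i - r) * g i z) * s ^ i)" for s z
      unfolding h_sum using g(2) by (intro sum.cong) (simp_all add: homogeneous_in_def)
    moreover have "h \<in> monomial_span (sqrad B) (sqrad C) (\<lambda>z. 1) (\<lambda>k l m. m = 0)"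
      using h(1) by (simp add: generated_algebra_two_eq_monomial_span[of _ _ "\<lambda>z. 1"])
    ultimately have "(\<lambda>z. (real i - r) * g i z) \<in> monomial_span (sqrad B) (sqrad C) (\<lambda>z. 1)
        (\<lambda>k l m. m = 0 \<and> 2 * k + 0 * l + 0 * m = i)"
      using monomial_span_component[OF uvB, where N = N and h = "\<lambda>i z. (real i - r) * g i z"] i(1) by blast
    then have "(\<lambda>z. (real i - r) * g i z) \<in> ?R"
      unfolding generated_algebra_two_eq_monomial_span[of _ _ "\<lambda>z. 1"]
      by (rule monomial_span_mono) auto
    from generated_algebra_cmult[OF this, of "1 / (real i - r)"] show ?thesis using i(2) by simp
  qed
  \<comment> \<open>Otherwise every component of \<open>F\<close> would be radial.\<close>
  have "\<exists>a\<le>N. real a = r"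
  proof (rule ccontr)
    assume "\<not> (\<exists>a\<le>N. real a = r)"
    then have "F \<in> ?R" unfolding F_sum by (intro generated_algebra_sum comp) auto
    with F(3) show False ..
  qed
  then obtain a where a: "a \<le> N" "real a = r" by blast
  define H0 where "H0 z = (\<Sum>i\<in>{..N} - {a}. g i z)" for z
  have H0: "H0 \<in> ?R"
    unfolding H0_def[abs_def] using a by (intro generated_algebra_sum comp) auto
  have ga: "g a = (\<lambda>z. F z - H0 z)"
    using a(1) by (simp add: F_sum H0_def fun_eq_iff sum.remove[of "{..N}" a])
  have "g a \<noteq> (\<lambda>z. 0)"
  proof
    assume "g a = (\<lambda>z. 0)"
    then have "F = H0" using ga by (simp add: fun_eq_iff)
    with H0 F(3) show False by simp
  qed
  then obtain z0 where "g a z0 \<noteq> 0" by blast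
  from homogeneous_in_complement[OF g(1) sub(1) g(2) g(3)[OF a(1)] this]
  have ae: "a \<le> e" and gaC: "homogeneous_in C (e - a) (g a)" by (simp_all flip: CB)
  have "g a \<in> ?A" unfolding ga
    by (rule generated_algebra_diff[OF generated_algebra.gen subsetD[OF RA H0]]) simp
  then have "laplacian Basis (g a) \<in> ?A" by (rule closed)
  moreover have "homogeneous_in Basis (e - 2) (laplacian Basis (g a))"
    by (intro homogeneous_in_laplacian g a) simp
  ultimately have "laplacian Basis (g a) \<in> ?R"
    using F(2) by (intro low_degree_part[OF hu hv homF, where d = "e - 2"]) auto
  then obtain W where W: "W \<in> ?R" "homogeneous_in B a W" "homogeneous_in C (e - a) W"
    "\<forall>z. laplacian B (\<lambda>z. g a z - W z) z = 0 \<and> laplacian C (\<lambda>z. g a z - W z) z = 0"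
    using separately_harmonic_correction[OF blocks g(1) g(2) gaC] ae F(2) by auto
  have polyW: "polyfun W"
    using generated_algebra_polynomial[OF W(1)] polyfun_sqrad sub by blast
  show ?thesis
  proof (intro bexI exI conjI)
    show "(\<lambda>z. H0 z + W z) \<in> ?R" by (intro generated_algebra.add H0 W)
    show "(\<lambda>z. g a z - W z) = (\<lambda>z. F z - (H0 z + W z))" unfolding ga by (simp add: fun_eq_iff)
    show "a + (e - a) = e" using ae by simp
    show "bihomogeneous_poly B a (e - a) (\<lambda>z. g a z - W z)"
      unfolding bihomogeneous_poly_iff[OF sub(1)] CB(1)[symmetric]
      by (intro conjI homogeneous_in_diff real_polynomial_function_diff g gaC W polyW)
    show "\<forall>z. laplacian B (\<lambda>z. g a z - W z) z = 0 \<and> laplacian C (\<lambda>z. g a z - W z) z = 0" by (rule W(4))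
  qed
qed

section \<open>Quadratic forms with two eigenvalues\<close>

text \<open>The second derivatives are homogeneous of degree \<open>0\<close>, hence constant. Euler's relation, applied
to \<open>S\<close> and to its derivatives, expresses \<open>S\<close> by them.\<close>

lemma quadratic_form_operator:
  fixes S :: "'a::euclidean_space \<Rightarrow> real"
  assumes "homogeneous_poly 2 S"
  shows "\<exists>M. linear M \<and> (\<forall>z w. M z \<bullet> w = z \<bullet> M w) \<and> (\<forall>z. S z = z \<bullet> M z) \<and>
    (\<forall>z. (\<Sum>b\<in>Basis. (partial_deriv b S z)\<^sup>2) = 4 * (M z \<bullet> M z))"
proof -
  have S: "polyfun S" "homogeneous_in Basis 2 S"
    using assms by (simp_all add: homogeneous_poly_iff)
  define H where "H c b = partial_deriv c (partial_deriv b S) 0" for c b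
  have grad: "partial_deriv b S z = (\<Sum>c\<in>Basis. (z \<bullet> c) * H c b)" if b: "b \<in> Basis" for b z
  proof -
    have p: "polyfun (partial_deriv b S)" by (rule polyfun_partial_deriv[OF S(1)])
    have h: "homogeneous_in Basis 1 (partial_deriv b S)"
      using homogeneous_in_partial_deriv[OF S order.refl b] by simp
    have "partial_deriv c (partial_deriv b S) z = H c b" if "c \<in> Basis" for c
    proof -
      have "homogeneous_in Basis 0 (partial_deriv c (partial_deriv b S))"
        using homogeneous_in_partial_deriv[OF p h order.refl that] by simp
      then have "partial_deriv c (partial_deriv b S) (dilate Basis 0 z) = partial_deriv c (partial_deriv b S) z"
        by (simp add: homogeneous_in_def)
      then show ?thesis by (simp add: H_def dilate_Basis)
    qed
    then show ?thesis using euler_homogeneous[OF p h order.refl, of z] by simp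
  qed
  define M where "M z = (\<Sum>b\<in>Basis. ((1/2) * (\<Sum>c\<in>Basis. (z \<bullet> c) * H c b)) *\<^sub>R b)" for z
  have lin: "linear M"
  proof (rule linearI)
    have "(\<Sum>c\<in>Basis. ((z + w) \<bullet> c) * H c b) = (\<Sum>c\<in>Basis. (z \<bullet> c) * H c b) + (\<Sum>c\<in>Basis. (w \<bullet> c) * H c b)" for z w b
      by (simp add: inner_add_left distrib_right sum.distrib)
    then show "M (z + w) = M z + M w" for z w
      by (simp only: M_def distrib_left scaleR_add_left sum.distrib)
    have "(\<Sum>c\<in>Basis. ((r *\<^sub>R z) \<bullet> c) * H c b) = r * (\<Sum>c\<in>Basis. (z \<bullet> c) * H c b)" for r z b
      by (simp add: sum_distrib_left mult.assoc)
    then show "M (r *\<^sub>R z) = r *\<^sub>R M z" for r z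
      by (simp only: M_def scaleR_sum_right scaleR_scaleR mult.left_commute[of "1/2" r])
  qed
  have M_Basis: "M z \<bullet> b = (1/2) * partial_deriv b S z" if "b \<in> Basis" for z b
    using that by (simp add: M_def grad)
  have inner: "M z \<bullet> w = (1/2) * (\<Sum>b\<in>Basis. \<Sum>c\<in>Basis. (w \<bullet> b) * ((z \<bullet> c) * H c b))" for z w
    unfolding M_def inner_sum_left
    by (simp add: sum_distrib_left mult_ac inner_commute)
  have sym: "H c b = H b c" for b c unfolding H_def using partial_deriv_commute[OF S(1)] by metis
  have "M z \<bullet> w = M w \<bullet> z" for z w
    unfolding inner by (subst sum.swap) (intro arg_cong[of _ _ "(*) (1/2)"] sum.cong refl, simp only: sym mult_ac)
  then have "M z \<bullet> w = z \<bullet> M w" for z w by (simp only: inner_commute)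
  moreover have "S z = z \<bullet> M z" for z
  proof -
    have "z \<bullet> M z = (\<Sum>b\<in>Basis. (z \<bullet> b) * (M z \<bullet> b))" by (rule euclidean_inner)
    also have "\<dots> = (1/2) * (euler_op Basis S z)"
      by (simp add: M_Basis sum_distrib_left)
    also have "\<dots> = S z" unfolding euler_homogeneous[OF S order.refl] by simp
    finally show ?thesis ..
  qed
  moreover have "(\<Sum>b\<in>Basis. (partial_deriv b S z)\<^sup>2) = 4 * (M z \<bullet> M z)" for z
    unfolding euclidean_inner[of "M z" "M z"] by (simp add: M_Basis sum_distrib_left power2_eq_square)
  ultimately show ?thesis using lin by blast
qed

text \<open>A symmetric isometry is an involution, and the whole space is the orthogonal sum of its eigenspaces for
\<open>1\<close> and \<open>-1\<close>. A bijection from the standard basis to an adapted orthonormal basis defines \<open>T\<close>.\<close>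

lemma involution_diagonalization:
  fixes J :: "'a::euclidean_space \<Rightarrow> 'a"
  assumes lin: "linear J" and sym: "\<And>z w. J z \<bullet> w = z \<bullet> J w" and iso: "\<And>z. J z \<bullet> J z = z \<bullet> z"
  shows "\<exists>(T :: 'a \<Rightarrow> 'a) B. orthogonal_transformation T \<and> B \<subseteq> Basis \<and>
    (\<forall>z. T z \<bullet> J (T z) = sqrad B z - sqrad (Basis - B) z)"
proof -
  have ot: "orthogonal_transformation J"
    unfolding orthogonal_transformation using lin iso by (simp add: norm_eq_sqrt_inner)
  have JJ: "J (J z) = z" for z
  proof (rule euclidean_eqI)
    fix b :: 'a
    show "J (J z) \<bullet> b = z \<bullet> b"
      using sym[of "J z" b] ot by (simp add: orthogonal_transformation_def)
  qed
  define V where "V = {z. J z = z}"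
  define W where "W = {z. J z = - z}"
  have "subspace V" "subspace W"
    unfolding V_def W_def subspace_def by (simp_all add: linear_0[OF lin] linear_add[OF lin] linear_cmul[OF lin])
  obtain X where X: "X \<subseteq> V" "pairwise orthogonal X" "\<And>x. x \<in> X \<Longrightarrow> norm x = 1" "independent X"
      "card X = dim V" "span X = V"
    by (rule orthonormal_basis_subspace[OF \<open>subspace V\<close>]) (rule that; blast)
  obtain Y where Y: "Y \<subseteq> W" "pairwise orthogonal Y" "\<And>x. x \<in> Y \<Longrightarrow> norm x = 1" "independent Y"
      "card Y = dim W" "span Y = W"
    by (rule orthonormal_basis_subspace[OF \<open>subspace W\<close>]) (rule that; blast)
  have VW: "x \<bullet> y = 0" if "x \<in> V" "y \<in> W" for x y
    using sym[of x y] that by (simp add: V_def W_def)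
  have orth: "pairwise orthogonal (X \<union> Y)"
    using X(1,2) Y(1,2) VW unfolding pairwise_def orthogonal_def
    by (auto simp: subset_iff) (metis inner_commute)
  have nrm: "norm e = 1" if "e \<in> X \<union> Y" for e using that X(3) Y(3) by blast
  have "0 \<notin> X \<union> Y" using nrm by force
  then have ind: "independent (X \<union> Y)" using orth pairwise_orthogonal_independent by blast
  have "z \<in> span (X \<union> Y)" for z
  proof -
    have "(1/2) *\<^sub>R (z + J z) \<in> V" "(1/2) *\<^sub>R (z - J z) \<in> W"
      by (simp_all add: V_def W_def linear_add[OF lin] linear_diff[OF lin] linear_cmul[OF lin] JJ algebra_simps)
    then have "(1/2) *\<^sub>R (z + J z) \<in> span (X \<union> Y)" "(1/2) *\<^sub>R (z - J z) \<in> span (X \<union> Y)"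
      using X(6) Y(6) span_mono[of X "X \<union> Y"] span_mono[of Y "X \<union> Y"] by auto
    then have "(1/2) *\<^sub>R (z + J z) + (1/2) *\<^sub>R (z - J z) \<in> span (X \<union> Y)" by (rule span_add)
    moreover have "(1/2) *\<^sub>R (z + J z) + (1/2) *\<^sub>R (z - J z) = z"
      by (simp add: algebra_simps flip: scaleR_add_left)
    ultimately show ?thesis by simp
  qed
  then have span: "span (X \<union> Y) = UNIV" by blast
  then have "card (X \<union> Y) = card (Basis :: 'a set)"
    using ind by (metis dim_UNIV dim_span dim_eq_card_independent)
  moreover have "finite (X \<union> Y)" using ind independent_imp_finite by blast
  ultimately obtain h where h: "bij_betw h (Basis :: 'a set) (X \<union> Y)"
    using finite_same_card_bij[OF finite_Basis, of "X \<union> Y"] by metis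
  have h_inner: "h b \<bullet> h c = (if b = c then 1 else 0)" if "b \<in> Basis" "c \<in> Basis" for b c
  proof (cases "b = c")
    case True
    then show ?thesis using nrm[of "h b"] bij_betwE[OF h] that by (simp add: norm_eq_1)
  next
    case False
    then have "h b \<noteq> h c" using h that unfolding bij_betw_def inj_on_def by blast
    then show ?thesis using orth bij_betwE[OF h] that False unfolding pairwise_def orthogonal_def by simp
  qed
  define T where "T z = (\<Sum>b\<in>Basis. (z \<bullet> b) *\<^sub>R h b)" for z :: 'a
  have linT: "linear T"
    unfolding T_def[abs_def]
    by (intro linear_compose_sum ballI linearI) (simp_all add: inner_add_left scaleR_add_left)
  have T_inner: "T z \<bullet> (\<Sum>c\<in>Basis. k c *\<^sub>R h c) = (\<Sum>b\<in>Basis. (z \<bullet> b) * k b)" for z k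
  proof -
    have "T z \<bullet> (\<Sum>c\<in>Basis. k c *\<^sub>R h c) = (\<Sum>c\<in>Basis. \<Sum>b\<in>Basis. (z \<bullet> b) * (k c * (h b \<bullet> h c)))"
      unfolding T_def inner_sum_left inner_sum_right by (simp add: sum_distrib_left mult_ac)
    also have "\<dots> = (\<Sum>b\<in>Basis. \<Sum>c\<in>Basis. (z \<bullet> b) * (k c * (h b \<bullet> h c)))" by (rule sum.swap)
    also have "\<dots> = (\<Sum>b\<in>Basis. \<Sum>c\<in>Basis. if c = b then (z \<bullet> b) * k b else 0)"
      by (intro sum.cong refl) (simp add: h_inner)
    finally show ?thesis by simp
  qed
  have "T z \<bullet> T z = z \<bullet> z" for z
    using T_inner[of z "\<lambda>b. z \<bullet> b"] unfolding T_def[symmetric] euclidean_inner[of z z] .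
  then have "orthogonal_transformation T"
    unfolding orthogonal_transformation using linT by (simp add: norm_eq_sqrt_inner)
  moreover define B where "B = {b \<in> Basis. h b \<in> X}"
  have "T z \<bullet> J (T z) = sqrad B z - sqrad (Basis - B) z" for z
  proof -
    have sgn: "J (h b) = (if b \<in> B then 1 else -1) *\<^sub>R h b" if "b \<in> Basis" for b
    proof (cases "h b \<in> X")
      case True
      then have "J (h b) = h b" using X(1) by (auto simp: V_def)
      then show ?thesis using True that by (simp add: B_def)
    next
      case False
      then have "h b \<in> Y" using bij_betwE[OF h] that by blast
      then have "J (h b) = - h b" using Y(1) by (auto simp: W_def)
      then show ?thesis using False by (simp add: B_def)
    qed
    have "J (T z) = (\<Sum>b\<in>Basis. ((z \<bullet> b) * (if b \<in> B then 1 else -1)) *\<^sub>R h b)"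
      unfolding T_def linear_sum[OF lin] linear_cmul[OF lin]
      by (intro sum.cong refl) (simp only: sgn scaleR_scaleR)
    then have "T z \<bullet> J (T z) = (\<Sum>b\<in>Basis. (z \<bullet> b) * ((z \<bullet> b) * (if b \<in> B then 1 else -1)))"
      using T_inner by simp
    also have "\<dots> = (\<Sum>b\<in>B. (z \<bullet> b)\<^sup>2) + (\<Sum>b\<in>Basis - B. - (z \<bullet> b)\<^sup>2)"
    proof -
      have "B \<subseteq> Basis" by (auto simp: B_def)
      then show ?thesis
        unfolding sum_Basis_split[OF \<open>B \<subseteq> Basis\<close>]
        by (intro arg_cong2[of _ _ _ _ "(+)"] sum.cong refl) (auto simp: power2_eq_square)
    qed
    also have "\<dots> = sqrad B z - sqrad (Basis - B) z"
      by (subst (1 2) sqrad_eq_sum) (auto simp: B_def sum_negf)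
    finally show ?thesis .
  qed
  ultimately show ?thesis by (intro exI[of _ T] exI[of _ B]) (auto simp: B_def)
qed

text \<open>Completing the square in \<open>M\<^sup>2 = \<alpha> + \<beta> M\<close> shows that \<open>N = M - \<beta>/2\<close> stretches all lengths by the same factor
\<open>\<surd>\<gamma>\<close>. This factor is nonzero because \<open>M\<close> is not a multiple of the identity, and \<open>N / \<surd>\<gamma>\<close> is then a
symmetric isometry.\<close>

lemma two_eigenvalue_diagonalization:
  fixes M :: "'a::euclidean_space \<Rightarrow> 'a"
  assumes lin: "linear M" and sym: "\<And>z w. M z \<bullet> w = z \<bullet> M w"
    and quad: "\<And>z. M z \<bullet> M z = \<alpha> * (z \<bullet> z) + \<beta> * (z \<bullet> M z)"
    and nonscalar: "\<And>r. \<exists>z. z \<bullet> M z \<noteq> r * (z \<bullet> z)"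
  shows "\<exists>(T :: 'a \<Rightarrow> 'a) B r s. orthogonal_transformation T \<and> B \<subseteq> Basis \<and> s \<noteq> 0 \<and>
    (\<forall>z. T z \<bullet> M (T z) = r * (norm z)\<^sup>2 + s * (sqrad B z - sqrad (Basis - B) z))"
proof -
  define N where "N z = M z - (\<beta>/2) *\<^sub>R z" for z
  define \<gamma> where "\<gamma> = \<alpha> + \<beta>\<^sup>2 / 4"
  have NN: "N z \<bullet> N z = \<gamma> * (z \<bullet> z)" for z
    using quad[of z]
    by (simp add: N_def \<gamma>_def inner_diff_left inner_diff_right inner_commute power2_eq_square algebra_simps)
  obtain z1 where z1: "z1 \<bullet> M z1 \<noteq> (\<beta>/2) * (z1 \<bullet> z1)" using nonscalar by blast
  have "N z1 \<noteq> 0"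
  proof
    assume "N z1 = 0"
    then have "M z1 = (\<beta>/2) *\<^sub>R z1" by (simp add: N_def)
    with z1 show False by simp
  qed
  then have "0 < \<gamma> * (z1 \<bullet> z1)" unfolding NN[symmetric] by simp
  then have \<gamma>: "\<gamma> > 0" by (simp add: zero_less_mult_iff) (smt (verit) inner_ge_zero)
  define s where "s = sqrt \<gamma>"
  have s: "s > 0" "s * s = \<gamma>" using \<gamma> by (simp_all add: s_def)
  define J where "J z = (1/s) *\<^sub>R N z" for z
  have MJ: "M z = (\<beta>/2) *\<^sub>R z + s *\<^sub>R J z" for z using s by (simp add: J_def N_def)
  have J1: "linear J"
    unfolding J_def[abs_def] N_def using lin
    by (intro linear_compose_scale_right linear_compose_sub linear_compose_scale_right linear_id[unfolded id_def])
  have J2: "J z \<bullet> w = z \<bullet> J w" for z w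
    using sym[of z w] by (simp add: J_def N_def inner_diff_left inner_diff_right)
  have J3: "J z \<bullet> J z = z \<bullet> z" for z
    using NN[of z] s \<gamma> by (simp add: J_def field_simps)
  obtain T :: "'a \<Rightarrow> 'a" and B where TB: "orthogonal_transformation T" "B \<subseteq> Basis"
    "\<And>z. T z \<bullet> J (T z) = sqrad B z - sqrad (Basis - B) z"
    using involution_diagonalization[OF J1 J2 J3] by blast
  have "T z \<bullet> M (T z) = (\<beta>/2) * (norm z)\<^sup>2 + s * (sqrad B z - sqrad (Basis - B) z)" for z
    using orthogonal_transformation_norm[OF TB(1), of z]
    by (simp add: MJ inner_add_right TB(3) flip: power2_norm_eq_inner)
  then show ?thesis
    using TB(1,2) s(1)
    by - (rule exI[of _ T], rule exI[of _ B], rule exI[of _ "\<beta>/2"], rule exI[of _ s], simp)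
qed

section \<open>Orthogonal changes of coordinates\<close>

lemma generated_algebra_compose:
  assumes "f \<in> generated_algebra G"
  shows "f \<circ> T \<in> generated_algebra ((\<lambda>g. g \<circ> T) ` G)"
  using assms
proof induction
  case (const c)
  show ?case using generated_algebra.const[of c] by (simp add: o_def)
next
  case (gen f)
  then show ?case by (intro generated_algebra.gen) simp
next
  case (add f g)
  then show ?case using generated_algebra.add[of "f \<circ> T" _ "g \<circ> T"] by (simp add: o_def)
next
  case (mult f g)
  then show ?case using generated_algebra.mult[of "f \<circ> T" _ "g \<circ> T"] by (simp add: o_def)
qed

lemma generated_algebra_composeD:
  assumes "f \<in> generated_algebra ((\<lambda>g. g \<circ> T) ` G)"
  shows "\<exists>g\<in>generated_algebra G. f = g \<circ> T"
  using assms
proof induction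
  case (const c)
  show ?case by (rule bexI[of _ "\<lambda>z. c"]) (auto intro: generated_algebra.const)
next
  case (gen f)
  then show ?case by (auto intro: generated_algebra.gen)
next
  case (add f g)
  then obtain f' g' where "f' \<in> generated_algebra G" "g' \<in> generated_algebra G" "f = f' \<circ> T" "g = g' \<circ> T" by blast
  then show ?case by (intro bexI[of _ "\<lambda>z. f' z + g' z"] generated_algebra.add) auto
next
  case (mult f g)
  then obtain f' g' where "f' \<in> generated_algebra G" "g' \<in> generated_algebra G" "f = f' \<circ> T" "g = g' \<circ> T" by blast
  then show ?case by (intro bexI[of _ "\<lambda>z. f' z * g' z"] generated_algebra.mult) auto
qed

lemma laplacian_compose_orthogonal:
  fixes f :: "'a::euclidean_space \<Rightarrow> real" and T :: "'a \<Rightarrow> 'a"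
  assumes T: "orthogonal_transformation T" and f: "polyfun f"
  shows "laplacian Basis (f \<circ> T) = laplacian Basis f \<circ> T"
proof -
  have bl: "bounded_linear T"
    using orthogonal_transformation_linear[OF T] linear_conv_bounded_linear by blast
  have sum_cd: "(\<Sum>b\<in>Basis. (T b \<bullet> c) * (T b \<bullet> d)) = c \<bullet> d" for c d
  proof -
    obtain c' d' where cd: "c = T c'" "d = T d'"
      using orthogonal_transformation_surj[OF T] by (metis surjD)
    have "(\<Sum>b\<in>Basis. (T b \<bullet> c) * (T b \<bullet> d)) = (\<Sum>b\<in>Basis. (c' \<bullet> b) * (d' \<bullet> b))"
      using T by (simp add: cd orthogonal_transformation_def inner_commute)
    then show ?thesis
      using T by (simp add: cd orthogonal_transformation_def euclidean_inner[of c' d'])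
  qed
  have "partial_deriv b (partial_deriv b (\<lambda>z. f (T z))) z =
      (\<Sum>c\<in>Basis. \<Sum>d\<in>Basis. (T b \<bullet> c) * (T b \<bullet> d) * partial_deriv d (partial_deriv c f) (T z))" for b z
  proof -
    have "polyfun (\<lambda>z. partial_deriv c f (T z))" for c
      by (intro polyfun_compose_linear[OF _ bl] polyfun_partial_deriv f)
    then show ?thesis
      unfolding partial_deriv_compose_linear[OF f bl]
      by (simp add: partial_deriv_sum partial_deriv_cmult polynomial_intros
          partial_deriv_compose_linear[OF polyfun_partial_deriv[OF f] bl]
          sum_distrib_left mult.assoc)
  qed
  then have "laplacian Basis (\<lambda>z. f (T z)) z =
      (\<Sum>b\<in>Basis. \<Sum>c\<in>Basis. \<Sum>d\<in>Basis. (T b \<bullet> c) * (T b \<bullet> d) * partial_deriv d (partial_deriv c f) (T z))" for z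
    by (simp add: laplacian_def)
  also have "\<dots> z = (\<Sum>c\<in>Basis. \<Sum>d\<in>Basis. (\<Sum>b\<in>Basis. (T b \<bullet> c) * (T b \<bullet> d)) * partial_deriv d (partial_deriv c f) (T z))" for z
    unfolding sum_distrib_right by (subst sum.swap) (intro sum.cong refl sum.swap)
  also have "\<dots> z = (\<Sum>c\<in>Basis. \<Sum>d\<in>Basis. if d = c then partial_deriv c (partial_deriv c f) (T z) else 0)" for z
    unfolding sum_cd by (intro sum.cong refl) (auto simp: inner_Basis)
  finally have "laplacian Basis (\<lambda>z. f (T z)) z = laplacian Basis f (T z)" for z
    by (simp add: laplacian_def)
  then show ?thesis by (intro ext) (simp add: o_def)
qed

section \<open>Structure of the graded algebra\<close>

lemma degree_two_part:
  assumes g: "homogeneous_in Basis 2 g1" "homogeneous_in Basis 2 g2" "homogeneous_in Basis e g3" "2 < e"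
    and f: "f \<in> generated_algebra {g1, g2, g3}" "homogeneous_in Basis 2 f"
  shows "\<exists>\<alpha> \<beta>. \<forall>z. f z = \<alpha> * g1 z + \<beta> * g2 z"
proof -
  have "f \<in> monomial_span g1 g2 g3 (\<lambda>k l m. True \<and> 2 * k + 2 * l + e * m = 2)"
    using f by (intro monomial_span_homogeneous[OF g(1-3)]) (simp_all add: generated_algebra_eq_monomial_span)
  then show ?thesis
  proof (rule monomial_span_eq_two_terms)
    fix k l m assume "True \<and> 2 * k + 2 * l + e * m = 2"
    then have "m = 0 \<and> (k = 1 \<and> l = 0 \<or> k = 0 \<and> l = 1)"
      using g(4) by (cases m) auto
    then show "(\<lambda>z. g1 z ^ k * g2 z ^ l * g3 z ^ m) = g1 \<or> (\<lambda>z. g1 z ^ k * g2 z ^ l * g3 z ^ m) = g2"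
      by auto
  qed
qed

lemma sum_partial_deriv_squares_in_algebra:
  fixes S :: "'a::euclidean_space \<Rightarrow> real"
  assumes S: "polyfun S" "S \<in> generated_algebra G"
    and closed: "\<And>f. f \<in> generated_algebra G \<Longrightarrow> laplacian Basis f \<in> generated_algebra G"
  shows "(\<lambda>z. \<Sum>b\<in>Basis. (partial_deriv b S z)\<^sup>2) \<in> generated_algebra G"
proof -
  have "(\<lambda>z. \<Sum>b\<in>Basis. (partial_deriv b S z)\<^sup>2) =
      (\<lambda>z. (1/2) * (laplacian Basis (\<lambda>z. S z * S z) z - 2 * (S z * laplacian Basis S z)))"
    by (simp add: laplacian_mult S(1) power2_eq_square)
  then show ?thesis
    by (simp only:) (intro generated_algebra_cmult generated_algebra_diff generated_algebra.mult closed S)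
qed

text \<open>All arguments about \<open>u\<close>, \<open>v\<close> take place in the algebra of the functions \<open>f \<circ> T\<close>, which is generated by
\<open>u\<close>, \<open>v\<close>, \<open>F \<circ> T\<close> and is closed under the Laplacian because \<open>T\<close> is orthogonal.\<close>

theorem graded_laplacian_algebra_structure:
  fixes S F :: "'a::euclidean_space \<Rightarrow> real"
  assumes S: "homogeneous_poly 2 S"
    and indep: "\<And>\<alpha> \<beta>. (\<forall>z. \<alpha> * (norm z)\<^sup>2 + \<beta> * S z = 0) \<Longrightarrow> \<alpha> = 0 \<and> \<beta> = 0"
    and F: "2 < e" "homogeneous_poly e F" "F \<notin> generated_algebra {\<lambda>z. (norm z)\<^sup>2, S}"
    and A: "laplacian_algebra (generated_algebra {\<lambda>z. (norm z)\<^sup>2, S, F})"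
  shows "\<exists>(T :: 'a \<Rightarrow> 'a) B. orthogonal_transformation T \<and> B \<subseteq> Basis \<and>
    (\<exists>c d c' d'. c * d' - d * c' \<noteq> 0 \<and>
      (\<forall>z. sqrad B z = c * (norm (T z))\<^sup>2 + d * S (T z)) \<and>
      (\<forall>z. sqrad (Basis - B) z = c' * (norm (T z))\<^sup>2 + d' * S (T z))) \<and>
    {f \<circ> T | f. f \<in> generated_algebra {\<lambda>z. (norm z)\<^sup>2, S, F} \<and> homogeneous_poly 2 f} =
      {\<lambda>z. \<alpha> * sqrad B z + \<beta> * sqrad (Basis - B) z | \<alpha> \<beta>. True} \<and>
    (\<exists>H\<in>generated_algebra {sqrad B, sqrad (Basis - B)}. \<exists>P a b.
      P = (\<lambda>z. F (T z) - H z) \<and> a + b = e \<and> bihomogeneous_poly B a b P \<and>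
      (\<forall>z. laplacian B P z = 0 \<and> laplacian (Basis - B) P z = 0))"
proof -
  define R where "R = (\<lambda>z :: 'a. (norm z)\<^sup>2)"
  let ?A = "generated_algebra {R, S, F}"
  have closed: "laplacian Basis f \<in> ?A" if "f \<in> ?A" for f
    using A that unfolding laplacian_algebra_def R_def by blast
  have R: "R = sqrad Basis" by (simp add: R_def fun_eq_iff sqrad_Basis)
  have polyS: "polyfun S" "homogeneous_in Basis 2 S"
    and polyF: "polyfun F" "homogeneous_in Basis e F"
    and polyR: "polyfun R" "homogeneous_in Basis 2 R"
    using S F(2) polyfun_sqrad[OF order.refl] homogeneous_in_sqrad[OF order.refl]
    by (simp_all add: homogeneous_poly_iff R)
  have polyA: "polyfun f" if "f \<in> ?A" for f
    using generated_algebra_polynomial[OF that] polyS(1) polyF(1) polyR(1) by blast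
  obtain M where M: "linear M" "\<And>z w. M z \<bullet> w = z \<bullet> M w" "\<And>z. S z = z \<bullet> M z"
    "\<And>z. (\<Sum>b\<in>Basis. (partial_deriv b S z)\<^sup>2) = 4 * (M z \<bullet> M z)"
    using quadratic_form_operator[OF S] by blast
  have "(\<lambda>z. \<Sum>b\<in>Basis. (partial_deriv b S z)\<^sup>2) \<in> ?A"
    by (rule sum_partial_deriv_squares_in_algebra[OF polyS(1) _ closed]) (auto intro: generated_algebra.gen)
  moreover have "homogeneous_in Basis 2 (\<lambda>z. \<Sum>b\<in>Basis. (partial_deriv b S z)\<^sup>2)"
    unfolding homogeneous_in_def dilate_Basis M(4) by (simp add: linear_cmul[OF M(1)] power2_eq_square)
  ultimately obtain \<alpha> \<beta> where "\<And>z. (\<Sum>b\<in>Basis. (partial_deriv b S z)\<^sup>2) = \<alpha> * R z + \<beta> * S z"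
    using degree_two_part[OF polyR(2) polyS(2) polyF(2) F(1)] by blast
  then have quad: "M z \<bullet> M z = (\<alpha>/4) * (z \<bullet> z) + (\<beta>/4) * (z \<bullet> M z)" for z
    using M(3,4)[of z] by (simp add: R_def power2_norm_eq_inner)
  have nonscalar: "\<exists>z. z \<bullet> M z \<noteq> r * (z \<bullet> z)" for r
    using indep[of r "-1"] by (simp add: M(3) power2_norm_eq_inner) metis
  obtain T :: "'a \<Rightarrow> 'a" and B r s where T: "orthogonal_transformation T" and B: "B \<subseteq> Basis" and s: "s \<noteq> 0"
    and ST: "\<And>z. T z \<bullet> M (T z) = r * (norm z)\<^sup>2 + s * (sqrad B z - sqrad (Basis - B) z)"
    using two_eigenvalue_diagonalization[OF M(1,2) quad nonscalar] by blast
  define C where "C = Basis - B"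
  have blocks: "B \<inter> C = {}" "B \<union> C = Basis" using B by (auto simp: C_def)
  have RT: "R (T z) = sqrad B z + sqrad C z" for z
    unfolding C_def sqrad_split[OF B] R_def orthogonal_transformation_norm[OF T] ..
  have ST': "S (T z) = (r + s) * sqrad B z + (r - s) * sqrad C z" for z
    unfolding M(3) ST sqrad_split[OF B, symmetric] C_def by (simp add: algebra_simps)
  define c d c' d' where "c = (s - r) / (2 * s)" and "d = 1 / (2 * s)"
    and "c' = (s + r) / (2 * s)" and "d' = - 1 / (2 * s)"
  have u: "sqrad B z = c * R (T z) + d * S (T z)" and v: "sqrad C z = c' * R (T z) + d' * S (T z)" for z
    unfolding RT ST' c_def d_def c'_def d'_def using s by (simp_all add: field_simps)
  have det: "c * d' - d * c' \<noteq> 0"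
  proof -
    have "c * d' - d * c' = - 1 / (2 * s)"
      unfolding c_def d_def c'_def d'_def using s by (simp add: field_simps)
    then show ?thesis using s by simp
  qed
  have surj: "\<exists>w. T w = z" for z
    using orthogonal_transformation_surj[OF T] by (metis surjD)
  \<comment> \<open>A block without coordinates would make \<open>u\<close> or \<open>v\<close> vanish and thus \<open>R\<close>, \<open>S\<close> dependent.\<close>
  have dep: False if "\<And>z. c1 * R (T z) + d1 * S (T z) = 0" "d1 \<noteq> 0" for c1 d1
  proof -
    have "c1 * (norm z)\<^sup>2 + d1 * S z = 0" for z
      using that(1) surj[of z] by (auto simp: R_def)
    with indep[of c1 d1] that(2) show False by blast
  qed
  have "B \<noteq> {}"
  proof
    assume "B = {}"
    then have "sqrad B z = 0" for z by (simp add: sqrad_def part_def)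
    with u dep[of c d] s show False by (simp add: d_def)
  qed
  moreover have "C \<noteq> {}"
  proof
    assume "C = {}"
    then have "sqrad C z = 0" for z by (simp add: sqrad_def part_def)
    with v dep[of c' d'] s show False by (simp add: d'_def)
  qed
  ultimately have nonempty: "B \<noteq> {}" "C \<noteq> {}" by auto
  have sub: "{sqrad B, sqrad C} \<subseteq> generated_algebra {R \<circ> T, S \<circ> T}"
  proof -
    have "(\<lambda>z. k * (R \<circ> T) z + l * (S \<circ> T) z) \<in> generated_algebra {R \<circ> T, S \<circ> T}" for k l
      by (intro generated_algebra.add generated_algebra_cmult generated_algebra.gen) auto
    from this[of c d] this[of c' d'] show ?thesis by (simp flip: u v)
  qed
  have sub': "{R \<circ> T, S \<circ> T} \<subseteq> radial_algebra B C"
  proof -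
    have comb: "(\<lambda>z. k * sqrad B z + l * sqrad C z) \<in> radial_algebra B C" for k l
      by (intro generated_algebra.add generated_algebra_cmult generated_algebra.gen) auto
    have "R \<circ> T = (\<lambda>z. 1 * sqrad B z + 1 * sqrad C z)"
      "S \<circ> T = (\<lambda>z. (r + s) * sqrad B z + (r - s) * sqrad C z)"
      using RT ST' by (simp_all add: fun_eq_iff)
    with comb[of 1 1] comb[of "r + s" "r - s"] show ?thesis by simp
  qed
  have two: "radial_algebra B C = generated_algebra {R \<circ> T, S \<circ> T}"
    using generated_algebra_subset[OF sub] generated_algebra_subset[OF sub'] by blast
  have three: "generated_algebra {sqrad B, sqrad C, F \<circ> T} = generated_algebra ((\<lambda>g. g \<circ> T) ` {R, S, F})"
  proof -
    have 1: "{sqrad B, sqrad C, F \<circ> T} \<subseteq> generated_algebra {R \<circ> T, S \<circ> T, F \<circ> T}"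
      using sub generated_algebra_mono[of "{R \<circ> T, S \<circ> T}" "{R \<circ> T, S \<circ> T, F \<circ> T}"]
        generated_algebra.gen[of "F \<circ> T" "{R \<circ> T, S \<circ> T, F \<circ> T}"] by blast
    have 2: "{R \<circ> T, S \<circ> T, F \<circ> T} \<subseteq> generated_algebra {sqrad B, sqrad C, F \<circ> T}"
      using sub' generated_algebra_mono[of "{sqrad B, sqrad C}" "{sqrad B, sqrad C, F \<circ> T}"]
        generated_algebra.gen[of "F \<circ> T" "{sqrad B, sqrad C, F \<circ> T}"] by blast
    show ?thesis using generated_algebra_subset[OF 1] generated_algebra_subset[OF 2] by simp
  qed
  have closed': "laplacian Basis f \<in> generated_algebra {sqrad B, sqrad C, F \<circ> T}"
    if f: "f \<in> generated_algebra {sqrad B, sqrad C, F \<circ> T}" for f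
  proof -
    obtain g where g: "g \<in> ?A" "f = g \<circ> T"
      using generated_algebra_composeD[OF f[unfolded three]] by blast
    show ?thesis
      unfolding g(2) laplacian_compose_orthogonal[OF T polyA[OF g(1)]] three
      by (intro generated_algebra_compose closed g)
  qed
  have bl: "bounded_linear T"
    using orthogonal_transformation_linear[OF T] linear_conv_bounded_linear by blast
  have FT: "homogeneous_poly e (F \<circ> T)"
    using polyfun_compose_linear[OF polyF(1) bl] polyF(2)
    by (simp add: homogeneous_poly_iff homogeneous_in_def dilate_Basis o_def linear_cmul[OF bounded_linear.linear[OF bl]])
  have nin: "F \<circ> T \<notin> radial_algebra B C"
  proof
    assume "F \<circ> T \<in> radial_algebra B C"
    then have "F \<circ> T \<in> generated_algebra ((\<lambda>g. g \<circ> T) ` {R, S})" by (simp add: two)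
    from generated_algebra_composeD[OF this]
    obtain g where g: "g \<in> generated_algebra {R, S}" "F \<circ> T = g \<circ> T" by blast
    have "F z = g z" for z using surj[of z] fun_cong[OF g(2)] by auto
    then have "F = g" by blast
    with g(1) F(3) show False by (simp add: R_def)
  qed
  obtain H P a b where HP: "H \<in> radial_algebra B C" "P = (\<lambda>z. (F \<circ> T) z - H z)"
    "a + b = e" "bihomogeneous_poly B a b P" "\<forall>z. laplacian B P z = 0 \<and> laplacian C P z = 0"
    using separately_harmonic_generator[OF blocks nonempty FT F(1) nin closed'] by blast
  have "{f \<circ> T | f. f \<in> ?A \<and> homogeneous_poly 2 f} = {\<lambda>z. \<alpha> * sqrad B z + \<beta> * sqrad C z | \<alpha> \<beta>. True}"
  proof (intro equalityI subsetI)
    fix h assume "h \<in> {f \<circ> T | f. f \<in> ?A \<and> homogeneous_poly 2 f}"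
    then obtain f where f: "f \<in> ?A" "homogeneous_in Basis 2 f" "h = f \<circ> T"
      by (auto simp: homogeneous_poly_iff)
    obtain \<alpha> \<beta> where "\<forall>z. f z = \<alpha> * R z + \<beta> * S z"
      using degree_two_part[OF polyR(2) polyS(2) polyF(2) F(1) f(1,2)] by blast
    then have "h = (\<lambda>z. (\<alpha> + \<beta> * (r + s)) * sqrad B z + (\<alpha> + \<beta> * (r - s)) * sqrad C z)"
      by (simp add: f(3) fun_eq_iff RT ST' algebra_simps)
    then show "h \<in> {\<lambda>z. \<alpha> * sqrad B z + \<beta> * sqrad C z | \<alpha> \<beta>. True}" by blast
  next
    fix h assume "h \<in> {\<lambda>z. \<alpha> * sqrad B z + \<beta> * sqrad C z | \<alpha> \<beta>. True}"
    then obtain \<alpha> \<beta> where h: "h = (\<lambda>z. \<alpha> * sqrad B z + \<beta> * sqrad C z)" by blast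
    define f where "f = (\<lambda>z. (\<alpha> * c + \<beta> * c') * R z + (\<alpha> * d + \<beta> * d') * S z)"
    have "f \<in> ?A" unfolding f_def
      by (intro generated_algebra.add generated_algebra_cmult generated_algebra.gen) auto
    moreover have "homogeneous_poly 2 f"
      unfolding f_def homogeneous_poly_iff
      by (intro conjI polynomial_intros homogeneous_in_add homogeneous_in_cmult polyR polyS)
    moreover have "h = f \<circ> T" by (simp add: h f_def fun_eq_iff u v algebra_simps)
    ultimately show "h \<in> {f \<circ> T | f. f \<in> ?A \<and> homogeneous_poly 2 f}" by blast
  qed
  then have deg2: "{f \<circ> T | f. f \<in> generated_algebra {\<lambda>z. (norm z)\<^sup>2, S, F} \<and> homogeneous_poly 2 f} =
      {\<lambda>z. \<alpha> * sqrad B z + \<beta> * sqrad (Basis - B) z | \<alpha> \<beta>. True}"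
    unfolding R_def C_def .
  have uv: "\<forall>z. sqrad B z = c * (norm (T z))\<^sup>2 + d * S (T z)"
    "\<forall>z. sqrad (Basis - B) z = c' * (norm (T z))\<^sup>2 + d' * S (T z)"
    using u v by (simp_all add: R_def C_def)
  have "\<exists>c d c' d'. c * d' - d * c' \<noteq> 0 \<and>
      (\<forall>z. sqrad B z = c * (norm (T z))\<^sup>2 + d * S (T z)) \<and>
      (\<forall>z. sqrad (Basis - B) z = c' * (norm (T z))\<^sup>2 + d' * S (T z))"
    by (rule exI[of _ c], rule exI[of _ d], rule exI[of _ c'], rule exI[of _ d'])
      (intro conjI det uv)
  moreover have "\<exists>H\<in>generated_algebra {sqrad B, sqrad (Basis - B)}. \<exists>P a b.
      P = (\<lambda>z. F (T z) - H z) \<and> a + b = e \<and> bihomogeneous_poly B a b P \<and>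
      (\<forall>z. laplacian B P z = 0 \<and> laplacian (Basis - B) P z = 0)"
    using HP unfolding C_def o_def by (intro bexI[of _ H]) blast+
  ultimately show ?thesis using T B deg2 by (intro exI[of _ T] exI[of _ B] conjI)
qed

section \<open>The classification\<close>

theorem proposition6p1:
  "(\<forall>(S :: 'a::euclidean_space \<Rightarrow> real) F e.
      homogeneous_poly 2 S \<and>
      (\<forall>\<alpha> \<beta>. (\<forall>z. \<alpha> * (norm z)\<^sup>2 + \<beta> * S z = 0) \<longrightarrow> \<alpha> = 0 \<and> \<beta> = 0) \<and>
      2 < e \<and> homogeneous_poly e F \<and>
      F \<notin> generated_algebra {\<lambda>z. (norm z)\<^sup>2, S} \<and>
      laplacian_algebra (generated_algebra {\<lambda>z. (norm z)\<^sup>2, S, F})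
      \<longrightarrow>
      (\<exists>(T :: 'a \<Rightarrow> 'a) B. orthogonal_transformation T \<and> B \<subseteq> Basis \<and>
         (\<exists>c d c' d'. c * d' - d * c' \<noteq> 0 \<and>
            (\<forall>z. sqrad B z = c * (norm (T z))\<^sup>2 + d * S (T z)) \<and>
            (\<forall>z. sqrad (Basis - B) z = c' * (norm (T z))\<^sup>2 + d' * S (T z))) \<and>
         {f \<circ> T | f. f \<in> generated_algebra {\<lambda>z. (norm z)\<^sup>2, S, F} \<and> homogeneous_poly 2 f} =
           {\<lambda>z. \<alpha> * sqrad B z + \<beta> * sqrad (Basis - B) z | \<alpha> \<beta>. True} \<and>
         (\<exists>H\<in>generated_algebra {sqrad B, sqrad (Basis - B)}. \<exists>P a b.
            P = (\<lambda>z. F (T z) - H z) \<and> a + b = e \<and> bihomogeneous_poly B a b P \<and>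
            (\<forall>z. laplacian B P z = 0 \<and> laplacian (Basis - B) P z = 0))))
   \<and>
   (\<forall>(B :: 'a set) P a b.
      B \<subseteq> Basis \<and> 2 \<le> card B \<and> 2 \<le> card (Basis - B) \<and>
      0 < a \<and> 0 < b \<and> 2 < a + b \<and>
      P \<noteq> (\<lambda>z. 0) \<and> bihomogeneous_poly B a b P \<and>
      (\<forall>z. laplacian B P z = 0 \<and> laplacian (Basis - B) P z = 0)
      \<longrightarrow>
      (laplacian_algebra (generated_algebra {sqrad B, sqrad (Basis - B), P}) \<longleftrightarrow>
         (\<exists>K L. K > 0 \<and>
            (\<forall>z. (norm (grad B P z))\<^sup>2 = (real a)\<^sup>2 *
                (K * sqrad B z ^ (a - 1) * sqrad (Basis - B) z ^ b +
                 (if even a \<and> even b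
                  then L * sqrad B z ^ (a div 2 - 1) * sqrad (Basis - B) z ^ (b div 2) * P z
                  else 0))) \<and>
            (\<forall>z. (norm (grad (Basis - B) P z))\<^sup>2 = (real b)\<^sup>2 *
                (K * sqrad B z ^ a * sqrad (Basis - B) z ^ (b - 1) +
                 (if even a \<and> even b
                  then L * sqrad B z ^ (a div 2) * sqrad (Basis - B) z ^ (b div 2 - 1) * P z
                  else 0))))) \<and>
      (laplacian_algebra (generated_algebra {sqrad B, sqrad (Basis - B), P}) \<longrightarrow>
         (real (card B) - 2) / real a = (real (card (Basis - B)) - 2) / real b \<and>
         isoparametric_on (sphere_product B) P))"
  (is "(\<forall>S F e. ?graded S F e \<longrightarrow> ?shape S F e) \<and> (\<forall>B P a b. ?harmonic B P a b \<longrightarrow> ?result B P a b)")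
proof (rule conjI)
  show "\<forall>S F e. ?graded S F e \<longrightarrow> ?shape S F e"
  proof (intro allI impI)
    fix S F e
    assume "?graded S F e"
    then show "?shape S F e" by (intro graded_laplacian_algebra_structure) blast+
  qed
next
  show "\<forall>B P a b. ?harmonic B P a b \<longrightarrow> ?result B P a b"
  proof (intro allI impI, elim conjE)
    fix B :: "'a set" and P a b
    assume B: "B \<subseteq> Basis" "2 \<le> card B" "2 \<le> card (Basis - B)" and ab: "0 < a" "0 < b"
      and P: "P \<noteq> (\<lambda>z. 0)" "bihomogeneous_poly B a b P"
        "\<forall>z. laplacian B P z = 0 \<and> laplacian (Basis - B) P z = 0"
    interpret separately_harmonic B "Basis - B" P a b
    proof unfold_locales
      show "polyfun P" "homogeneous_in B a P" "homogeneous_in (Basis - B) b P"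
        using P(2) unfolding bihomogeneous_poly_iff[OF B(1)] by blast+
      show "\<exists>z. P z \<noteq> 0" using P(1) by auto
    qed (use B ab P(3) in auto)
    show "?result B P a b"
      using closed_iff_gradient_identities dimensions_of_closed isoparametric_on_sphere_product by blast
  qed
qed

end
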